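(* Let $m\ge 3$ and let $G=W(C_m)$ be the whisker graph on the cycle $C_m$. Then for each $1\le k\le \nu(G)=m$, we have $$2k+\left\lfloor\frac{m-k-1}{2}\right\rfloor\le \operatorname{reg}\bigl(I(G)^{[k]}\bigr)\le 2k+\left\lfloor\frac{m-k}{2}\right\rfloor.$$
   Context: All graphs are finite and simple. Fix a field $\mathbb{K}$. For a graph $G$ with vertex set $V(G)$ (vertices are identified with indeterminates), $R=\mathbb{K}[x\mid x\in V(G)]$ and $I(G)=\langle xy\mid \{x,y\}\in E(G)\rangle\subseteq R$ is the edge ideal. A $k$-matching of $G$ is a set of $k$ pairwise disjoint edges; $\nu(G)$ is the maximum cardinality of a matching. The $k$-th square-free power $I(G)^{[k]}$ is the ideal of $R$ generated by the square-free monomials of $I(G)^k$; equivalently it is generated by the products $\prod_{x\in \bigcup_{e\in M}e}x$ over all $k$-matchings $M$ of $G$. For a nonzero graded ideal $J\subseteq R$ with graded Betti numbers $\beta_{i,j}(J)$ (of $J$ as an $R$-module), $\operatorname{reg}(J)=\max\{j-i\mid \beta_{i,j}(J)\ne 0\}$. The whiskered cycle $W(C_m)$ has vertices $x_1,\dots,x_m,y_1,\dots,y_m$ and edges $\{x_i,x_{i+1}\}$ ($1\le i\le m-1$), $\{x_1,x_m\}$, and $\{x_i,y_i\}$ ($1\le i\le m$). *)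

theory Defs
  imports
    "HOL-Library.Poly_Mapping"
    "HOL-Algebra.Ideal_Product"
    "Jordan_Normal_Form.Matrix_Kernel"
begin

section \<open>Polynomial rings\<close>

text \<open>
  An exponent vector is a finitely supported map from variables to \<open>nat\<close>, and a polynomial
  is a finitely supported map from exponent vectors to the coefficient field; the product of
  \<^theory>\<open>HOL-Library.Poly_Mapping\<close> is convolution, i.e. multiplication of polynomials.
\<close>

type_synonym 'v monomial = "'v \<Rightarrow>\<^sub>0 nat"
type_synonym ('v, 'k) mpoly = "'v monomial \<Rightarrow>\<^sub>0 'k"

definition mdeg :: "'v monomial \<Rightarrow> nat" where
  "mdeg e = (\<Sum>x\<in>Poly_Mapping.keys e. Poly_Mapping.lookup e x)"

definition indet :: "'v \<Rightarrow> ('v, 'k::field) mpoly" where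
  "indet x = Poly_Mapping.single (Poly_Mapping.single x 1) 1"

definition poly_ring :: "'v set \<Rightarrow> ('v, 'k::field) mpoly ring" where
  "poly_ring V =
     \<lparr>carrier = {p. \<forall>e\<in>Poly_Mapping.keys p. Poly_Mapping.keys e \<subseteq> V},
      mult = (*), one = 1, zero = 0, add = (+)\<rparr>"

lemma cring_poly_ring: "cring (poly_ring V :: ('v, 'k::field) mpoly ring)"
proof -
  let ?R = "poly_ring V :: ('v, 'k) mpoly ring"
  have mult_closed: "x * y \<in> carrier ?R" if "x \<in> carrier ?R" "y \<in> carrier ?R" for x y
  proof -
    have "Poly_Mapping.keys e \<subseteq> V" if e: "e \<in> Poly_Mapping.keys (x * y)" for e
    proof -
      obtain a b where "a \<in> Poly_Mapping.keys x" "b \<in> Poly_Mapping.keys y" "e = a + b"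
        using e keys_mult[of x y] by blast
      moreover have "Poly_Mapping.keys (a + b) \<subseteq> Poly_Mapping.keys a \<union> Poly_Mapping.keys b"
        by (rule keys_add)
      ultimately show ?thesis
        using \<open>x \<in> _\<close> \<open>y \<in> _\<close> by (fastforce simp: poly_ring_def)
    qed
    then show ?thesis by (simp add: poly_ring_def)
  qed
  have add_closed: "x + y \<in> carrier ?R" if "x \<in> carrier ?R" "y \<in> carrier ?R" for x y
    using that keys_add[of x y] by (fastforce simp: poly_ring_def)
  have one_closed: "(1 :: ('v, 'k) mpoly) \<in> carrier ?R"
    by (simp add: poly_ring_def)
  have sel: "mult ?R = (*)" "one ?R = 1" "zero ?R = 0" "add ?R = (+)"
    by (simp_all add: poly_ring_def)
  show ?thesis
  proof (rule cringI)
    show "abelian_group ?R"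
    proof (rule abelian_groupI, unfold sel)
      fix x assume x: "x \<in> carrier ?R"
      then show "\<exists>y\<in>carrier ?R. y + x = 0"
        by (intro bexI[of _ "- x"]) (simp_all add: poly_ring_def)
    next
      show "0 \<in> carrier ?R" by (simp add: poly_ring_def)
    qed (simp_all only: add_closed add.assoc add_0_left, rule add.commute)
    show "comm_monoid ?R"
      by (rule comm_monoidI, unfold sel)
        (simp_all only: mult_closed one_closed mult.assoc mult_1_left, rule mult.commute)
  qed (simp only: sel distrib_right)
qed


section \<open>Graded Betti numbers and regularity of homogeneous ideals\<close>

text \<open>
  The free module \<open>R\<^sup>n\<close> consists of the vectors with entries in \<^term>\<open>poly_ring V\<close>.
  A list \<open>s\<close> of natural numbers stands for the graded free module \<open>\<Oplus>\<^sub>a R(- s ! a)\<close>, whose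
  basis vector number \<open>a\<close> has degree \<open>s ! a\<close>.  All generators of an ideal, and hence all
  basis elements in its minimal resolution, have nonnegative degree.
\<close>

definition free_module :: "'v set \<Rightarrow> nat \<Rightarrow> ('v, 'k::field) mpoly vec set" where
  "free_module V n = {v \<in> carrier_vec n. \<forall>a<n. v $ a \<in> carrier (poly_ring V)}"

text \<open>
  \<open>A\<close> is the matrix of a degree-preserving \<open>R\<close>-linear map
  \<open>\<Oplus>\<^sub>b R(- t ! b) \<rightarrow> \<Oplus>\<^sub>a R(- s ! a)\<close>: entry \<open>(a, b)\<close> is zero or homogeneous of degree
  \<open>t ! b - s ! a\<close>.
\<close>

definition graded_matrix ::
  "'v set \<Rightarrow> nat list \<Rightarrow> nat list \<Rightarrow> ('v, 'k::field) mpoly mat \<Rightarrow> bool" where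
  "graded_matrix V s t A \<longleftrightarrow>
     A \<in> carrier_mat (length s) (length t) \<and>
     (\<forall>a<length s. \<forall>b<length t.
        A $$ (a, b) \<in> carrier (poly_ring V) \<and>
        (\<forall>e\<in>Poly_Mapping.keys (A $$ (a, b)). mdeg e + s ! a = t ! b))"

definition irrelevant_ideal :: "'v set \<Rightarrow> ('v, 'k::field) mpoly set" where
  "irrelevant_ideal V = Idl\<^bsub>poly_ring V\<^esub> (indet ` V)"

text \<open>
  \<open>\<dots> \<rightarrow> F\<^sub>1 \<rightarrow> F\<^sub>0 \<rightarrow> J \<rightarrow> 0\<close> is exact, where \<open>F\<^sub>i\<close> has basis degrees \<open>d i\<close>; the row matrix
  \<open>A 0\<close> represents the augmentation \<open>F\<^sub>0 \<rightarrow> J \<subseteq> R\<close> and \<open>A (i + 1)\<close> the differential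
  \<open>F\<^bsub>i+1\<^esub> \<rightarrow> F\<^sub>i\<close>.  Minimality means that the entries of the differentials lie in the
  irrelevant ideal.
\<close>

definition minimal_graded_free_resolution ::
  "'v set \<Rightarrow> ('v, 'k::field) mpoly set \<Rightarrow>
     (nat \<Rightarrow> nat list) \<Rightarrow> (nat \<Rightarrow> ('v, 'k) mpoly mat) \<Rightarrow> bool" where
  "minimal_graded_free_resolution V J d A \<longleftrightarrow>
     graded_matrix V [0] (d 0) (A 0) \<and>
     {(A 0 *\<^sub>v v) $ 0 | v. v \<in> free_module V (length (d 0))} = J \<and>
     (\<forall>i. graded_matrix V (d i) (d (Suc i)) (A (Suc i)) \<and>
          mat_kernel (A i) \<inter> free_module V (length (d i)) =
            {A (Suc i) *\<^sub>v v | v. v \<in> free_module V (length (d (Suc i)))} \<and>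
          (\<forall>a<length (d i). \<forall>b<length (d (Suc i)).
             A (Suc i) $$ (a, b) \<in> irrelevant_ideal V))"

text \<open>
  The number of copies of \<open>R(-j)\<close> in homological degree \<open>i\<close> of a minimal graded free
  resolution of \<open>J\<close>.  For a homogeneous ideal \<open>J\<close> in finitely many variables such a
  resolution exists, and it is unique up to isomorphism, so the choice is immaterial.
\<close>

definition graded_betti :: "'v set \<Rightarrow> ('v, 'k::field) mpoly set \<Rightarrow> nat \<Rightarrow> nat \<Rightarrow> nat" where
  "graded_betti V J i j =
     count_list (fst (SOME (d, A). minimal_graded_free_resolution V J d A) i) j"

text \<open>
  Only meaningful for \<open>J \<noteq> {0}\<close>; the set is finite by Hilbert's syzygy theorem.
\<close>

definition regularity :: "'v set \<Rightarrow> ('v, 'k::field) mpoly set \<Rightarrow> int" where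
  "regularity V J = Max {int j - int i | i j. graded_betti V J i j \<noteq> 0}"


section \<open>Graphs, matchings and square-free powers of edge ideals\<close>

type_synonym 'v graph = "'v set \<times> 'v set set"

abbreviation vertices :: "'v graph \<Rightarrow> 'v set" where "vertices G \<equiv> fst G"
abbreviation edges :: "'v graph \<Rightarrow> 'v set set" where "edges G \<equiv> snd G"

definition finite_simple_graph :: "'v graph \<Rightarrow> bool" where
  "finite_simple_graph G \<longleftrightarrow>
     finite (vertices G) \<and> (\<forall>e\<in>edges G. e \<subseteq> vertices G \<and> card e = 2)"

definition is_matching :: "'v graph \<Rightarrow> 'v set set \<Rightarrow> bool" where
  "is_matching G M \<longleftrightarrow> M \<subseteq> edges G \<and> pairwise disjnt M"

definition matching_number :: "'v graph \<Rightarrow> nat" where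
  "matching_number G = Max {card M | M. is_matching G M}"

definition edge_ideal :: "'v graph \<Rightarrow> ('v, 'k::field) mpoly set" where
  "edge_ideal G =
     Idl\<^bsub>poly_ring (vertices G)\<^esub> {indet x * indet y | x y. {x, y} \<in> edges G}"

definition squarefree_monomial :: "'v monomial \<Rightarrow> bool" where
  "squarefree_monomial e \<longleftrightarrow> (\<forall>x. Poly_Mapping.lookup e x \<le> 1)"

text \<open>
  The power \<open>I(G)\<^sup>k\<close> is taken in the semiring of ideals of the polynomial ring.
\<close>

definition squarefree_power :: "'v graph \<Rightarrow> nat \<Rightarrow> ('v, 'k::field) mpoly set" where
  "squarefree_power G k =
     Idl\<^bsub>poly_ring (vertices G)\<^esub>
       {u. \<exists>e. u = Poly_Mapping.single e 1 \<and> squarefree_monomial e \<and>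
          u \<in> edge_ideal G [^]\<^bsub>ideals_set (poly_ring (vertices G))\<^esub> k}"

datatype whisker_vertex = X nat | Y nat

definition whiskered_cycle :: "nat \<Rightarrow> whisker_vertex graph" where
  "whiskered_cycle m =
     (X ` {1..m} \<union> Y ` {1..m},
      {{X i, X (i + 1)} | i. 1 \<le> i \<and> i \<le> m - 1} \<union> {{X 1, X m}} \<union>
      {{X i, Y i} | i. 1 \<le> i \<and> i \<le> m})"

lemma finite_simple_graph_whiskered_cycle:
  assumes "3 \<le> m"
  shows "finite_simple_graph (whiskered_cycle m)"
proof -
  have "e \<subseteq> vertices (whiskered_cycle m) \<and> card e = 2"
    if e: "e \<in> edges (whiskered_cycle m)" for e
  proof -
    consider i where "e = {X i, X (i + 1)}" "1 \<le> i" "i \<le> m - 1"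
      | "e = {X 1, X m}"
      | i where "e = {X i, Y i}" "1 \<le> i" "i \<le> m"
      using e unfolding whiskered_cycle_def snd_conv by blast
    then show ?thesis
      by cases (use assms in \<open>simp_all add: whiskered_cycle_def image_iff, linarith\<close>)
  qed
  then show ?thesis
    unfolding finite_simple_graph_def by (simp add: whiskered_cycle_def)
qed

end

theory Submission
  imports Defs "HOL-Library.Function_Algebras"
begin

text \<open>
  By Hochster's formula, \<open>\<beta>\<^bsub>i,j\<^esub>(J)\<close> of a square-free monomial ideal \<open>J\<close> is nonzero iff some
  square-free multidegree \<open>S\<close> with \<open>|S| = j\<close> carries Koszul homology in degree \<open>i\<close>.  This homology
  depends only on the family \<open>U\<close> of supports of monomials in \<open>J\<close>, and splitting off a variable
  \<open>x\<close> gives a long exact sequence, whence \<open>reg J \<le> max (reg (J : x) + 1) (reg J')\<close>, where \<open>J'\<close>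
  is generated by the generators of \<open>J\<close> without \<open>x\<close>.

  For the upper bound, four variables of \<open>W(C\<^sub>m)\<close> are split off in this way: \<open>x\<^sub>m\<close>, its whisker
  \<open>y\<^sub>m\<close>, then \<open>x\<^sub>1\<close>, \<open>y\<^sub>1\<close>.  A leaf edge whose ends have both been inverted lowers \<open>k\<close> by one, so all
  branches lead to whiskered paths, except for the one where \<open>x\<^sub>1\<close> and \<open>x\<^sub>m\<close> are inverted but their
  whiskers deleted: contracting \<open>x\<^sub>2, x\<^sub>1, x\<^sub>m, x\<^bsub>m-1\<^esub>\<close> to an edge turns it into \<open>W(C\<^bsub>m-2\<^esub>)\<close>
  with \<open>k - 1\<close>.  For the lower bound, the multidegree of \<open>W(P\<^sub>k)\<close> together with \<open>q\<close> further whiskers at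
  pairwise distance two carries homology in degree \<open>q\<close>, since the upper bound for \<open>k - 1\<close> makes
  the connecting maps surjective.
\<close>

section \<open>Koszul complexes with varying coefficients\<close>

text \<open>Hochster's formula speaks of Koszul homology, while the regularity is read off a
  resolution picked by \<open>SOME\<close>; so minimal graded free resolutions have to be shown to
  exist and to have basis degrees independent of the choice. Both follow from dimension shifting: in
  each internal degree, the homology of a syzygy module in degree p is that of its predecessor in
  degree p + 1, and its vanishing in degree 0 says that no minimal generator has that degree. The
  upper bound is proved before resolutions enter, as the vanishing statement \<open>reg_le\<close>,
  and is itself what makes every syzygy module finitely generated. No homology groups are formed:
  exact sequences appear as implications between vanishing statements. One locale, a Koszul complex
  with its own coefficient group at every face, covers graded modules as well as the complexes of
  single multidegrees. In the combinatorics, every inverted variable has to be paid for with one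
  unit of regularity. The bound equals floor((n + 3k) / 2), and each branch of the induction lowers
  n and k by enough for that.\<close>

definition kless :: "'v \<Rightarrow> 'v \<Rightarrow> bool" where
  "kless x y \<longleftrightarrow> x \<noteq> y \<and> (x, y) \<in> (SOME r. well_order_on UNIV r)"

text \<open>The order serves only to fix the signs of the differential. An arbitrary well-order of
  the type avoids an order class on the variables.\<close>

lemma kless_flip:
  assumes "x \<noteq> y"
  shows "kless y x \<longleftrightarrow> \<not> kless x y"
proof -
  let ?r = "SOME r :: 'a rel. well_order_on UNIV r"
  have "well_order_on UNIV ?r"
    using someI_ex[OF well_order_on[of UNIV]] .
  then have "total_on UNIV ?r" "antisym ?r"
    by (auto simp: well_order_on_def linear_order_on_def partial_order_on_def)
  then show ?thesis
    using assms by (auto simp: kless_def total_on_def dest: antisymD)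
qed

text \<open>\<open>True\<close> stands for the sign \<open>1\<close>, \<open>False\<close> for \<open>-1\<close>.\<close>

definition kpar :: "'v \<Rightarrow> 'v set \<Rightarrow> bool" where
  "kpar x F \<longleftrightarrow> even (card {y\<in>F. kless y x})"

lemma kpar_insert:
  assumes "finite F" "y \<notin> F"
  shows "kpar x (insert y F) \<longleftrightarrow> kpar x F = (\<not> kless y x)"
proof (cases "kless y x")
  case True
  then have "{z\<in>insert y F. kless z x} = insert y {z\<in>F. kless z x}" by auto
  then show ?thesis using True assms by (simp add: kpar_def)
next
  case False
  then have "{z\<in>insert y F. kless z x} = {z\<in>F. kless z x}" by auto
  then show ?thesis using False by (simp add: kpar_def)
qed

definition signed :: "bool \<Rightarrow> 'm::ab_group_add \<Rightarrow> 'm" where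
  "signed s m = (if s then m else - m)"

lemma signed_add: "signed s (m + n) = signed s m + signed s n"
  and signed_minus: "signed s (- m) = - signed s m"
  and signed_0 [simp]: "signed s 0 = 0"
  and signed_signed: "signed s (signed t m) = signed (s = t) m"
  and signed_self [simp]: "signed s (signed s m) = m"
  and signed_eq_0 [simp]: "signed s m = 0 \<longleftrightarrow> m = 0"
  by (auto simp: signed_def)

lemma signed_sum: "signed s (sum f A) = (\<Sum>a\<in>A. signed s (f a))"
  by (simp add: signed_def sum_negf)

text \<open>Swapping the two indices would only show that twice the sum is 0, which says nothing in
  characteristic 2. The induction instead cancels the new row against the new column.\<close>

lemma sum_offdiag_antisym:
  fixes g :: "'v \<Rightarrow> 'v \<Rightarrow> 'm::ab_group_add"
  assumes "finite T" and "\<And>x y. x \<in> T \<Longrightarrow> y \<in> T \<Longrightarrow> x \<noteq> y \<Longrightarrow> g y x = - g x y"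
  shows "(\<Sum>x\<in>T. \<Sum>y\<in>T - {x}. g x y) = 0"
  using assms
proof (induction T)
  case (insert z T)
  have z: "insert z T - {z} = T" using insert.hyps by auto
  have x: "(\<Sum>y\<in>insert z T - {x}. g x y) = g x z + (\<Sum>y\<in>T - {x}. g x y)" if "x \<in> T" for x
  proof -
    have i: "insert z T - {x} = insert z (T - {x})" using insert.hyps that by auto
    have "finite (T - {x})" "z \<notin> T - {x}" using insert.hyps by auto
    from sum.insert[OF this] show ?thesis unfolding i .
  qed
  have "(\<Sum>x\<in>T. \<Sum>y\<in>insert z T - {x}. g x y) = (\<Sum>x\<in>T. g x z + (\<Sum>y\<in>T - {x}. g x y))"
    by (rule sum.cong[OF refl x])
  also have "\<dots> = (\<Sum>x\<in>T. g x z) + (\<Sum>x\<in>T. \<Sum>y\<in>T - {x}. g x y)"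
    by (rule sum.distrib)
  also have "(\<Sum>x\<in>T. \<Sum>y\<in>T - {x}. g x y) = 0"
    by (rule insert.IH) (use insert.prems in blast)
  also have "(\<Sum>x\<in>T. g x z) = (\<Sum>x\<in>T. - g z x)"
    by (rule sum.cong[OF refl insert.prems]) (use insert.hyps in auto)
  finally show ?case
    unfolding sum.insert[OF insert.hyps] z by (simp only: sum_negf add_0_right right_minus)
qed simp

text \<open>The variables act through commuting additive maps, and scalars do not occur.
  Multiplication of polynomial vectors by a variable and the identity on the field are both
  instances.\<close>

locale koszul =
  fixes V :: "'v set" and mul :: "'v \<Rightarrow> 'm::ab_group_add \<Rightarrow> 'm"
  assumes finite_V: "finite V"
    and mul_add: "mul x (m + n) = mul x m + mul x n"
    and mul_commute: "mul x (mul y m) = mul y (mul x m)"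
begin

lemma mul_0 [simp]: "mul x 0 = 0"
  using mul_add[of x 0 0] by simp

lemma mul_minus: "mul x (- m) = - mul x m"
  using mul_add[of x m "- m"] by (simp add: eq_neg_iff_add_eq_0 add.commute)

lemma mul_signed: "mul x (signed s m) = signed s (mul x m)"
  by (simp add: signed_def mul_minus)

lemma mul_sum: "mul x (sum f A) = (\<Sum>a\<in>A. mul x (f a))"
  by (induction A rule: infinite_finite_induct) (simp_all add: mul_add)

text \<open>\<open>c F\<close> is the coefficient of the exterior basis element of \<open>F\<close>,
  and this is the Koszul differential read off coefficientwise. Chains are functions on all sets, so
  that the differential can be iterated without reference to degrees.\<close>

definition kd :: "('v set \<Rightarrow> 'm) \<Rightarrow> 'v set \<Rightarrow> 'm" where
  "kd c F = (if F \<subseteq> V then \<Sum>x\<in>V - F. signed (kpar x F) (mul x (c (insert x F))) else 0)"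

lemma kd_add: "kd (\<lambda>F. b F + c F) F = kd b F + kd c F"
  by (simp add: kd_def mul_add signed_add sum.distrib)

lemma kd_minus: "kd (\<lambda>F. - c F) F = - kd c F"
  by (simp add: kd_def mul_minus signed_minus sum_negf)

lemma kd_diff: "kd (\<lambda>F. b F - c F) F = kd b F - kd c F"
  using kd_add[of b "\<lambda>F. - c F"] by (simp add: kd_minus)

lemma kd_0 [simp]: "kd (\<lambda>F. 0) F = 0"
  by (simp add: kd_def)

lemma mul_kd: "mul x (kd c F) = kd (\<lambda>F. mul x (c F)) F"
  by (simp add: kd_def mul_sum mul_signed mul_commute)

lemma finite_subset_V: "F \<subseteq> V \<Longrightarrow> finite F"
  using finite_V finite_subset by blast

lemma kd_kd: "kd (kd c) F = 0"
proof (cases "F \<subseteq> V")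
  case True
  define g where "g x y = signed (kpar x F = kpar y (insert x F))
    (mul x (mul y (c (insert y (insert x F)))))" for x y
  have "kd (kd c) F = (\<Sum>x\<in>V - F. signed (kpar x F) (mul x
      (\<Sum>y\<in>V - insert x F. signed (kpar y (insert x F)) (mul y (c (insert y (insert x F)))))))"
    using True by (auto simp: kd_def intro!: sum.cong)
  also have "\<dots> = (\<Sum>x\<in>V - F. \<Sum>y\<in>(V - F) - {x}. g x y)"
  proof (intro sum.cong refl)
    fix x assume "x \<in> V - F"
    have V: "V - insert x F = (V - F) - {x}" by auto
    show "signed (kpar x F) (mul x
      (\<Sum>y\<in>V - insert x F. signed (kpar y (insert x F)) (mul y (c (insert y (insert x F)))))) =
      (\<Sum>y\<in>(V - F) - {x}. g x y)"
      unfolding V mul_sum signed_sum mul_signed signed_signed g_def ..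
  qed
  also have "\<dots> = 0"
  proof (rule sum_offdiag_antisym)
    fix x y assume xy: "x \<in> V - F" "y \<in> V - F" "x \<noteq> y"
    \<comment> \<open>Inserting \<open>x\<close> flips the sign at \<open>y\<close> exactly when
      \<open>x\<close> precedes \<open>y\<close>. Of the two insertions exactly one flips, which
      gives opposite signs.\<close>
    have "kpar y (insert x F) \<longleftrightarrow> kpar y F = (\<not> kless x y)"
      "kpar x (insert y F) \<longleftrightarrow> kpar x F = kless x y"
      using xy finite_subset_V[OF True] kless_flip[OF xy(3)] by (auto simp: kpar_insert)
    moreover have "insert x (insert y F) = insert y (insert x F)" by auto
    ultimately show "g y x = - g x y"
      by (auto simp: g_def mul_commute[of y x] signed_def)
  qed (simp add: finite_V)
  finally show ?thesis .
qed (simp add: kd_def)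

text \<open>\<open>N F\<close> is the group of coefficients allowed at the face \<open>F\<close>;
  the conditions make the allowed chains a subcomplex. If \<open>N F\<close> is a graded piece of a
  module, this is a strand of its Koszul complex; if \<open>N F\<close> is the whole field or 0, it
  is the chain complex of a simplicial complex.\<close>

definition coeffs :: "('v set \<Rightarrow> 'm set) \<Rightarrow> bool" where
  "coeffs N \<longleftrightarrow>
     (\<forall>F. 0 \<in> N F \<and> (\<forall>m\<in>N F. - m \<in> N F \<and> (\<forall>n\<in>N F. m + n \<in> N F))) \<and>
     (\<forall>F x m. F \<subseteq> V \<longrightarrow> x \<in> V - F \<longrightarrow> m \<in> N (insert x F) \<longrightarrow> mul x m \<in> N F)"

lemma coeffsD:
  assumes "coeffs N"
  shows "0 \<in> N F" "m \<in> N F \<Longrightarrow> - m \<in> N F" "m \<in> N F \<Longrightarrow> n \<in> N F \<Longrightarrow> m + n \<in> N F"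
    "F \<subseteq> V \<Longrightarrow> x \<in> V \<Longrightarrow> x \<notin> F \<Longrightarrow> m \<in> N (insert x F) \<Longrightarrow> mul x m \<in> N F"
  using assms by (simp_all add: coeffs_def)

lemma coeffs_signed: "coeffs N \<Longrightarrow> m \<in> N F \<Longrightarrow> signed s m \<in> N F"
  using coeffsD(2)[of N m F] by (simp add: signed_def)

lemma coeffs_sum:
  assumes N: "coeffs N" and "\<And>a. a \<in> A \<Longrightarrow> f a \<in> N F"
  shows "sum f A \<in> N F"
  using assms(2)
  by (induction A rule: infinite_finite_induct) (simp_all add: coeffsD(1,3)[OF N])

definition chain :: "('v set \<Rightarrow> 'm set) \<Rightarrow> nat \<Rightarrow> ('v set \<Rightarrow> 'm) \<Rightarrow> bool" where
  "chain N i c \<longleftrightarrow> (\<forall>F. c F \<in> N F \<and> (c F \<noteq> 0 \<longrightarrow> F \<subseteq> V \<and> card F = i))"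

lemma chainI:
  "(\<And>F. c F \<in> N F) \<Longrightarrow> (\<And>F. c F \<noteq> 0 \<Longrightarrow> F \<subseteq> V \<and> card F = i) \<Longrightarrow> chain N i c"
  by (simp add: chain_def)

lemma chainD:
  assumes "chain N i c"
  shows "c F \<in> N F" "c F \<noteq> 0 \<Longrightarrow> F \<subseteq> V" "c F \<noteq> 0 \<Longrightarrow> card F = i"
  using assms by (auto simp: chain_def)

lemma chain_zero: "coeffs N \<Longrightarrow> chain N i (\<lambda>F. 0)"
  using coeffsD(1)[of N] by (simp add: chain_def)

lemma chain_add:
  assumes N: "coeffs N" and b: "chain N i b" and c: "chain N i c"
  shows "chain N i (\<lambda>F. b F + c F)"
proof (rule chainI)
  fix F
  show "b F + c F \<in> N F"
    by (rule coeffsD(3)[OF N chainD(1)[OF b] chainD(1)[OF c]])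
  assume "b F + c F \<noteq> 0"
  then have "b F \<noteq> 0 \<or> c F \<noteq> 0" by auto
  then show "F \<subseteq> V \<and> card F = i" using chainD(2,3)[OF b] chainD(2,3)[OF c] by metis
qed

lemma chain_minus:
  assumes N: "coeffs N" and c: "chain N i c"
  shows "chain N i (\<lambda>F. - c F)"
  by (rule chainI) (use coeffsD(2)[OF N chainD(1)[OF c]] chainD(2,3)[OF c] in auto)

lemma chain_diff: "coeffs N \<Longrightarrow> chain N i b \<Longrightarrow> chain N i c \<Longrightarrow> chain N i (\<lambda>F. b F - c F)"
  using chain_add[OF _ _ chain_minus, of N i b c] by simp

lemma kd_nonzero:
  assumes "kd c F \<noteq> 0" "\<And>F. c F \<noteq> 0 \<Longrightarrow> F \<subseteq> V \<and> card F = i"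
  shows "F \<subseteq> V" "Suc (card F) = i"
proof -
  show F: "F \<subseteq> V" using assms(1) by (auto simp: kd_def split: if_splits)
  obtain x where "x \<in> V - F" "c (insert x F) \<noteq> 0"
    using assms(1) F unfolding kd_def by (metis (no_types, lifting) mul_0 signed_0 sum.neutral)
  then show "Suc (card F) = i"
    using assms(2)[of "insert x F"] finite_subset_V[OF F] by auto
qed

lemma chain_kd:
  assumes N: "coeffs N" and c: "chain N (Suc i) c"
  shows "chain N i (kd c)"
proof (rule chainI)
  show "kd c F \<in> N F" for F
    unfolding kd_def using N chainD(1)[OF c]
    by (auto intro!: coeffs_sum[OF N] coeffs_signed[OF N] coeffsD(1,4)[OF N])
  show "F \<subseteq> V \<and> card F = i" if "kd c F \<noteq> 0" for F
    using kd_nonzero[OF that, of "Suc i"] chainD[OF c] by auto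
qed

definition vanishes :: "('v set \<Rightarrow> 'm set) \<Rightarrow> nat \<Rightarrow> bool" where
  "vanishes N i \<longleftrightarrow>
     (\<forall>c. chain N i c \<longrightarrow> (\<forall>F. kd c F = 0) \<longrightarrow> (\<exists>b. chain N (Suc i) b \<and> kd b = c))"

lemma vanishesD:
  assumes "vanishes N i" "chain N i c" "\<And>F. kd c F = 0"
  obtains b where "chain N (Suc i) b" "kd b = c"
  using assms unfolding vanishes_def by blast

lemma vanishes_trivial:
  assumes "coeffs N" "\<And>F. F \<subseteq> V \<Longrightarrow> card F = i \<Longrightarrow> N F \<subseteq> {0}"
  shows "vanishes N i"
  unfolding vanishes_def
proof (intro allI impI)
  fix c assume c: "chain N i c" "\<forall>F. kd c F = 0"
  have "c F = 0" for F
    using chainD[OF c(1), of F] assms(2)[of F] by auto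
  then have "c = (\<lambda>F. 0)" by auto
  moreover have "kd (\<lambda>F. 0) = (\<lambda>F. 0)" by (rule ext) simp
  ultimately show "\<exists>b. chain N (Suc i) b \<and> kd b = c"
    using chain_zero[OF assms(1)] by blast
qed

subsection \<open>Long exact sequence of a short exact sequence\<close>

lemma kd_hom:
  assumes "\<And>m n. \<phi> (m + n) = \<phi> m + \<phi> n" "\<And>x m. \<phi> (mul x m) = mul x (\<phi> m)"
  shows "kd (\<lambda>F. \<phi> (c F)) F = \<phi> (kd c F)"
proof -
  have 0: "\<phi> 0 = 0" using assms(1)[of 0 0] by simp
  have m: "\<phi> (- m) = - \<phi> m" for m
    using assms(1)[of m "- m"] 0 by (simp add: eq_neg_iff_add_eq_0 add.commute)
  have s: "\<phi> (sum f A) = (\<Sum>a\<in>A. \<phi> (f a))" for f and A :: "'v set"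
    by (induction A rule: infinite_finite_induct) (simp_all add: 0 assms)
  have g: "\<phi> (signed e n) = signed e (\<phi> n)" for e n
    by (simp add: signed_def m)
  show ?thesis by (simp add: kd_def s g 0 assms(2))
qed

lemma lift_chain:
  assumes surj: "\<And>F. F \<subseteq> V \<Longrightarrow> \<phi> ` N F = N'' F" and N: "coeffs N"
    and \<phi>0: "\<phi> 0 = 0" and c: "chain N'' i c"
  obtains b where "chain N i b" "\<forall>F. \<phi> (b F) = c F"
proof -
  have "\<exists>m. m \<in> N F \<and> \<phi> m = c F \<and> (c F = 0 \<longrightarrow> m = 0)" for F
  proof (cases "c F = 0")
    case True then show ?thesis using \<phi>0 coeffsD(1)[OF N] by auto
  next
    case False
    then have "c F \<in> \<phi> ` N F" using surj chainD[OF c, of F] by blast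
    with False show ?thesis by auto
  qed
  then obtain b where b: "\<And>F. b F \<in> N F" "\<And>F. \<phi> (b F) = c F" "\<And>F. c F = 0 \<Longrightarrow> b F = 0"
    by metis
  have "chain N i b"
  proof (rule chainI)
    show "F \<subseteq> V \<and> card F = i" if "b F \<noteq> 0" for F
      using that b(3)[of F] chainD(2,3)[OF c, of F] by blast
  qed (rule b(1))
  then show ?thesis using b(2) that by blast
qed

text \<open>The piece H_{i+1}(N'') -> H_i(N') -> H_i(N) of the long exact sequence. The hypothesis
  \<open>bd\<close> asks only that the second map be zero, not that H_i(N) vanish: a free module has
  homology in degree 0, and there minimality makes the map zero.\<close>

lemma vanishes_kernel:
  assumes N: "coeffs N" and add: "\<And>m n. \<phi> (m + n) = \<phi> m + \<phi> n"
    and mul: "\<And>x m. \<phi> (mul x m) = mul x (\<phi> m)"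
    and surj: "\<And>F. F \<subseteq> V \<Longrightarrow> \<phi> ` N F = N'' F"
    and ker: "\<And>F. F \<subseteq> V \<Longrightarrow> N' F = {m \<in> N F. \<phi> m = 0}"
    and N': "coeffs N'" and N'': "coeffs N''"
    and van: "vanishes N'' (Suc i)"
    and bd: "\<And>c. chain N' i c \<Longrightarrow> \<forall>F. kd c F = 0 \<Longrightarrow> \<exists>b. chain N (Suc i) b \<and> kd b = c"
  shows "vanishes N' i"
  unfolding vanishes_def
proof (intro allI impI)
  fix c assume c: "chain N' i c" "\<forall>F. kd c F = 0"
  obtain b where b: "chain N (Suc i) b" "kd b = c" using bd[OF c] by blast
  have \<phi>0: "\<phi> 0 = 0" using add[of 0 0] by simp
  have \<phi>d: "\<phi> (m - n) = \<phi> m - \<phi> n" for m n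
    using add[of "m - n" n] by simp
  have "chain N'' (Suc i) (\<lambda>F. \<phi> (b F))"
  proof (rule chainI)
    fix F show "\<phi> (b F) \<in> N'' F"
    proof (cases "b F = 0")
      case True then show ?thesis using \<phi>0 coeffsD(1)[OF N''] by simp
    next
      case False then show ?thesis using chainD[OF b(1), of F] surj[of F] by blast
    qed
  next
    fix F assume "\<phi> (b F) \<noteq> 0"
    then have "b F \<noteq> 0" using \<phi>0 by auto
    then show "F \<subseteq> V \<and> card F = Suc i" using chainD[OF b(1)] by auto
  qed
  moreover have "kd (\<lambda>F. \<phi> (b F)) F = 0" for F
  proof -
    have "kd (\<lambda>F. \<phi> (b F)) F = \<phi> (c F)" by (simp add: kd_hom[OF add mul] b)
    also have "\<dots> = 0"
      using chainD[OF c(1), of F] ker[of F] \<phi>0 by (cases "c F = 0") auto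
    finally show ?thesis .
  qed
  ultimately obtain e where e: "chain N'' (Suc (Suc i)) e" "kd e = (\<lambda>F. \<phi> (b F))"
    by (rule vanishesD[OF van])
  \<comment> \<open>Correcting \<open>b\<close> by the boundary of a lift of \<open>e\<close> moves
    it into the kernel without changing its own boundary.\<close>
  obtain e' where e': "chain N (Suc (Suc i)) e'" "\<And>F. \<phi> (e' F) = e F"
    using lift_chain[OF surj N \<phi>0 e(1)] by blast
  have "\<phi> (kd e' F) = \<phi> (b F)" for F
    using kd_hom[OF add mul, of e' F] e e'(2) by simp
  then have z: "\<phi> (b F - kd e' F) = 0" for F by (simp add: \<phi>d)
  have ch: "chain N (Suc i) (\<lambda>F. b F - kd e' F)"
    by (rule chain_diff[OF N b(1) chain_kd[OF N e'(1)]])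
  have "chain N' (Suc i) (\<lambda>F. b F - kd e' F)"
  proof (rule chainI)
    fix F show "b F - kd e' F \<in> N' F"
      using chainD[OF ch, of F] z[of F] ker[of F] coeffsD(1)[OF N', of F]
      by (cases "b F - kd e' F = 0") auto
  qed (use chainD[OF ch] in auto)
  moreover have "kd (\<lambda>F. b F - kd e' F) = c"
    by (rule ext) (simp add: kd_diff kd_kd b(2))
  ultimately show "\<exists>b. chain N' (Suc i) b \<and> kd b = c" by blast
qed

text \<open>The piece H_{i+1}(N) -> H_{i+1}(N'') -> H_i(N'). The boundary of a lifted cycle lies in
  the kernel and is bounded there by some \<open>z\<close>; subtracting \<open>z\<close> turns the
  lift into a cycle of \<open>N\<close>.\<close>

lemma vanishes_quotient:
  assumes N: "coeffs N" and add: "\<And>m n. \<phi> (m + n) = \<phi> m + \<phi> n"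
    and mul: "\<And>x m. \<phi> (mul x m) = mul x (\<phi> m)"
    and surj: "\<And>F. F \<subseteq> V \<Longrightarrow> \<phi> ` N F = N'' F"
    and ker: "\<And>F. F \<subseteq> V \<Longrightarrow> N' F = {m \<in> N F. \<phi> m = 0}"
    and N': "coeffs N'" and N'': "coeffs N''"
    and van: "vanishes N (Suc i)" "vanishes N' i"
  shows "vanishes N'' (Suc i)"
  unfolding vanishes_def
proof (intro allI impI)
  fix c assume c: "chain N'' (Suc i) c" "\<forall>F. kd c F = 0"
  have \<phi>0: "\<phi> 0 = 0" using add[of 0 0] by simp
  obtain c' where c': "chain N (Suc i) c'" "\<And>F. \<phi> (c' F) = c F"
    using lift_chain[OF surj N \<phi>0 c(1)] by blast
  have z: "\<phi> (kd c' F) = 0" for F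
    using kd_hom[OF add mul, of c' F] c c'(2) by simp
  have ch: "chain N i (kd c')" using chain_kd[OF N c'(1)] .
  have "chain N' i (kd c')"
  proof (rule chainI)
    fix F show "kd c' F \<in> N' F"
      using chainD[OF ch, of F] z[of F] ker[of F] coeffsD(1)[OF N', of F]
      by (cases "kd c' F = 0") auto
  qed (use chainD[OF ch] in auto)
  then obtain z where z: "chain N' (Suc i) z" "kd z = kd c'"
    using vanishesD[OF van(2) _ kd_kd] by blast
  have \<phi>z: "\<phi> (z F) = 0" for F
    using chainD[OF z(1), of F] ker[of F] \<phi>0 by (cases "z F = 0") auto
  have zN: "chain N (Suc i) z"
  proof (rule chainI)
    fix F show "z F \<in> N F"
      using chainD[OF z(1), of F] ker[of F] coeffsD(1)[OF N, of F] by (cases "z F = 0") auto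
  qed (use chainD[OF z(1)] in auto)
  have "chain N (Suc i) (\<lambda>F. c' F - z F)" by (rule chain_diff[OF N c'(1) zN])
  then obtain b where b: "chain N (Suc (Suc i)) b" "kd b = (\<lambda>F. c' F - z F)"
    by (rule vanishesD[OF van(1)]) (simp add: kd_diff z(2))
  have "chain N'' (Suc (Suc i)) (\<lambda>F. \<phi> (b F))"
  proof (rule chainI)
    fix F show "\<phi> (b F) \<in> N'' F"
    proof (cases "b F = 0")
      case True then show ?thesis using \<phi>0 coeffsD(1)[OF N''] by simp
    next
      case False then show ?thesis using chainD[OF b(1), of F] surj[of F] by blast
    qed
  next
    fix F assume "\<phi> (b F) \<noteq> 0"
    then have "b F \<noteq> 0" using \<phi>0 by auto
    then show "F \<subseteq> V \<and> card F = Suc (Suc i)" using chainD[OF b(1)] by auto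
  qed
  moreover have "kd (\<lambda>F. \<phi> (b F)) = c"
  proof
    fix F
    have "\<phi> (c' F - z F) = \<phi> (c' F) - \<phi> (z F)"
      using add[of "c' F - z F" "z F"] by simp
    then show "kd (\<lambda>F. \<phi> (b F)) F = c F"
      by (simp add: kd_hom[OF add mul] b c' \<phi>z)
  qed
  ultimately show "\<exists>b. chain N'' (Suc (Suc i)) b \<and> kd b = c" by blast
qed

subsection \<open>Splitting off a variable\<close>

definition del :: "'v \<Rightarrow> ('v set \<Rightarrow> 'm set) \<Rightarrow> 'v set \<Rightarrow> 'm set" where
  "del x N F = (if x \<in> F then {0} else N F)"

definition link :: "'v \<Rightarrow> ('v set \<Rightarrow> 'm set) \<Rightarrow> 'v set \<Rightarrow> 'm set" where
  "link x N F = (if x \<in> F then {0} else N (insert x F))"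

text \<open>The chain a + e_x b, where the sign moves the exterior variable e_x from the front to
  its place in the order. Every chain has this form with \<open>a\<close> over
  \<open>del x N\<close> and \<open>b\<close> over \<open>link x N\<close>, which exhibits the
  complex as the mapping cone of multiplication by x.\<close>

definition join :: "'v \<Rightarrow> ('v set \<Rightarrow> 'm) \<Rightarrow> ('v set \<Rightarrow> 'm) \<Rightarrow> 'v set \<Rightarrow> 'm" where
  "join x a b F = (if x \<in> F then signed (kpar x (F - {x})) (b (F - {x})) else a F)"

lemma coeffs_del: "coeffs N \<Longrightarrow> coeffs (del x N)"
  by (auto simp: coeffs_def del_def)

lemma coeffs_link: 
  assumes N: "coeffs N" and x: "x \<in> V"
  shows "coeffs (link x N)"
  unfolding coeffs_def
proof (intro conjI allI impI)
  fix F y m assume F: "F \<subseteq> V" "y \<in> V - F" "m \<in> link x N (insert y F)"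
  show "mul y m \<in> link x N F"
  proof (cases "x \<in> F \<or> x = y")
    case True then show ?thesis using F N by (auto simp: link_def coeffsD(1)[OF N] split: if_splits)
  next
    case False
    then have "m \<in> N (insert y (insert x F))" using F by (simp add: link_def insert_commute)
    then show ?thesis using False F x N by (auto simp: link_def intro!: coeffsD(4)[OF N])
  qed
qed (auto simp: link_def coeffsD(1-3)[OF N])

lemma kd_vanish_on:
  assumes "\<And>F. x \<in> F \<Longrightarrow> a F = 0" "x \<in> F" shows "kd a F = 0"
  using assms by (simp add: kd_def)

text \<open>The product rule d(a + e_x b) = (d a + x b) - e_x d b; passing the differential over e_x
  changes the sign.\<close>

lemma kd_join:
  assumes x: "x \<in> V" and a: "\<And>F. x \<in> F \<Longrightarrow> a F = 0" and b: "\<And>F. x \<in> F \<Longrightarrow> b F = 0"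
    and bV: "\<And>F. \<not> F \<subseteq> V \<Longrightarrow> b F = 0"
  shows "kd (join x a b) = join x (\<lambda>F. kd a F + mul x (b F)) (\<lambda>F. - kd b F)"
proof
  fix F
  show "kd (join x a b) F = join x (\<lambda>F. kd a F + mul x (b F)) (\<lambda>F. - kd b F) F"
  proof (cases "x \<in> F")
    case False
    show ?thesis
    proof (cases "F \<subseteq> V")
      case True
      have "V - F = insert x (V - F - {x})" using x False by auto
      then have "(\<Sum>y\<in>V - F. signed (kpar y F) (mul y (join x a b (insert y F)))) =
        (\<Sum>y\<in>insert x (V - F - {x}). signed (kpar y F) (mul y (join x a b (insert y F))))"
        by simp
      also have "\<dots> = mul x (b F) +
          (\<Sum>y\<in>V - F - {x}. signed (kpar y F) (mul y (join x a b (insert y F))))"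
        using finite_V False by (subst sum.insert) (simp_all add: join_def mul_signed)
      also have "(\<Sum>y\<in>V - F - {x}. signed (kpar y F) (mul y (join x a b (insert y F)))) =
        (\<Sum>y\<in>V - F - {x}. signed (kpar y F) (mul y (a (insert y F))))"
        using False by (intro sum.cong refl) (auto simp: join_def)
      also have "\<dots> = (\<Sum>y\<in>V - F. signed (kpar y F) (mul y (a (insert y F))))"
        using finite_V a by (intro sum.mono_neutral_left) auto
      finally show ?thesis using True False by (simp add: kd_def join_def)
    qed (use False bV in \<open>simp add: kd_def join_def\<close>)
  next
    case True
    define G where "G = F - {x}"
    have F: "F = insert x G" "x \<notin> G" using True by (auto simp: G_def)
    show ?thesis
    proof (cases "F \<subseteq> V")
      case FV: True
      then have fG: "finite G" using F finite_subset_V by auto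
      have "(\<Sum>y\<in>V - F. signed (kpar y F) (mul y (join x a b (insert y F)))) =
        (\<Sum>y\<in>V - F. - signed (kpar x G) (signed (kpar y G) (mul y (b (insert y G)))))"
      proof (intro sum.cong refl)
        fix y assume y: "y \<in> V - F"
        have e: "insert y F - {x} = insert y G" "x \<in> insert y F" using F y by auto
        have p: "kpar y F \<longleftrightarrow> kpar y G = (\<not> kless x y)"
          "kpar x (insert y G) \<longleftrightarrow> kpar x G = kless x y"
          using F y fG kless_flip[of x y] by (auto simp: kpar_insert)
        show "signed (kpar y F) (mul y (join x a b (insert y F))) =
          - signed (kpar x G) (signed (kpar y G) (mul y (b (insert y G))))"
          unfolding join_def e(1) p using e(2) by (auto simp: mul_signed mul_minus signed_def p)
      qed
      also have "\<dots> = - signed (kpar x G) (\<Sum>y\<in>V - F. signed (kpar y G) (mul y (b (insert y G))))"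
        by (simp add: signed_def sum_negf)
      also have "(\<Sum>y\<in>V - F. signed (kpar y G) (mul y (b (insert y G)))) =
          (\<Sum>y\<in>V - G. signed (kpar y G) (mul y (b (insert y G))))"
        using finite_V b F by (intro sum.mono_neutral_left) auto
      finally show ?thesis
        using True FV F by (simp add: kd_def join_def signed_minus G_def[symmetric])
    next
      case FV: False
      then have "\<not> G \<subseteq> V" using F x by auto
      then show ?thesis using True FV by (simp add: kd_def join_def G_def)
    qed
  qed
qed

lemma chain_join:
  assumes N: "coeffs N" and x: "x \<in> V" and a: "chain (del x N) (Suc i) a" and b: "chain (link x N) i b"
  shows "chain N (Suc i) (join x a b)"
proof (rule chainI)
  fix F
  show "join x a b F \<in> N F"
    using chainD(1)[OF a, of F] chainD(1)[OF b, of "F - {x}"] N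
    by (auto simp: join_def del_def link_def insert_absorb intro: coeffs_signed[OF N] split: if_splits)
  assume nz: "join x a b F \<noteq> 0"
  show "F \<subseteq> V \<and> card F = Suc i"
  proof (cases "x \<in> F")
    case True
    then have G: "F - {x} \<subseteq> V" "card (F - {x}) = i"
      using nz chainD[OF b, of "F - {x}"] by (auto simp: join_def)
    then have "F \<subseteq> V" using x by auto
    then show ?thesis using G True card_Suc_Diff1[of F x] finite_subset_V by simp
  next
    case False then show ?thesis using nz chainD[OF a] by (auto simp: join_def)
  qed
qed

lemma chain_join0:
  assumes N: "coeffs N" and a: "chain (del x N) i a"
  shows "chain N i (join x a (\<lambda>F. 0))"
proof (rule chainI)
  fix F
  show "join x a (\<lambda>F. 0) F \<in> N F"
    using chainD(1)[OF a, of F] N by (auto simp: join_def del_def coeffsD(1)[OF N] split: if_splits)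
  assume "join x a (\<lambda>F. 0) F \<noteq> 0"
  then show "F \<subseteq> V \<and> card F = i" using chainD[OF a] by (auto simp: join_def split: if_splits)
qed

lemma del_zero: "chain (del x N) i a \<Longrightarrow> x \<in> F \<Longrightarrow> a F = 0"
  and link_zero: "chain (link x N) i b \<Longrightarrow> x \<in> F \<Longrightarrow> b F = 0"
  using chainD(1)[of "del x N" i a F] chainD(1)[of "link x N" i b F]
  by (auto simp: del_def link_def)

lemma chain_outside: "chain N i c \<Longrightarrow> \<not> F \<subseteq> V \<Longrightarrow> c F = 0"
  using chainD(2) by blast

text \<open>In degree 0 there is no chain of degree -1 to take for \<open>b\<close>; the last two
  clauses separate this case.\<close>

lemma split_chain:
  assumes N: "coeffs N" and c: "chain N i c" and x: "x \<in> V"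
  obtains a b where "chain (del x N) i a" "c = join x a b"
    "\<And>j. i = Suc j \<Longrightarrow> chain (link x N) j b" "i = 0 \<Longrightarrow> b = (\<lambda>F. 0)"
proof
  define a where "a F = (if x \<in> F then 0 else c F)" for F
  define b where "b F = (if x \<in> F then 0 else signed (kpar x F) (c (insert x F)))" for F
  show "chain (del x N) i a"
    by (rule chainI) (use chainD[OF c] in \<open>auto simp: a_def del_def split: if_splits\<close>)
  show "c = join x a b"
    by (rule ext) (auto simp: join_def a_def b_def insert_absorb)
  have nz: "F \<subseteq> V \<and> Suc (card F) = i" if "b F \<noteq> 0" for F
  proof -
    have "x \<notin> F" "c (insert x F) \<noteq> 0" using that by (auto simp: b_def split: if_splits)
    then have "insert x F \<subseteq> V" "card (insert x F) = i" using chainD[OF c] by auto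
    then show ?thesis using \<open>x \<notin> F\<close> finite_subset_V[of F] by auto
  qed
  show "chain (link x N) j b" if "i = Suc j" for j
    by (rule chainI)
      (use nz that chainD(1)[OF c] coeffs_signed[OF N] in \<open>auto simp: b_def link_def\<close>)
  show "b = (\<lambda>F. 0)" if "i = 0" using nz that by fastforce
qed

text \<open>\<open>join\<close> never reads its arguments at sets that contain \<open>x\<close>,
  hence the two side conditions.\<close>

lemma join_inject:
  assumes "join x a b = join x a' b'"
    and "\<And>F. x \<in> F \<Longrightarrow> a F = a' F" "\<And>F. x \<in> F \<Longrightarrow> b F = b' F"
  shows "a = a'" "b = b'"
proof -
  have "a F = a' F" for F
    using fun_cong[OF assms(1), of F] assms(2)[of F] by (auto simp: join_def split: if_splits)
  then show "a = a'" by auto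
  have "b F = b' F" for F
  proof (cases "x \<in> F")
    case False
    then have "insert x F - {x} = F" by auto
    then have "signed (kpar x F) (b F) = signed (kpar x F) (b' F)"
      using fun_cong[OF assms(1), of "insert x F"] by (simp add: join_def)
    then show ?thesis by (metis signed_self)
  qed (use assms(3) in auto)
  then show "b = b'" by auto
qed

lemma join_zero: "join x (\<lambda>F. 0) (\<lambda>F. 0) = (\<lambda>F. 0)"
  by (rule ext) (simp add: join_def)

lemma chain_mul_link:
  assumes N: "coeffs N" and x: "x \<in> V" and b: "chain (link x N) i b"
  shows "chain (del x N) i (\<lambda>F. mul x (b F))"
proof (rule chainI)
  fix F
  have nz: "F \<subseteq> V" if "mul x (b F) \<noteq> 0" using that chain_outside[OF b, of F] by (metis mul_0)
  show "mul x (b F) \<in> del x N F"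
  proof (cases "mul x (b F) = 0")
    case True then show ?thesis using coeffsD(1)[OF coeffs_del[OF N]] by simp
  next
    case False
    then have "F \<subseteq> V" "x \<notin> F" using nz link_zero[OF b, of F] by auto
    then show ?thesis using chainD(1)[OF b, of F] N x by (auto simp: del_def link_def intro: coeffsD(4)[OF N])
  qed
  assume "mul x (b F) \<noteq> 0"
  then have "b F \<noteq> 0" by auto
  then show "F \<subseteq> V \<and> card F = i" using chainD[OF b] by auto
qed

lemma kd_split_cycle:
  assumes x: "x \<in> V" and a: "\<And>F. x \<in> F \<Longrightarrow> a F = 0" and b: "\<And>F. x \<in> F \<Longrightarrow> b F = 0"
    and bV: "\<And>F. \<not> F \<subseteq> V \<Longrightarrow> b F = 0" and z: "\<And>F. kd (join x a b) F = 0"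
  shows "kd a F + mul x (b F) = 0" "kd b F = 0"
proof -
  have "join x (\<lambda>F. kd a F + mul x (b F)) (\<lambda>F. - kd b F) = join x (\<lambda>F. 0) (\<lambda>F. 0)"
    using kd_join[of x a b, OF x a b bV] z join_zero by auto
  from join_inject[OF this] have "(\<lambda>F. kd a F + mul x (b F)) = (\<lambda>F. 0)" "(\<lambda>F. - kd b F) = (\<lambda>F. 0)"
    using kd_vanish_on[of x a, OF a] kd_vanish_on[of x b, OF b] b by auto
  then show "kd a F + mul x (b F) = 0" "kd b F = 0" by (auto dest: fun_cong)
qed

lemma kd_split_boundary:
  assumes x: "x \<in> V" and A: "\<And>F. x \<in> F \<Longrightarrow> A F = 0" and B: "\<And>F. x \<in> F \<Longrightarrow> B F = 0"
    and BV: "\<And>F. \<not> F \<subseteq> V \<Longrightarrow> B F = 0"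
    and a: "\<And>F. x \<in> F \<Longrightarrow> a F = 0" and b: "\<And>F. x \<in> F \<Longrightarrow> b F = 0"
    and z: "kd (join x A B) = join x a b"
  shows "kd A F + mul x (B F) = a F" "- kd B F = b F"
proof -
  have "join x (\<lambda>F. kd A F + mul x (B F)) (\<lambda>F. - kd B F) = join x a b"
    using kd_join[of x A B, OF x A B BV] z by simp
  from join_inject[OF this] have "(\<lambda>F. kd A F + mul x (B F)) = a" "(\<lambda>F. - kd B F) = b"
    using kd_vanish_on[of x A, OF A] kd_vanish_on[of x B, OF B] a b B by auto
  then show "kd A F + mul x (B F) = a F" "- kd B F = b F" by (auto dest: fun_cong)
qed

text \<open>In the sequence of the cone, H_i(N) lies between H_i(del) and H_{i-1}(link). A chain
  \<open>b1\<close> that bounds \<open>b\<close> turns \<open>a\<close> into the cycle a + x b1 of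
  \<open>del x N\<close>.\<close>

lemma vanishes_from_split:
  assumes N: "coeffs N" and x: "x \<in> V"
    and d: "vanishes (del x N) i" and l: "\<And>j. i = Suc j \<Longrightarrow> vanishes (link x N) j"
  shows "vanishes N i"
  unfolding vanishes_def
proof (intro allI impI)
  fix c assume c: "chain N i c" "\<forall>F. kd c F = 0"
  obtain a b where ab: "chain (del x N) i a" "c = join x a b"
    "\<And>j. i = Suc j \<Longrightarrow> chain (link x N) j b" "i = 0 \<Longrightarrow> b = (\<lambda>F. 0)"
    by (rule split_chain[OF N c(1) x], rule that)
  have b0: "b F = 0" if "x \<in> F \<or> \<not> F \<subseteq> V" for F
    using that ab(4) link_zero[OF ab(3), of _ F] chain_outside[OF ab(3), of _ F]
    by (cases i) auto
  have cyc: "kd a F + mul x (b F) = 0" "kd b F = 0" for F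
    using kd_split_cycle[OF x, of a b] del_zero[OF ab(1)] b0 c(2) ab(2) by auto
  have "\<exists>b1. chain (link x N) i b1 \<and> kd b1 = b"
  proof (cases i)
    case 0
    have "kd (\<lambda>F. 0) = b" using ab(4)[OF 0] by auto
    then show ?thesis using chain_zero[OF coeffs_link[OF N x]] by blast
  next
    case (Suc j)
    then show ?thesis using l[OF Suc] ab(3)[OF Suc] cyc(2) by (metis vanishesD)
  qed
  then obtain b1 where b1: "chain (link x N) i b1" "kd b1 = b" by blast
  have "chain (del x N) i (\<lambda>F. a F + mul x (b1 F))"
    by (rule chain_add[OF coeffs_del[OF N] ab(1) chain_mul_link[OF N x b1(1)]])
  moreover have "kd (\<lambda>F. a F + mul x (b1 F)) F = 0" for F
    using cyc(1)[of F] by (simp add: kd_add mul_kd[symmetric] b1)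
  ultimately obtain A where A: "chain (del x N) (Suc i) A" "kd A = (\<lambda>F. a F + mul x (b1 F))"
    by (rule vanishesD[OF d])
  have mb: "chain (link x N) i (\<lambda>F. - b1 F)"
    by (rule chain_minus[OF coeffs_link[OF N x] b1(1)])
  have "kd (join x A (\<lambda>F. - b1 F)) = c"
    unfolding ab(2)
    by (subst kd_join[OF x del_zero[OF A(1)] link_zero[OF mb] chain_outside[OF mb]])
      (simp_all add: A(2) mul_minus kd_minus b1(2))
  then show "\<exists>b. chain N (Suc i) b \<and> kd b = c"
    using chain_join[OF N x A(1) mb] by blast
qed

text \<open>H_i(link) lies between H_{i+1}(N) and H_i(del). Since x b bounds in
  \<open>del x N\<close>, the cycle \<open>b\<close> completes to a cycle of \<open>N\<close>, and
  the link part of a chain bounding the latter bounds \<open>b\<close> up to sign.\<close>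

lemma vanishes_link:
  assumes N: "coeffs N" and x: "x \<in> V"
    and v: "vanishes N (Suc i)" and d: "vanishes (del x N) i"
  shows "vanishes (link x N) i"
  unfolding vanishes_def
proof (intro allI impI)
  fix b assume b: "chain (link x N) i b" "\<forall>F. kd b F = 0"
  have "kd (\<lambda>F. mul x (b F)) F = 0" for F using b(2) by (simp add: mul_kd[symmetric])
  then obtain a where a: "chain (del x N) (Suc i) a" "kd a = (\<lambda>F. mul x (b F))"
    using vanishesD[OF d chain_mul_link[OF N x b(1)]] by blast
  have ma: "chain (del x N) (Suc i) (\<lambda>F. - a F)"
    by (rule chain_minus[OF coeffs_del[OF N] a(1)])
  have "kd (join x (\<lambda>F. - a F) b) F = 0" for F
    by (subst kd_join[OF x del_zero[OF ma] link_zero[OF b(1)] chain_outside[OF b(1)]])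
      (simp_all add: join_def kd_minus a(2) b(2))
  then obtain c where c: "chain N (Suc (Suc i)) c" "kd c = join x (\<lambda>F. - a F) b"
    using vanishesD[OF v chain_join[OF N x ma b(1)]] by blast
  obtain A B where AB: "chain (del x N) (Suc (Suc i)) A" "c = join x A B"
    "\<And>j. Suc (Suc i) = Suc j \<Longrightarrow> chain (link x N) j B"
    using split_chain[OF N c(1) x] by metis
  have B: "chain (link x N) (Suc i) B" using AB(3) by simp
  have "- kd B F = b F" for F
    using kd_split_boundary[OF x del_zero[OF AB(1)] link_zero[OF B] chain_outside[OF B]
        del_zero[OF ma] link_zero[OF b(1)]] c(2) AB(2) by auto
  then have "kd (\<lambda>F. - B F) = b" by (auto simp: kd_minus)
  then show "\<exists>c. chain (link x N) (Suc i) c \<and> kd c = b"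
    using chain_minus[OF coeffs_link[OF N x] B] by blast
qed

text \<open>H_i(del) lies between H_i(link) and H_i(N): the link part of a chain bounding
  \<open>a\<close> in \<open>N\<close> is a cycle, and bounding it in turn removes it.\<close>

lemma vanishes_del:
  assumes N: "coeffs N" and x: "x \<in> V"
    and v: "vanishes N i" and l: "vanishes (link x N) i"
  shows "vanishes (del x N) i"
  unfolding vanishes_def
proof (intro allI impI)
  fix a assume a: "chain (del x N) i a" "\<forall>F. kd a F = 0"
  have "kd (join x a (\<lambda>F. 0)) F = 0" for F
    by (subst kd_join[OF x del_zero[OF a(1)]]) (simp_all add: join_def a(2))
  then obtain c where c: "chain N (Suc i) c" "kd c = join x a (\<lambda>F. 0)"
    using vanishesD[OF v chain_join0[OF N a(1)]] by blast
  obtain A B where AB: "chain (del x N) (Suc i) A" "c = join x A B"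
    "\<And>j. Suc i = Suc j \<Longrightarrow> chain (link x N) j B"
    using split_chain[OF N c(1) x] by metis
  have B: "chain (link x N) i B" using AB(3) by simp
  have eq: "kd A F + mul x (B F) = a F" "- kd B F = 0" for F
    using kd_split_boundary[OF x del_zero[OF AB(1)] link_zero[OF B] chain_outside[OF B]
        del_zero[OF a(1)], where b = "\<lambda>F. 0"] c(2) AB(2) by auto
  obtain B' where B': "chain (link x N) (Suc i) B'" "kd B' = B"
    using vanishesD[OF l B] eq(2) by auto
  have "chain (del x N) (Suc i) (\<lambda>F. A F + mul x (B' F))"
    by (rule chain_add[OF coeffs_del[OF N] AB(1) chain_mul_link[OF N x B'(1)]])
  moreover have "kd (\<lambda>F. A F + mul x (B' F)) = a"
    by (rule ext) (simp add: kd_add mul_kd[symmetric] B'(2) eq(1))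
  ultimately show "\<exists>b. chain (del x N) (Suc i) b \<and> kd b = a" by blast
qed

text \<open>The cone of an isomorphism is acyclic. Dividing \<open>a\<close> by x gives a chain
  \<open>B\<close>, and e_x B bounds the given cycle.\<close>

lemma vanishes_cone:
  assumes N: "coeffs N" and x: "x \<in> V"
    and bij: "\<And>F. F \<subseteq> V \<Longrightarrow> x \<notin> F \<Longrightarrow> bij_betw (mul x) (N (insert x F)) (N F)"
  shows "vanishes N i"
  unfolding vanishes_def
proof (intro allI impI)
  fix c assume c: "chain N i c" "\<forall>F. kd c F = 0"
  obtain a b where ab: "chain (del x N) i a" "c = join x a b"
    "\<And>j. i = Suc j \<Longrightarrow> chain (link x N) j b" "i = 0 \<Longrightarrow> b = (\<lambda>F. 0)"
    by (rule split_chain[OF N c(1) x], rule that)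
  have b0: "b F = 0" if "x \<in> F \<or> \<not> F \<subseteq> V" for F
    using that ab(4) link_zero[OF ab(3), of _ F] chain_outside[OF ab(3), of _ F]
    by (cases i) auto
  have bN: "b F \<in> link x N F" for F
    using ab(4) chainD(1)[OF ab(3), of _ F] coeffsD(1)[OF coeffs_link[OF N x], of F]
    by (cases i) simp_all
  have cyc: "kd a F + mul x (b F) = 0" "kd b F = 0" for F
    using kd_split_cycle[OF x, of a b] del_zero[OF ab(1)] b0 c(2) ab(2) by auto
  have "\<exists>m. m \<in> link x N F \<and> mul x m = a F \<and> (a F = 0 \<longrightarrow> m = 0)" for F
  proof (cases "a F = 0")
    case True then show ?thesis using coeffsD(1)[OF coeffs_link[OF N x]] by auto
  next
    case False
    then have "x \<notin> F" "F \<subseteq> V" "a F \<in> N F"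
      using del_zero[OF ab(1)] chainD[OF ab(1), of F] by (auto simp: del_def split: if_splits)
    then have "a F \<in> mul x ` N (insert x F)" using bij[of F] by (simp add: bij_betw_def)
    then show ?thesis using False \<open>x \<notin> F\<close> by (auto simp: link_def)
  qed
  then obtain B where B: "\<And>F. B F \<in> link x N F" "\<And>F. mul x (B F) = a F" "\<And>F. a F = 0 \<Longrightarrow> B F = 0"
    by metis
  have chB: "chain (link x N) i B"
  proof (rule chainI)
    show "F \<subseteq> V \<and> card F = i" if "B F \<noteq> 0" for F
      using that B(3)[of F] chainD(2,3)[OF ab(1), of F] by blast
  qed (rule B(1))
  have "- kd B F = b F" for F
  proof (cases "F \<subseteq> V \<and> x \<notin> F")
    case True
    have m: "- b F \<in> N (insert x F)"
      using bN[of F] True by (simp add: link_def coeffsD(2)[OF N])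
    have "kd B F \<in> N (insert x F)"
    proof (cases i)
      case 0
      then have "kd B F = 0" using kd_nonzero(2)[of B F i] chainD[OF chB] by auto
      then show ?thesis by (simp add: coeffsD(1)[OF N])
    next
      case (Suc j)
      then show ?thesis
        using chain_kd[OF coeffs_link[OF N x], of j B] chB True chainD(1)[of "link x N" j "kd B" F]
        by (simp add: link_def)
    qed
    \<comment> \<open>Both sides equal the boundary of \<open>a\<close> because a + e_x b is a
      cycle; injectivity of multiplication by x then removes the factor.\<close>
    moreover have "mul x (kd B F) = mul x (- b F)"
      using cyc(1)[of F] by (simp add: mul_kd B(2) mul_minus eq_neg_iff_add_eq_0)
    ultimately have "kd B F = - b F"
      using m bij[of F] True by (auto simp: bij_betw_def dest: inj_onD)
    then show ?thesis by simp
  next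
    case False
    then show ?thesis using b0[of F] kd_vanish_on[of x B F, OF link_zero[OF chB]]
      by (auto simp: kd_def)
  qed
  then have "kd (join x (\<lambda>F. 0) B) = c"
    unfolding ab(2) 
    by (subst kd_join[OF x _ link_zero[OF chB] chain_outside[OF chB]]) (simp_all add: B(2))
  moreover have "chain N (Suc i) (join x (\<lambda>F. 0) B)"
    by (rule chain_join[OF N x chain_zero[OF coeffs_del[OF N]] chB])
  ultimately show "\<exists>b. chain N (Suc i) b \<and> kd b = c" by blast
qed

text \<open>In interpretations where \<open>mul x\<close> is the identity, this rule would rewrite \<open>0\<close> to \<open>0\<close> forever.\<close>

declare mul_0 [simp del]

end

section \<open>Upper Koszul complexes of square-free monomial ideals\<close>

definition upset :: "'v set set \<Rightarrow> bool" where
  "upset U \<longleftrightarrow> (\<forall>S T. S \<in> U \<longrightarrow> S \<subseteq> T \<longrightarrow> T \<in> U)"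

lemma upsetD: "upset U \<Longrightarrow> S \<in> U \<Longrightarrow> S \<subseteq> T \<Longrightarrow> T \<in> U"
  by (simp add: upset_def)

text \<open>If \<open>U\<close> consists of the supports of the monomials of a square-free monomial
  ideal J, this family belongs to J : x.\<close>

definition colon :: "'v \<Rightarrow> 'v set set \<Rightarrow> 'v set set" where
  "colon x U = {S. insert x S \<in> U}"

lemma upset_colon: "upset U \<Longrightarrow> upset (colon x U)"
  unfolding upset_def colon_def using insert_mono by (metis mem_Collect_eq)

locale squarefree_koszul =
  fixes V :: "'v set" and K :: "'k::field itself"
  assumes fin: "finite V"
begin

sublocale sq: koszul V "\<lambda>(x::'v) (m::'k). m"
  by unfold_locales (simp_all add: fin)

text \<open>The upper Koszul complex of J in the square-free multidegree \<open>S\<close>: a set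
  \<open>F\<close> is a face if the monomial of S - F lies in J. A face of size i sits in degree i,
  so the homology here is reduced simplicial homology shifted by one, and in degree i it computes
  the Betti number of J at (i, S).\<close>

definition faces :: "'v set set \<Rightarrow> 'v set \<Rightarrow> 'v set \<Rightarrow> 'k set" where
  "faces U S F = (if F \<subseteq> S \<and> S - F \<in> U then UNIV else {0})"

definition acyclic_at :: "'v set set \<Rightarrow> 'v set \<Rightarrow> nat \<Rightarrow> bool" where
  "acyclic_at U S i \<longleftrightarrow> sq.vanishes (faces U S) i"

lemma mem_faces: "m \<in> faces U S F \<longleftrightarrow> m = 0 \<or> F \<subseteq> S \<and> S - F \<in> U"
  by (auto simp: faces_def)

lemma coeffs_faces:
  assumes "upset U" shows "sq.coeffs (faces U S)"
proof -
  have "m \<in> faces U S F" if "m \<in> faces U S (insert x F)" for m x F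
  proof -
    have "S - insert x F \<in> U \<Longrightarrow> S - F \<in> U"
      by (erule upsetD[OF assms]) blast
    then show ?thesis using that unfolding mem_faces by blast
  qed
  moreover have "0 \<in> faces U S F" "m \<in> faces U S F \<Longrightarrow> - m \<in> faces U S F"
    "m \<in> faces U S F \<Longrightarrow> n \<in> faces U S F \<Longrightarrow> m + n \<in> faces U S F" for m n F
    by (auto simp: mem_faces)
  ultimately show ?thesis unfolding sq.coeffs_def by blast
qed

text \<open>A face that avoids x leaves x in the complement, where it may be used freely; this is
  membership in J : x. A face through x has spent it, so that \<open>link\<close> sees J
  itself.\<close>

lemma del_faces: "x \<in> S \<Longrightarrow> sq.del x (faces U S) = faces (colon x U) (S - {x})"
proof
  fix F assume x: "x \<in> S"
  have "x \<notin> F \<Longrightarrow> insert x (S - {x} - F) = S - F" using x by auto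
  then show "sq.del x (faces U S) F = faces (colon x U) (S - {x}) F"
    by (auto simp: sq.del_def faces_def colon_def)
qed

lemma link_faces: "x \<in> S \<Longrightarrow> sq.link x (faces U S) = faces U (S - {x})"
proof
  fix F assume x: "x \<in> S"
  have "S - {x} - F = S - insert x F" by auto
  then show "sq.link x (faces U S) F = faces U (S - {x}) F"
    using x by (auto simp: sq.link_def faces_def)
qed

lemma acyclic_from_split:
  assumes "upset U" "x \<in> V" "x \<in> S" "acyclic_at (colon x U) (S - {x}) i"
    "\<And>j. i = Suc j \<Longrightarrow> acyclic_at U (S - {x}) j"
  shows "acyclic_at U S i"
  using sq.vanishes_from_split[OF coeffs_faces[OF assms(1)] assms(2), of S i] assms
  by (simp add: acyclic_at_def del_faces link_faces)

lemma acyclic_link: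
  assumes "upset U" "x \<in> V" "x \<in> S" "acyclic_at U S (Suc i)" "acyclic_at (colon x U) (S - {x}) i"
  shows "acyclic_at U (S - {x}) i"
  using sq.vanishes_link[OF coeffs_faces[OF assms(1)] assms(2), of S i] assms
  by (simp add: acyclic_at_def del_faces link_faces)

lemma acyclic_colon:
  assumes "upset U" "x \<in> V" "x \<in> S" "acyclic_at U S i" "acyclic_at U (S - {x}) i"
  shows "acyclic_at (colon x U) (S - {x}) i"
  using sq.vanishes_del[OF coeffs_faces[OF assms(1)] assms(2), of S i] assms
  by (simp add: acyclic_at_def del_faces link_faces)

text \<open>If x does not affect membership below \<open>S\<close>, adding x to a face gives a face
  again: the complex is a cone with apex x.\<close>

lemma acyclic_isolated:
  assumes "upset U" "x \<in> V" "x \<in> S" "\<And>T. T \<subseteq> S \<Longrightarrow> insert x T \<in> U \<longleftrightarrow> T \<in> U"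
  shows "acyclic_at U S i"
  unfolding acyclic_at_def
proof (rule sq.vanishes_cone[OF coeffs_faces[OF assms(1)] assms(2)])
  fix F assume "F \<subseteq> V" "x \<notin> F"
  then have "insert x (S - insert x F) = S - F" using assms(3) by auto
  then have "S - F \<in> U \<longleftrightarrow> S - insert x F \<in> U" using assms(4)[of "S - insert x F"] by auto
  then have "faces U S (insert x F) = faces U S F" using assms(3) by (auto simp: faces_def)
  then show "bij_betw (\<lambda>m. m) (faces U S (insert x F)) (faces U S F)" by (simp add: bij_betw_def)
qed

lemma acyclic_cong:
  assumes "\<And>T. T \<subseteq> S \<Longrightarrow> T \<in> U \<longleftrightarrow> T \<in> U'"
  shows "acyclic_at U S i \<longleftrightarrow> acyclic_at U' S i"
proof -
  have "faces U S = faces U' S" using assms by (auto simp: faces_def fun_eq_iff)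
  then show ?thesis by (simp add: acyclic_at_def)
qed

text \<open>\<open>S\<close> is the support of a minimal generator. Its complex consists of the
  empty face alone, and nothing bounds that face.\<close>

lemma not_acyclic_minimal:
  assumes "S \<in> U" "\<And>T. T \<subset> S \<Longrightarrow> T \<notin> U"
  shows "\<not> acyclic_at U S 0"
proof
  assume "acyclic_at U S 0"
  define c :: "'v set \<Rightarrow> 'k" where "c F = (if F = {} then 1 else 0)" for F
  have "sq.chain (faces U S) 0 c"
    by (rule sq.chainI) (auto simp: c_def faces_def assms split: if_splits)
  moreover have "sq.kd c F = 0" for F by (simp add: sq.kd_def c_def)
  ultimately obtain b where b: "sq.chain (faces U S) (Suc 0) b" "sq.kd b = c"
    using sq.vanishesD \<open>acyclic_at U S 0\<close> unfolding acyclic_at_def by blast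
  have "b (insert x {}) = 0" for x
    using sq.chainD(1)[OF b(1), of "{x}"] assms(2)[of "S - {x}"]
    by (auto simp: faces_def split: if_splits)
  then have "sq.kd b {} = 0" by (simp add: sq.kd_def)
  then show False by (simp add: b(2) c_def)
qed

text \<open>By Hochster's formula this bounds the regularity of the ideal generated, in the
  variables \<open>W\<close>, by the members of \<open>U\<close> inside \<open>W\<close>. As a
  conjunction of vanishing statements it holds for every \<open>r\<close> if that ideal is
  zero.\<close>

definition reg_le :: "'v set \<Rightarrow> 'v set set \<Rightarrow> int \<Rightarrow> bool" where
  "reg_le W U r \<longleftrightarrow> (\<forall>S\<subseteq>W. \<forall>i. int (card S) > r + int i \<longrightarrow> acyclic_at U S i)"

lemma reg_leD: "reg_le W U r \<Longrightarrow> S \<subseteq> W \<Longrightarrow> int (card S) > r + int i \<Longrightarrow> acyclic_at U S i"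
  by (simp add: reg_le_def)

lemma reg_le_mono: "reg_le W U r \<Longrightarrow> r \<le> r' \<Longrightarrow> reg_le W U r'"
  by (auto simp: reg_le_def)

lemma reg_le_cong:
  assumes "\<And>T. T \<subseteq> W \<Longrightarrow> T \<in> U \<longleftrightarrow> T \<in> U'"
  shows "reg_le W U r \<longleftrightarrow> reg_le W U' r"
  unfolding reg_le_def using acyclic_cong[of _ U U'] assms by (meson subset_trans)

text \<open>Removing x from a multidegree lowers its size by one. For the deletion the homological
  degree drops as well, so the bound stays \<open>r\<close>; for the colon it does not, so the bound
  there has to be r - 1.\<close>

lemma reg_le_split:
  assumes U: "upset U" and x: "x \<in> V" "W \<subseteq> V"
    and c: "reg_le (W - {x}) (colon x U) (r - 1)" and d: "reg_le (W - {x}) U r"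
  shows "reg_le W U r"
  unfolding reg_le_def
proof (intro allI impI)
  fix S i assume S: "S \<subseteq> W" "r + int i < int (card S)"
  show "acyclic_at U S i"
  proof (cases "x \<in> S")
    case True
    have "finite S" by (rule finite_subset[OF subset_trans[OF S(1) x(2)] fin])
    then have card: "card S = Suc (card (S - {x}))" using True by (simp only: card_Suc_Diff1)
    show ?thesis
    proof (rule acyclic_from_split[OF U x(1) True])
      show "acyclic_at (colon x U) (S - {x}) i"
        using S card by (intro reg_leD[OF c]) auto
      show "acyclic_at U (S - {x}) j" if "i = Suc j" for j
        using S card that by (intro reg_leD[OF d]) auto
    qed
  next
    case False then show ?thesis using reg_leD[OF d] S by auto
  qed
qed

lemma reg_le_isolated:
  assumes U: "upset U" and x: "x \<in> V" and iso: "\<And>T. T \<subseteq> W \<Longrightarrow> insert x T \<in> U \<longleftrightarrow> T \<in> U"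
    and d: "reg_le (W - {x}) U r"
  shows "reg_le W U r"
  unfolding reg_le_def
proof (intro allI impI)
  fix S i assume S: "S \<subseteq> W" "r + int i < int (card S)"
  show "acyclic_at U S i"
  proof (cases "x \<in> S")
    case True
    then show ?thesis using acyclic_isolated[OF U x True] iso S by auto
  next
    case False then show ?thesis using reg_leD[OF d] S by auto
  qed
qed

text \<open>Over \<open>W\<close> this is the unit ideal, whose only homology sits at the empty
  multidegree.\<close>

lemma reg_le_all_faces:
  assumes "W \<subseteq> V" "\<And>T. T \<subseteq> W \<Longrightarrow> T \<in> U" "0 \<le> r"
  shows "reg_le W U r"
proof -
  have "reg_le W UNIV r"
    unfolding reg_le_def
  proof (intro allI impI)
    fix S i assume S: "S \<subseteq> W" "r + int i < int (card S)"
    then obtain x where "x \<in> S" using assms(3) by (metis card.empty ex_in_conv of_nat_0 of_nat_0_le_iff add_nonneg_nonneg not_le)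
    then show "acyclic_at UNIV S i"
      using S assms(1) by (intro acyclic_isolated[of _ x]) (auto simp: upset_def)
  qed
  then show ?thesis using reg_le_cong[of W U UNIV] assms(2) by auto
qed

end


section \<open>Sets of vertices containing a matching\<close>

text \<open>The supports of the monomials in the k-th square-free power of the edge ideal, as
  \<open>squarefree_power_eq\<close> confirms.\<close>

definition matched :: "'v set set \<Rightarrow> nat \<Rightarrow> 'v set set" where
  "matched E k = {S. \<exists>M\<subseteq>E. finite M \<and> card M = k \<and> pairwise disjnt M \<and> \<Union>M \<subseteq> S}"

lemma upset_matched: "upset (matched E k)"
  unfolding upset_def matched_def by blast

lemma matched_0: "S \<in> matched E 0"
  unfolding matched_def by (auto intro!: exI[of _ "{}"])

lemma matched_cong:
  assumes "\<And>e. e \<subseteq> S \<Longrightarrow> e \<in> E \<longleftrightarrow> e \<in> E'"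
  shows "S \<in> matched E k \<longleftrightarrow> S \<in> matched E' k"
proof -
  have M: "M \<subseteq> E \<longleftrightarrow> M \<subseteq> E'" if "\<Union>M \<subseteq> S" for M
  proof -
    have "e \<in> E \<longleftrightarrow> e \<in> E'" if "e \<in> M" for e
      using assms[of e] \<open>\<Union>M \<subseteq> S\<close> that by blast
    then show ?thesis by (simp only: subset_eq cong: ball_cong)
  qed
  show ?thesis
    unfolding matched_def mem_Collect_eq by (intro ex_cong1) (use M in blast)
qed

lemma matched_isolated:
  assumes "\<And>e. e \<in> E \<Longrightarrow> y \<in> e \<Longrightarrow> \<not> e \<subseteq> insert y S"
  shows "insert y S \<in> matched E k \<longleftrightarrow> S \<in> matched E k"
proof
  assume "insert y S \<in> matched E k"
  then obtain M where M: "M \<subseteq> E" "finite M" "card M = k" "pairwise disjnt M" "\<Union>M \<subseteq> insert y S"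
    by (auto simp: matched_def)
  have "y \<notin> e" if "e \<in> M" for e
    using assms[of e] M(1,5) that by blast
  then have "\<Union>M \<subseteq> S" using M(5) by blast
  then show "S \<in> matched E k" using M unfolding matched_def by blast
qed (rule upsetD[OF upset_matched], auto)

text \<open>A matching that avoids the leaf edge can be exchanged for one that uses it.\<close>

lemma matched_leaf:
  assumes xy: "{x, y} \<in> E" "x \<notin> S" "y \<notin> S"
    and leaf: "\<And>e. e \<in> E \<Longrightarrow> y \<in> e \<Longrightarrow> e \<subseteq> insert x (insert y S) \<Longrightarrow> e = {x, y}"
  shows "insert x (insert y S) \<in> matched E (Suc k) \<longleftrightarrow> S \<in> matched E k"
proof
  assume "insert x (insert y S) \<in> matched E (Suc k)"
  then obtain M where M: "M \<subseteq> E" "finite M" "card M = Suc k" "pairwise disjnt M"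
    "\<Union>M \<subseteq> insert x (insert y S)"
    by (auto simp: matched_def)
  have "M \<noteq> {}" using M(3) by auto
  have "\<exists>e0\<in>M. \<forall>e\<in>M. x \<in> e \<longrightarrow> e = e0"
  proof (cases "\<exists>e\<in>M. x \<in> e")
    case True
    then show ?thesis using M(4) unfolding pairwise_def disjnt_def by blast
  next
    case False then show ?thesis using \<open>M \<noteq> {}\<close> by blast
  qed
  then obtain e0 where e0: "e0 \<in> M" "\<And>e. e \<in> M \<Longrightarrow> x \<in> e \<Longrightarrow> e = e0" by blast
  have "\<Union>(M - {e0}) \<subseteq> S"
  proof
    fix z assume "z \<in> \<Union>(M - {e0})"
    then obtain e where e: "e \<in> M" "e \<noteq> e0" "z \<in> e" by blast
    have "x \<notin> e" using e0(2) e by blast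
    moreover from this have "y \<notin> e" using leaf[of e] e(1) M(1,5) by blast
    ultimately show "z \<in> S" using e M(5) by blast
  qed
  moreover have "card (M - {e0}) = k" using e0(1) M(2,3) by simp
  moreover have "pairwise disjnt (M - {e0})" using M(4) by (meson Diff_subset pairwise_subset)
  ultimately show "S \<in> matched E k"
    unfolding matched_def using M(1,2) by (auto intro!: exI[of _ "M - {e0}"])
next
  assume "S \<in> matched E k"
  then obtain M where M: "M \<subseteq> E" "finite M" "card M = k" "pairwise disjnt M" "\<Union>M \<subseteq> S"
    by (auto simp: matched_def)
  have "{x, y} \<notin> M" using M(5) xy by blast
  moreover have "pairwise disjnt (insert {x, y} M)"
    using M(4,5) xy by (auto simp: pairwise_insert disjnt_def)
  ultimately show "insert x (insert y S) \<in> matched E (Suc k)"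
    unfolding matched_def using M xy by (auto intro!: exI[of _ "insert {x, y} M"])
qed

lemma matched_card:
  assumes "\<And>e. e \<in> E \<Longrightarrow> card e = 2" "finite S" "S \<in> matched E k"
  shows "2 * k \<le> card S"
proof -
  obtain M where M: "M \<subseteq> E" "finite M" "card M = k" "pairwise disjnt M" "\<Union>M \<subseteq> S"
    using assms(3) by (auto simp: matched_def)
  have "finite e" if "e \<in> M" for e
    using assms(1)[of e] M(1) that by (intro card_ge_0_finite) auto
  then have "card (\<Union>M) = (\<Sum>e\<in>M. card e)"
    using M by (intro card_Union_disjoint) auto
  also have "\<dots> = (\<Sum>e\<in>M. 2)"
    using M(1) assms(1) by (intro sum.cong refl) auto
  also have "\<dots> = 2 * k" using M(3) by simp
  finally show ?thesis using card_mono[OF assms(2) M(5)] by simp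
qed


section \<open>Whiskered paths and cycles\<close>

definition block :: "nat \<Rightarrow> nat \<Rightarrow> whisker_vertex set" where
  "block a b = X ` {a..<b} \<union> Y ` {a..<b}"

text \<open>The edges of an infinite whiskered path. Finite ones are cut out by the vertex set
  alone, so that deleting vertices never changes the edge set.\<close>

definition path_edges :: "whisker_vertex set set" where
  "path_edges = {{X i, X (Suc i)} | i. True} \<union> {{X i, Y i} | i. True}"

text \<open>For \<open>b = a + 2\<close> the closing edge belongs to the path; for \<open>b = a + 1\<close> it would be a loop.\<close>

definition cycle_edges :: "nat \<Rightarrow> nat \<Rightarrow> whisker_vertex set set" where
  "cycle_edges a b = path_edges \<union> (if a + 2 \<le> b then {{X a, X (b - 1)}} else {})"

text \<open>In the form floor((n + 3k) / 2) the savings are visible: n - 1 with k - 1 saves exactly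
  2, n - 2 with k exactly 1, and n - 2 with k - 1 at least 2.\<close>

definition reg_bound :: "nat \<Rightarrow> nat \<Rightarrow> int" where
  "reg_bound n k = 2 * int k + (int n - int k) div 2"

lemma finite_block [simp]: "finite (block a b)"
  by (simp add: block_def)

lemma card_block: "card (block a b) = 2 * (b - a)"
proof -
  have "card (X ` {a..<b} \<union> Y ` {a..<b}) = card (X ` {a..<b}) + card (Y ` {a..<b})"
    by (rule card_Un_disjoint) auto
  then show ?thesis by (simp add: block_def card_image inj_on_def)
qed

lemma mem_block [simp]: "X i \<in> block a b \<longleftrightarrow> a \<le> i \<and> i < b" "Y i \<in> block a b \<longleftrightarrow> a \<le> i \<and> i < b"
  by (auto simp: block_def)

lemma block_mono: "a' \<le> a \<Longrightarrow> b \<le> b' \<Longrightarrow> block a b \<subseteq> block a' b'"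
  by (auto simp: block_def)

lemma block_minus_top: "a \<le> b \<Longrightarrow> block a (Suc b) - {X b} - {Y b} = block a b"
  by (auto simp: block_def)

lemma block_minus_bot: "block a b - {X a} - {Y a} = block (Suc a) b"
  by (auto simp: block_def)

lemma path_edgesE:
  assumes "e \<in> path_edges"
  obtains i where "e = {X i, X (Suc i)}" | i where "e = {X i, Y i}"
  using assms by (auto simp: path_edges_def)

lemma cycle_edgesE:
  assumes "e \<in> cycle_edges a b"
  obtains i where "e = {X i, X (Suc i)}" | i where "e = {X i, Y i}" | "e = {X a, X (b - 1)}" "a + 2 \<le> b"
  using assms by (auto simp: cycle_edges_def path_edges_def split: if_splits)

lemma path_edges_I [intro]: "{X i, X (Suc i)} \<in> path_edges" "{X i, Y i} \<in> path_edges"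
  "{X (Suc i), X i} \<in> path_edges" "{Y i, X i} \<in> path_edges"
  by (auto simp: path_edges_def)

lemma card_path_edge: "e \<in> path_edges \<Longrightarrow> card e = 2"
  by (auto simp: path_edges_def)

lemma card_cycle_edge: "e \<in> cycle_edges a b \<Longrightarrow> card e = 2"
  by (auto simp: path_edges_def cycle_edges_def split: if_splits)

lemma path_edges_subset_cycle: "path_edges \<subseteq> cycle_edges a b"
  by (auto simp: cycle_edges_def)

lemma matched_isolated_Y:
  assumes "X i \<notin> T"
  shows "insert (Y i) T \<in> matched path_edges k \<longleftrightarrow> T \<in> matched path_edges k"
    "insert (Y i) T \<in> matched (cycle_edges a b) k \<longleftrightarrow> T \<in> matched (cycle_edges a b) k"
  by (rule matched_isolated; use assms in \<open>auto elim!: path_edgesE cycle_edgesE\<close>)+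

lemma matched_isolated_X:
  assumes "Y i \<notin> T" "X (Suc i) \<notin> T" "\<And>j. i = Suc j \<Longrightarrow> X j \<notin> T"
  shows "insert (X i) T \<in> matched path_edges k \<longleftrightarrow> T \<in> matched path_edges k"
  by (rule matched_isolated) (use assms in \<open>auto elim!: path_edgesE\<close>)

lemma matched_leaf_Y:
  assumes "X i \<notin> T" "Y i \<notin> T"
  shows "insert (X i) (insert (Y i) T) \<in> matched path_edges (Suc k) \<longleftrightarrow> T \<in> matched path_edges k"
    "insert (X i) (insert (Y i) T) \<in> matched (cycle_edges a b) (Suc k) \<longleftrightarrow> T \<in> matched (cycle_edges a b) k"
  by (rule matched_leaf;
      use assms path_edges_subset_cycle[of a b] in \<open>auto elim!: path_edgesE cycle_edgesE\<close>)+

text \<open>Here \<open>X (Suc i)\<close> is the leaf, since its whisker and its upper neighbour are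
  absent.\<close>

lemma matched_leaf_X:
  assumes "X i \<notin> T" "X (Suc i) \<notin> T" "X (Suc (Suc i)) \<notin> T" "Y (Suc i) \<notin> T"
  shows "insert (X i) (insert (X (Suc i)) T) \<in> matched path_edges (Suc k) \<longleftrightarrow> T \<in> matched path_edges k"
  by (rule matched_leaf) (use assms in \<open>auto elim!: path_edgesE\<close>)

lemma matched_cycle_path:
  assumes "X a \<notin> T \<or> X (b - 1) \<notin> T"
  shows "T \<in> matched (cycle_edges a b) k \<longleftrightarrow> T \<in> matched path_edges k"
  by (rule matched_cong) (use assms in \<open>auto simp: cycle_edges_def split: if_splits\<close>)

lemma cycle_edges_degenerate: "b \<le> a + 2 \<Longrightarrow> cycle_edges a b = path_edges"
  by (cases "b = a + 2") (auto simp: cycle_edges_def)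

text \<open>Contracting the path through the top and bottom vertices of a whiskered cycle, whose
  whiskers have been deleted, yields a whiskered cycle that is shorter by two.\<close>

lemma matched_contract:
  assumes t: "t = a + p + 2" and T: "T \<subseteq> block (Suc a) t"
  shows "insert (X t) (insert (X a) T) \<in> matched (cycle_edges a (Suc t)) (Suc k) \<longleftrightarrow>
    T \<in> matched (cycle_edges (Suc a) t) k"
proof
  let ?u = "X a" and ?v = "X t" and ?p = "X (Suc a)" and ?q = "X (t - 1)"
  have notin: "?u \<notin> T" "?v \<notin> T" "Y a \<notin> T" "Y t \<notin> T" "X (Suc t) \<notin> T" "\<And>j. a = Suc j \<Longrightarrow> X j \<notin> T"
    using T by auto
  assume "insert (X t) (insert (X a) T) \<in> matched (cycle_edges a (Suc t)) (Suc k)"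
  then obtain M where M: "M \<subseteq> cycle_edges a (Suc t)" "finite M" "card M = Suc k"
    "pairwise disjnt M" "\<Union>M \<subseteq> insert ?v (insert ?u T)"
    by (auto simp: matched_def)
  have disj: "e = e'" if "e \<in> M" "e' \<in> M" "z \<in> e" "z \<in> e'" for e e' z
    using M(4) that by (auto simp: pairwise_def disjnt_def)
  have sub: "e \<subseteq> insert ?v (insert ?u T)" "e \<in> cycle_edges a (Suc t)" if "e \<in> M" for e
    using M(1,5) that by auto
  have inner: "e \<in> cycle_edges (Suc a) t" if "e \<in> M" "?u \<notin> e" "?v \<notin> e" for e
  proof -
    have "e \<in> path_edges"
      using sub[OF that(1)] that(2,3) by (auto simp: cycle_edges_def split: if_splits)
    then show ?thesis using path_edges_subset_cycle by blast
  qed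
  \<comment> \<open>Either no edge other than \<open>e0\<close> meets the two contracted vertices,
    and \<open>e0\<close> is dropped, or two distinct edges meet them and are traded for the closing
    edge between \<open>?p\<close> and \<open>?q\<close>.\<close>
  show "T \<in> matched (cycle_edges (Suc a) t) k"
  proof (cases "\<exists>e0\<in>M. \<forall>e\<in>M. ?u \<in> e \<or> ?v \<in> e \<longrightarrow> e = e0")
    case True
    then obtain e0 where e0: "e0 \<in> M" "\<And>e. e \<in> M \<Longrightarrow> ?u \<in> e \<or> ?v \<in> e \<Longrightarrow> e = e0" by blast
    have "M - {e0} \<subseteq> cycle_edges (Suc a) t" using inner e0(2) by blast
    moreover have "\<Union>(M - {e0}) \<subseteq> T" using e0(2) M(5) by blast
    moreover have "card (M - {e0}) = k" using e0(1) M(2,3) by simp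
    moreover have "pairwise disjnt (M - {e0})" using M(4) by (meson Diff_subset pairwise_subset)
    ultimately show ?thesis unfolding matched_def using M(2) by blast
  next
    case False
    have "M \<noteq> {}" using M(3) by auto
    obtain e1 where e1: "e1 \<in> M" "?u \<in> e1"
      using False \<open>M \<noteq> {}\<close> disj by (metis ex_in_conv)
    obtain e2 where e2: "e2 \<in> M" "?v \<in> e2"
      using False \<open>M \<noteq> {}\<close> disj by (metis ex_in_conv)
    have ne: "e1 \<noteq> e2"
      using False e1 e2 disj by metis
    have "?v \<notin> e1" "?u \<notin> e2" using ne e1 e2 disj by metis+
    \<comment> \<open>Neither the whisker of \<open>X a\<close> nor a path vertex below it is
      present, and the closing edge would meet \<open>X t\<close>; one edge is left. The situation
      at \<open>X t\<close> is symmetric.\<close>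
    have e1': "e1 = {?u, ?p}"
      using sub(2)[OF e1(1)]
    proof (cases rule: cycle_edgesE)
      case (1 i)
      show ?thesis
      proof (cases "a = i")
        case False
        then have "a = Suc i" using 1 e1(2) by auto
        then have "X i \<in> T" using 1 sub(1)[OF e1(1)] t by auto
        then show ?thesis using notin(6) \<open>a = Suc i\<close> by auto
      qed (use 1 in auto)
    next
      case (2 i)
      then show ?thesis using e1(2) sub(1)[OF e1(1)] notin by auto
    qed (use \<open>?v \<notin> e1\<close> in auto)
    have e2': "e2 = {?q, ?v}"
      using sub(2)[OF e2(1)]
    proof (cases rule: cycle_edgesE)
      case (1 i)
      show ?thesis
      proof (cases "t = Suc i")
        case False
        then have "t = i" using 1 e2(2) by auto
        then show ?thesis using 1 sub(1)[OF e2(1)] t notin(5) by auto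
      qed (use 1 in auto)
    next
      case (2 i)
      then show ?thesis using e2(2) sub(1)[OF e2(1)] notin by auto
    qed (use \<open>?u \<notin> e2\<close> in auto)
    have pq: "?p \<noteq> ?q" using ne disj[OF e1(1) e2(1)] e1' e2' by auto
    have pM: "e = e1" if "e \<in> M" "?p \<in> e" for e using disj[OF that(1) e1(1) that(2)] e1' by auto
    have qM: "e = e2" if "e \<in> M" "?q \<in> e" for e using disj[OF that(1) e2(1) that(2)] e2' by auto
    have uM: "e = e1" if "e \<in> M" "?u \<in> e" for e using disj[OF that(1) e1(1) that(2)] e1' by auto
    have vM: "e = e2" if "e \<in> M" "?v \<in> e" for e using disj[OF that(1) e2(1) that(2)] e2' by auto
    define M' where "M' = M - {e1, e2}"
    have "{?p, ?q} \<notin> M'" unfolding M'_def using pM by blast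
    moreover have "card M' = k - 1" "0 < k"
    proof -
      have "card M' = card M - card {e1, e2}"
        unfolding M'_def using e1 e2 by (intro card_Diff_subset) auto
      then show "card M' = k - 1" using M(3) ne by simp
      have "card {e1, e2} \<le> card M" using e1 e2 M(2) by (intro card_mono) auto
      then show "0 < k" using M(3) ne by simp
    qed
    moreover have "finite M'" using M(2) by (simp add: M'_def)
    ultimately have card: "card (insert {?p, ?q} M') = k" by simp
    have "Suc a + 2 \<le> t" using pq t by (cases p) auto
    then have "{?p, ?q} \<in> cycle_edges (Suc a) t" by (simp add: cycle_edges_def)
    moreover have "M' \<subseteq> cycle_edges (Suc a) t" unfolding M'_def using inner uM vM by blast
    ultimately have E: "insert {?p, ?q} M' \<subseteq> cycle_edges (Suc a) t" by blast
    have "pairwise disjnt M'" using M(4) unfolding M'_def by (meson Diff_subset pairwise_subset)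
    moreover have "?p \<notin> e \<and> ?q \<notin> e" if "e \<in> M'" for e using that pM qM unfolding M'_def by blast
    ultimately have pw: "pairwise disjnt (insert {?p, ?q} M')"
      by (auto simp: pairwise_insert disjnt_def)
    have "?p \<in> T" using sub(1)[OF e1(1)] e1' t by auto
    moreover have "?q \<in> T" using sub(1)[OF e2(1)] e2' t by auto
    moreover have "\<Union>M' \<subseteq> T" unfolding M'_def using uM vM M(5) by blast
    ultimately have "\<Union>(insert {?p, ?q} M') \<subseteq> T" by simp
    then show ?thesis
      unfolding matched_def using E card pw \<open>finite M'\<close> by blast
  qed
next
  let ?u = "X a" and ?v = "X t" and ?p = "X (Suc a)" and ?q = "X (t - 1)"
  have notin: "?u \<notin> T" "?v \<notin> T" using T by auto
  assume "T \<in> matched (cycle_edges (Suc a) t) k"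
  then obtain M where M: "M \<subseteq> cycle_edges (Suc a) t" "finite M" "card M = k"
    "pairwise disjnt M" "\<Union>M \<subseteq> T"
    by (auto simp: matched_def)
  have uv: "?u \<notin> e \<and> ?v \<notin> e" if "e \<in> M" for e using M(5) that notin by blast
  \<comment> \<open>If the closing edge of the short cycle is used, it is stretched to the two edges
    that join its ends to \<open>X a\<close> and \<open>X t\<close>. Otherwise the edge between
    \<open>X a\<close> and \<open>X t\<close> is added.\<close>
  show "insert (X t) (insert (X a) T) \<in> matched (cycle_edges a (Suc t)) (Suc k)"
  proof (cases "Suc a + 2 \<le> t \<and> {?p, ?q} \<in> M")
    case True
    define M' where "M' = M - {{?p, ?q}}"
    have M': "finite M'" "Suc (card M') = k"
      unfolding M'_def
      by (rule finite_Diff[OF M(2)], rule trans[OF card_Suc_Diff1[OF M(2) conjunct2[OF True]] M(3)])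
    have pq: "?p \<notin> e \<and> ?q \<notin> e" if "e \<in> M'" for e
    proof -
      have "e \<in> M" "e \<noteq> {?p, ?q}" using that by (auto simp: M'_def)
      then have "disjnt e {?p, ?q}" using pairwiseD[OF M(4)] True by blast
      then show ?thesis by (simp add: disjnt_iff) blast
    qed
    have uv': "?u \<notin> e \<and> ?v \<notin> e" if "e \<in> M'" for e using that uv unfolding M'_def by blast
    have "pairwise disjnt M'" using M(4) unfolding M'_def by (meson Diff_subset pairwise_subset)
    then have pw: "pairwise disjnt (insert {?u, ?p} (insert {?q, ?v} M'))"
      using pq uv' True t by (auto simp: pairwise_insert disjnt_def)
    have "{?u, ?p} \<notin> insert {?q, ?v} M'" "{?q, ?v} \<notin> M'"
      using uv' True t by (auto simp: doubleton_eq_iff)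
    then have card: "card (insert {?u, ?p} (insert {?q, ?v} M')) = Suc k"
      using M' by simp
    have "M' \<subseteq> path_edges"
      using M(1) by (auto simp: M'_def cycle_edges_def split: if_splits)
    moreover have "t = Suc (t - 1)" using t by simp
    then have "{?q, ?v} \<in> path_edges" using path_edges_I(1)[of "t - 1"] by simp
    ultimately have E: "insert {?u, ?p} (insert {?q, ?v} M') \<subseteq> cycle_edges a (Suc t)"
      using path_edges_subset_cycle by blast
    have "{?p, ?q} \<subseteq> T" using True M(5) by blast
    then have "\<Union>(insert {?u, ?p} (insert {?q, ?v} M')) \<subseteq> insert ?v (insert ?u T)"
      using M(5) by (auto simp: M'_def)
    then show ?thesis
      unfolding matched_def using E card pw M'(1) by blast
  next
    case False
    then have "M \<subseteq> path_edges"
      using M(1) by (auto simp: cycle_edges_def split: if_splits)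
    moreover have "{?u, ?v} \<in> cycle_edges a (Suc t)" using t by (simp add: cycle_edges_def)
    ultimately have E: "insert {?u, ?v} M \<subseteq> cycle_edges a (Suc t)"
      using path_edges_subset_cycle by blast
    have "{?u, ?v} \<notin> M" using uv by blast
    then have "card (insert {?u, ?v} M) = Suc k" using M(2,3) by simp
    moreover have "pairwise disjnt (insert {?u, ?v} M)"
      using M(4) uv by (auto simp: pairwise_insert disjnt_def)
    moreover have "\<Union>(insert {?u, ?v} M) \<subseteq> insert ?v (insert ?u T)" using M(5) by auto
    ultimately show ?thesis
      unfolding matched_def using E M(2) by blast
  qed
qed

lemma reg_bound_nonneg: "0 \<le> reg_bound n k"
  unfolding reg_bound_def by linarith

section \<open>Upper bounds for whiskered paths and cycles\<close>

locale whiskered = squarefree_koszul V K for V :: "whisker_vertex set" and K :: "'k::field itself"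
begin

lemma reg_le_empty: "0 \<le> r \<Longrightarrow> reg_le {} U r"
  by (simp add: reg_le_def)

lemma reg_le_transfer:
  assumes "reg_le W U' r'" "\<And>T. T \<subseteq> W \<Longrightarrow> T \<in> U \<longleftrightarrow> T \<in> U'" "r' \<le> r"
  shows "reg_le W U r"
  using reg_le_cong[OF assms(2), where r = r] reg_le_mono[OF assms(1,3)] by blast

text \<open>A whiskered path below an inverted vertex whose own whisker is deleted. The lemma serves
  inside the induction for \<open>reg_le_path\<close>, hence the bounds for shorter paths as
  hypothesis \<open>IH\<close>. For n = 0 and k = 0 the bound would be -1, which the unit ideal
  violates.\<close>

lemma reg_le_colon_path:
  assumes V: "block a (a + n) \<subseteq> V" and k: "1 \<le> k"
    and IH: "\<And>n' k. n = Suc n' \<Longrightarrow> reg_le (block a (a + n')) (matched path_edges k) (reg_bound n' k)"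
  shows "reg_le (block a (a + n)) (colon (X (a + n)) (matched path_edges k)) (reg_bound (Suc n) k - 1)"
proof (cases n)
  case 0
  have "0 \<le> reg_bound (Suc n) k - 1" using k unfolding reg_bound_def by linarith
  then show ?thesis using 0 by (simp add: block_def reg_le_empty)
next
  case (Suc n')
  obtain k' where k': "k = Suc k'" using k by (cases k) auto
  define b where "b = a + n'"
  let ?U = "matched path_edges k" and ?r = "reg_bound (Suc n) k - 1" and ?W = "block a (Suc b) - {X b}"
  have bV: "X b \<in> V" "Y b \<in> V" and WV: "block a (Suc b) \<subseteq> V"
    using V by (auto simp: Suc b_def subset_iff)
  have W: "?W - {Y b} = block a b" by (rule block_minus_top) (simp add: b_def)
  have up: "upset (colon (X (Suc b)) ?U)" by (intro upset_colon upset_matched)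
  \<comment> \<open>If \<open>X b\<close> is inverted too, its edge to \<open>X (Suc b)\<close> is a
    leaf edge and k drops; if it is deleted, \<open>X (Suc b)\<close> is isolated. In both cases
    \<open>Y b\<close> is isolated as well, and a whiskered path on n - 1 vertices remains.\<close>
  have "reg_le (block a (Suc b)) (colon (X (Suc b)) ?U) ?r"
  proof (rule reg_le_split[OF up bV(1) WV])
    have r: "reg_bound n' k' \<le> ?r - 1" using Suc k' unfolding reg_bound_def by linarith
    have "reg_le ?W (matched path_edges k') (?r - 1)"
    proof (rule reg_le_isolated[OF upset_matched bV(2)])
      show "reg_le (?W - {Y b}) (matched path_edges k') (?r - 1)"
        unfolding W using reg_le_mono[OF IH[OF Suc] r] by (simp add: b_def)
    qed (rule matched_isolated_Y, auto)
    moreover have "T \<in> colon (X b) (colon (X (Suc b)) ?U) \<longleftrightarrow> T \<in> matched path_edges k'"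
      if "T \<subseteq> ?W" for T
    proof -
      have "insert (X (Suc b)) (insert (X b) T) = insert (X b) (insert (X (Suc b)) T)" by auto
      moreover have "X b \<notin> T" "X (Suc b) \<notin> T" "X (Suc (Suc b)) \<notin> T" "Y (Suc b) \<notin> T"
        using that by auto
      ultimately show ?thesis
        using matched_leaf_X[of b T k'] by (simp add: colon_def k')
    qed
    ultimately show "reg_le ?W (colon (X b) (colon (X (Suc b)) ?U)) (?r - 1)"
      by (rule reg_le_transfer) simp_all
  next
    have r: "reg_bound n' k \<le> ?r" using Suc unfolding reg_bound_def by linarith
    have "reg_le ?W ?U ?r"
    proof (rule reg_le_isolated[OF upset_matched bV(2)])
      show "reg_le (?W - {Y b}) ?U ?r"
        unfolding W using reg_le_mono[OF IH[OF Suc] r] by (simp add: b_def)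
    qed (rule matched_isolated_Y, auto)
    moreover have "T \<in> colon (X (Suc b)) ?U \<longleftrightarrow> T \<in> ?U" if "T \<subseteq> ?W" for T
      unfolding colon_def mem_Collect_eq by (rule matched_isolated_X) (use that in auto)
    ultimately show "reg_le ?W (colon (X (Suc b)) ?U) ?r"
      by (rule reg_le_transfer) simp_all
  qed
  then show ?thesis by (simp add: b_def Suc)
qed

text \<open>The top vertex and its whisker are split off. With both inverted, the leaf edge lowers n
  and k together; with only the path vertex inverted, \<open>reg_le_colon_path\<close> applies; with
  the path vertex deleted, the whisker is isolated and a shorter path remains.\<close>

lemma reg_le_path:
  assumes "block a (a + n) \<subseteq> V"
  shows "reg_le (block a (a + n)) (matched path_edges k) (reg_bound n k)"
  using assms
proof (induction n arbitrary: k rule: less_induct)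
  case (less n)
  show ?case
  proof (cases n)
    case 0
    then show ?thesis by (simp add: block_def reg_le_empty reg_bound_nonneg)
  next
    case (Suc n')
    show ?thesis
    proof (cases k)
      case 0
      then show ?thesis
        using less.prems by (intro reg_le_all_faces) (auto simp: matched_0 reg_bound_nonneg)
    next
      case k': (Suc k')
      define b where "b = a + n'"
      let ?U = "matched path_edges k" and ?r = "reg_bound n k" and ?W = "block a (Suc b) - {X b}"
      have bV: "X b \<in> V" "Y b \<in> V" and WV: "block a (Suc b) \<subseteq> V" "?W \<subseteq> V" "block a b \<subseteq> V"
        using less.prems by (auto simp: Suc b_def subset_iff block_def)
      have W: "?W - {Y b} = block a b" by (rule block_minus_top) (simp add: b_def)
      have IH: "reg_le (block a b) (matched path_edges j) (reg_bound n' j)" for j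
        using less.IH[of n' j] Suc WV by (simp add: b_def)
      have "reg_le (block a (Suc b)) ?U ?r"
      proof (rule reg_le_split[OF upset_matched bV(1) WV(1)])
        show "reg_le ?W (colon (X b) ?U) (?r - 1)"
        proof (rule reg_le_split[OF upset_colon[OF upset_matched] bV(2) WV(2)], unfold W)
          have r: "reg_bound n' k' \<le> ?r - 1 - 1" using Suc k' unfolding reg_bound_def by linarith
          have iff: "T \<in> colon (Y b) (colon (X b) ?U) \<longleftrightarrow> T \<in> matched path_edges k'"
            if "T \<subseteq> block a b" for T
          proof -
            have "X b \<notin> T" "Y b \<notin> T" using that by auto
            then show ?thesis using matched_leaf_Y(1)[of b T k'] by (simp add: colon_def k')
          qed
          show "reg_le (block a b) (colon (Y b) (colon (X b) ?U)) (?r - 1 - 1)"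
            by (rule reg_le_transfer[OF IH iff r])
          have "reg_le (block a (a + n')) (colon (X (a + n')) ?U) (reg_bound (Suc n') k - 1)"
          proof (rule reg_le_colon_path)
            fix n'' j assume "n' = Suc n''"
            then show "reg_le (block a (a + n'')) (matched path_edges j) (reg_bound n'' j)"
              using Suc WV(3) block_mono[of a a "a + n''" b]
              by (intro less.IH) (auto simp: b_def)
          qed (use WV(3) k' in \<open>auto simp: b_def\<close>)
          then show "reg_le (block a b) (colon (X b) ?U) (?r - 1)"
            by (simp add: b_def Suc)
        qed
        have r: "reg_bound n' k \<le> ?r" using Suc unfolding reg_bound_def by linarith
        show "reg_le ?W ?U ?r"
        proof (rule reg_le_isolated[OF upset_matched bV(2)])
          show "reg_le (?W - {Y b}) ?U ?r" unfolding W by (rule reg_le_mono[OF IH r])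
        qed (rule matched_isolated_Y, auto)
      qed
      then show ?thesis by (simp add: b_def Suc)
    qed
  qed
qed

text \<open>Contraction moves both ends of the interval, so its start \<open>a\<close> varies in the
  induction. With at most two path vertices the cycle is a whiskered path by
  \<open>cycle_edges_degenerate\<close>.\<close>

lemma reg_le_cycle:
  assumes "block a (a + n) \<subseteq> V"
  shows "reg_le (block a (a + n)) (matched (cycle_edges a (a + n)) k) (reg_bound n k)"
  using assms
proof (induction n arbitrary: a k rule: less_induct)
  case (less n)
  consider "n \<le> 2" | "k = 0" | p k' where "n = Suc (Suc (Suc p))" "k = Suc k'"
  proof -
    assume *: "n \<le> 2 \<Longrightarrow> thesis" "k = 0 \<Longrightarrow> thesis"
      "\<And>p k'. n = Suc (Suc (Suc p)) \<Longrightarrow> k = Suc k' \<Longrightarrow> thesis"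
    show thesis
    proof (cases "n \<le> 2 \<or> k = 0")
      case False
      then have "n = Suc (Suc (Suc (n - 3)))" "k = Suc (k - 1)" by auto
      then show thesis by (rule *(3))
    qed (use * in auto)
  qed
  then show ?case
  proof cases
    case 1
    then show ?thesis using reg_le_path[OF less.prems] by (simp add: cycle_edges_degenerate)
  next
    case 2
    then show ?thesis
      using less.prems by (intro reg_le_all_faces) (auto simp: matched_0 reg_bound_nonneg)
  next
    case 3
    define t where "t = a + p + 2"
    have an: "a + n = Suc t" using 3 by (simp add: t_def)
    let ?E = "cycle_edges a (Suc t)"
    let ?U = "matched ?E k" and ?r = "reg_bound n k"
    let ?L = "colon (X t) ?U" and ?B = "block (Suc a) t"
    have BV: "block a (Suc t) \<subseteq> V" using less.prems by (simp add: an)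
    then have tV: "X t \<in> V" "Y t \<in> V" "X a \<in> V" "Y a \<in> V"
      by (auto simp: subset_iff t_def)
    have BV': "block a (Suc t) - {X t} \<subseteq> V" "block a t \<subseteq> V" "block a t - {X a} \<subseteq> V" "?B \<subseteq> V"
      using BV by (auto simp: subset_iff block_def)
    have W: "block a (Suc t) - {X t} - {Y t} = block a t" by (rule block_minus_top) (simp add: t_def)
    have W': "block a t - {X a} - {Y a} = ?B" by (rule block_minus_bot)
    have path: "reg_le (block a t) (matched path_edges j) (reg_bound (p + 2) j)" for j
      using reg_le_path[of a "p + 2" j] BV'(2) by (simp add: t_def add.assoc)
    \<comment> \<open>The block \<open>?B\<close> lies directly below \<open>X t\<close>, so
      \<open>reg_le_colon_path\<close> applies to it with p + 1 path vertices.\<close>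
    have cpath: "reg_le ?B (colon (X t) (matched path_edges j)) (reg_bound (p + 2) j - 1)"
      if "1 \<le> j" for j
    proof -
      have t': "t = Suc a + (p + 1)" by (simp add: t_def)
      have "reg_le (block (Suc a) (Suc a + (p + 1))) (colon (X (Suc a + (p + 1))) (matched path_edges j))
          (reg_bound (Suc (p + 1)) j - 1)"
      proof (rule reg_le_colon_path[OF _ that])
        show "block (Suc a) (Suc a + (p + 1)) \<subseteq> V" using BV'(4) by (simp add: t')
        fix n' i assume n': "p + 1 = Suc n'"
        have "block (Suc a) (Suc a + n') \<subseteq> ?B" by (rule block_mono) (use n' in \<open>auto simp: t_def\<close>)
        then show "reg_le (block (Suc a) (Suc a + n')) (matched path_edges i) (reg_bound n' i)"
          by (intro reg_le_path) (use BV'(4) in blast)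
      qed
      then show ?thesis by (simp add: t')
    qed
    have upL: "upset ?L" by (intro upset_colon upset_matched)
    have top: "reg_le (block a (Suc t) - {X t}) ?U ?r"
    proof (rule reg_le_isolated[OF upset_matched tV(2)], unfold W)
      show "insert (Y t) T \<in> ?U \<longleftrightarrow> T \<in> ?U" if "T \<subseteq> block a (Suc t) - {X t}" for T
        by (rule matched_isolated_Y(2)) (use that in auto)
      have r: "reg_bound (p + 2) k \<le> ?r" using 3 unfolding reg_bound_def by linarith
      have iff: "T \<in> ?U \<longleftrightarrow> T \<in> matched path_edges k" if "T \<subseteq> block a t" for T
        by (rule matched_cycle_path) (use that in auto)
      show "reg_le (block a t) ?U ?r" by (rule reg_le_transfer[OF path iff r])
    qed
    \<comment> \<open>\<open>X t\<close> and \<open>Y t\<close> inverted: the leaf edge is consumed,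
      and the closing edge disappears along with \<open>X t\<close>.\<close>
    have mid: "reg_le (block a t) (colon (Y t) ?L) (?r - 1 - 1)"
    proof -
      have r: "reg_bound (p + 2) k' \<le> ?r - 1 - 1" using 3 unfolding reg_bound_def by linarith
      have iff: "T \<in> colon (Y t) ?L \<longleftrightarrow> T \<in> matched path_edges k'" if "T \<subseteq> block a t" for T
      proof -
        have "X t \<notin> T" "Y t \<notin> T" using that by auto
        then show ?thesis
          using matched_leaf_Y(2)[of t T a "Suc t" k'] matched_cycle_path[of a T "Suc t" k'] 3
          by (simp add: colon_def)
      qed
      show ?thesis by (rule reg_le_transfer[OF path iff r])
    qed
    have notin: "X t \<notin> T" "Y t \<notin> T" "X a \<notin> T" "Y a \<notin> T" if "T \<subseteq> ?B" for T
      using that by auto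
    \<comment> \<open>\<open>X t\<close>, \<open>X a\<close> and \<open>Y a\<close> inverted:
      consuming the leaf edge at \<open>X a\<close> also removes the closing edge, and
      \<open>X t\<close> stays inverted above a path.\<close>
    have bot1: "reg_le ?B (colon (Y a) (colon (X a) ?L)) (?r - 1 - 1 - 1)"
    proof -
      have iff: "T \<in> colon (Y a) (colon (X a) ?L) \<longleftrightarrow> T \<in> colon (X t) (matched path_edges k')"
        if "T \<subseteq> ?B" for T
      proof -
        have ne: "X a \<noteq> X t" by (simp add: t_def)
        have "insert (X t) (insert (X a) (insert (Y a) T)) = insert (X a) (insert (Y a) (insert (X t) T))"
          by auto
        then show ?thesis
          using notin[OF that] ne matched_leaf_Y(2)[of a "insert (X t) T" a "Suc t" k']
            matched_cycle_path[of a "insert (X t) T" "Suc t" k'] 3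
          by (simp add: colon_def)
      qed
      \<comment> \<open>\<open>cpath\<close> requires a positive exponent. For k' = 0 the ideal is
        the unit ideal, and the bound is nonnegative since there are at least three path
        vertices.\<close>
      have "reg_le ?B (colon (X t) (matched path_edges k')) (?r - 1 - 1 - 1)"
      proof (cases k')
        case 0
        have "0 \<le> ?r - 1 - 1 - 1" using 3 0 unfolding reg_bound_def by linarith
        then show ?thesis
          using BV'(4) 0 by (intro reg_le_all_faces) (auto simp: matched_0 colon_def)
      next
        case (Suc j)
        have r: "reg_bound (p + 2) k' - 1 \<le> ?r - 1 - 1 - 1" using 3 unfolding reg_bound_def by linarith
        show ?thesis using reg_le_mono[OF cpath r] Suc by simp
      qed
      then show ?thesis by (rule reg_le_transfer[OF _ iff order_refl])
    qed
    \<comment> \<open>The contraction branch: \<open>X t\<close> and \<open>X a\<close> inverted,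
      both whiskers deleted. Passing from n, k to n - 2, k - 1 lowers the bound by two or three,
      which pays for the two inversions.\<close>
    have bot2: "reg_le ?B (colon (X a) ?L) (?r - 1 - 1)"
    proof -
      have r: "reg_bound (p + 1) k' \<le> ?r - 1 - 1" using 3 unfolding reg_bound_def by linarith
      have t': "Suc a + (p + 1) = t" by (simp add: t_def)
      have iff: "T \<in> colon (X a) ?L \<longleftrightarrow> T \<in> matched (cycle_edges (Suc a) t) k'" if "T \<subseteq> ?B" for T
        using matched_contract[OF t_def that, of k'] 3 by (simp add: colon_def)
      have "reg_le ?B (matched (cycle_edges (Suc a) t) k') (reg_bound (p + 1) k')"
        using less.IH[of "p + 1" "Suc a" k'] 3 BV'(4) unfolding t' by simp
      then show ?thesis by (rule reg_le_transfer[OF _ iff r])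
    qed
    \<comment> \<open>\<open>X t\<close> inverted, \<open>X a\<close> deleted: the cycle is open,
      \<open>Y a\<close> is isolated, and \<open>X t\<close> is inverted above a path.\<close>
    have bot3: "reg_le (block a t - {X a}) ?L (?r - 1)"
    proof (rule reg_le_isolated[OF upL tV(4)], unfold W')
      show "insert (Y a) T \<in> ?L \<longleftrightarrow> T \<in> ?L" if "T \<subseteq> block a t - {X a}" for T
      proof -
        have "insert (X t) (insert (Y a) T) = insert (Y a) (insert (X t) T)" by auto
        moreover have "X a \<notin> insert (X t) T" using that by (auto simp: t_def)
        ultimately show ?thesis
          using matched_isolated_Y(2)[of a "insert (X t) T" a "Suc t" k] by (simp add: colon_def)
      qed
      have iff: "T \<in> ?L \<longleftrightarrow> T \<in> colon (X t) (matched path_edges k)" if "T \<subseteq> ?B" for T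
        unfolding colon_def mem_Collect_eq
        by (rule matched_cycle_path) (use notin[OF that] in \<open>auto simp: t_def\<close>)
      have r: "reg_bound (p + 2) k - 1 \<le> ?r - 1" using 3 unfolding reg_bound_def by linarith
      have k1: "1 \<le> k" using 3 by simp
      show "reg_le ?B ?L (?r - 1)" by (rule reg_le_transfer[OF cpath[OF k1] iff r])
    qed
    have "reg_le (block a t - {X a}) (colon (X a) ?L) (?r - 1 - 1)"
      by (rule reg_le_split[OF upset_colon[OF upL] tV(4) BV'(3)], unfold W', fact bot1, fact bot2)
    from reg_le_split[OF upL tV(3) BV'(2) this bot3]
    have low: "reg_le (block a t) ?L (?r - 1)" .
    have "reg_le (block a (Suc t) - {X t}) ?L (?r - 1)"
      by (rule reg_le_split[OF upL tV(2) BV'(1)], unfold W, fact mid, fact low)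
    from reg_le_split[OF upset_matched tV(1) BV this top]
    have "reg_le (block a (Suc t)) ?U ?r" .
    then show ?thesis by (simp add: an)
  qed
qed

section \<open>Lower bound: multidegrees that carry homology\<close>

fun witness :: "nat \<Rightarrow> nat \<Rightarrow> whisker_vertex set" where
  "witness k 0 = block 1 (Suc k)"
| "witness k (Suc q) = insert (X (k + 2 * Suc q)) (insert (Y (k + 2 * Suc q)) (witness k q))"

lemma witness_block: "witness k q \<subseteq> block 1 (Suc (k + 2 * q))"
proof (induction q)
  case (Suc q)
  moreover have "block 1 (Suc (k + 2 * q)) \<subseteq> block 1 (Suc (k + 2 * Suc q))"
    by (rule block_mono) auto
  ultimately show ?case by auto
qed simp

lemma card_witness: "card (witness k q) = 2 * k + 2 * q"
proof (induction q)
  case (Suc q)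
  have "finite (witness k q)" by (rule finite_subset[OF witness_block finite_block])
  moreover have "X (k + 2 * Suc q) \<notin> witness k q" "Y (k + 2 * Suc q) \<notin> witness k q"
    using witness_block[of k q] by auto
  ultimately show ?case using Suc by simp
qed (simp add: card_block)

lemma block_matched: "block 1 (Suc k) \<in> matched path_edges k"
proof -
  let ?M = "(\<lambda>i. {X i, Y i}) ` {1..<Suc k}"
  have "card ?M = k" by (subst card_image) (auto simp: inj_on_def doubleton_eq_iff)
  moreover have "pairwise disjnt ?M" by (auto simp: pairwise_def disjnt_def)
  moreover have "\<Union>?M \<subseteq> block 1 (Suc k)" by auto
  moreover have "?M \<subseteq> path_edges" by auto
  ultimately show ?thesis unfolding matched_def by blast
qed

lemma not_acyclic_block:
  assumes "path_edges \<subseteq> E" "\<And>e. e \<in> E \<Longrightarrow> card e = 2"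
  shows "\<not> acyclic_at (matched E k) (block 1 (Suc k)) 0"
proof (rule not_acyclic_minimal)
  show "block 1 (Suc k) \<in> matched E k"
    using block_matched[of k] assms(1) by (auto simp: matched_def)
  fix T assume T: "T \<subset> block 1 (Suc k)"
  then have "finite T" using finite_block finite_subset by blast
  moreover have "card T < 2 * k" using psubset_card_mono[OF finite_block T] by (simp add: card_block)
  ultimately show "T \<notin> matched E k" using matched_card[OF assms(2), where S = T and k = k] by auto
qed

text \<open>The whiskers of \<open>witness\<close> sit two places apart, so the only neighbour of
  \<open>X c\<close> is \<open>Y c\<close>. Each adds two variables and one homological degree,
  which raises size minus degree by one.\<close>

lemma not_acyclic_witness:
  assumes k: "1 \<le> k" and V: "block 1 (Suc (k + 2 * q)) \<subseteq> V"
  shows "\<not> acyclic_at (matched path_edges k) (witness k q) q"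
  using V
proof (induction q)
  case 0
  then show ?case using not_acyclic_block[of path_edges k] card_path_edge by simp
next
  case (Suc q)
  define c where "c = k + 2 * Suc q"
  obtain k' where k': "k = Suc k'" using k by (cases k) auto
  let ?U = "matched path_edges k" and ?S = "witness k q"
  have BV: "block 1 (Suc (k + 2 * q)) \<subseteq> V"
    using Suc.prems block_mono[of 1 1 "Suc (k + 2 * q)" "Suc (k + 2 * Suc q)"] by auto
  have S: "?S \<subseteq> block 1 (Suc (k + 2 * q))" by (rule witness_block)
  have cV: "X c \<in> V" "Y c \<in> V" using Suc.prems by (auto simp: c_def subset_iff)
  have notin: "X c \<notin> ?S" "Y c \<notin> ?S" using S by (auto simp: c_def)
  have sub: "X c \<notin> T" "Y c \<notin> T" "X (Suc c) \<notin> T" "c = Suc j \<Longrightarrow> X j \<notin> T"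
    if "T \<subseteq> ?S" for T j
    using that S by (auto simp: c_def)
  \<comment> \<open>On k + 2q path vertices the bound for k - 1 is 2k - 2 + q, while size minus
    degree is 2k + q here; so the homology vanishes.\<close>
  have upper: "acyclic_at (colon (X c) (colon (Y c) ?U)) ?S q"
  proof -
    have iff: "T \<in> colon (X c) (colon (Y c) ?U) \<longleftrightarrow> T \<in> matched path_edges k'" if "T \<subseteq> ?S" for T
    proof -
      have "insert (Y c) (insert (X c) T) = insert (X c) (insert (Y c) T)" by auto
      then show ?thesis using matched_leaf_Y(1)[of c T k'] sub[OF that] by (simp add: colon_def k')
    qed
    have "acyclic_at (matched path_edges k') ?S q"
    proof (rule reg_leD)
      show "reg_le (block 1 (1 + (k + 2 * q))) (matched path_edges k') (reg_bound (k + 2 * q) k')"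
        by (rule reg_le_path) (use BV in simp)
      show "?S \<subseteq> block 1 (1 + (k + 2 * q))" using S by simp
      show "reg_bound (k + 2 * q) k' + int q < int (card ?S)"
        unfolding card_witness reg_bound_def k' by simp
    qed
    then show ?thesis using acyclic_cong[OF iff] by blast
  qed
  show ?case
  proof
    assume "acyclic_at ?U (witness k (Suc q)) (Suc q)"
    then have A: "acyclic_at ?U (insert (Y c) (insert (X c) ?S)) (Suc q)"
      by (simp add: c_def insert_commute)
    have Y: "insert (Y c) (insert (X c) ?S) - {Y c} = insert (X c) ?S" using notin by auto
    have X: "insert (X c) ?S - {X c} = ?S" using notin by auto
    \<comment> \<open>Without its whisker \<open>X c\<close> is isolated, and the multidegree
      carries no homology at all.\<close>
    have "acyclic_at ?U (insert (X c) ?S) (Suc q)"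
    proof (rule acyclic_isolated[OF upset_matched cV(1)])
      fix T assume T: "T \<subseteq> insert (X c) ?S"
      show "insert (X c) T \<in> ?U \<longleftrightarrow> T \<in> ?U"
      proof (rule matched_isolated_X)
        show "Y c \<notin> T" "X (Suc c) \<notin> T" using T sub[OF order_refl] by auto
        show "X j \<notin> T" if "c = Suc j" for j using T sub(4)[OF order_refl that] that by auto
      qed
    qed simp
    \<comment> \<open>Vanishing is pushed down in two exact sequences: first \<open>Y c\<close> is
      inverted, then \<open>X c\<close> is dropped, where \<open>upper\<close> supplies the third
      term.\<close>
    then have "acyclic_at (colon (Y c) ?U) (insert (X c) ?S) (Suc q)"
      using acyclic_colon[OF upset_matched cV(2) _ A] unfolding Y by simp
    then have "acyclic_at (colon (Y c) ?U) ?S q"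
      using acyclic_link[OF upset_colon[OF upset_matched] cV(1), of "insert (X c) ?S" "Y c" path_edges k q] upper
      unfolding X by simp
    \<comment> \<open>On \<open>?S\<close> the vertex \<open>Y c\<close> is isolated, so inverting
      it changes nothing, and the induction hypothesis is contradicted.\<close>
    moreover have iff: "T \<in> colon (Y c) ?U \<longleftrightarrow> T \<in> ?U" if "T \<subseteq> ?S" for T
      unfolding colon_def mem_Collect_eq by (rule matched_isolated_Y) (use sub[OF that] in auto)
    ultimately have "acyclic_at ?U ?S q" using acyclic_cong[OF iff] by blast
    then show False using Suc.IH BV by blast
  qed
qed

end

section \<open>From index intervals to the whiskered cycle\<close>

lemma whiskered_cycle_block: "vertices (whiskered_cycle m) = block 1 (Suc m)"
  by (auto simp: whiskered_cycle_def block_def)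

lemma whiskered_cycle_edges:
  assumes m: "3 \<le> m" and e: "e \<subseteq> block 1 (Suc m)"
  shows "e \<in> edges (whiskered_cycle m) \<longleftrightarrow> e \<in> cycle_edges 1 (Suc m)"
proof
  assume "e \<in> edges (whiskered_cycle m)"
  then show "e \<in> cycle_edges 1 (Suc m)"
    using m unfolding whiskered_cycle_def snd_conv cycle_edges_def path_edges_def by auto
next
  assume "e \<in> cycle_edges 1 (Suc m)"
  then show "e \<in> edges (whiskered_cycle m)"
  proof (cases rule: cycle_edgesE)
    case (1 i)
    then have "1 \<le> i \<and> i \<le> m - 1" using e by auto
    then show ?thesis using 1 unfolding whiskered_cycle_def by auto
  next
    case (2 i)
    then have "1 \<le> i \<and> i \<le> m" using e by auto
    then show ?thesis using 2 unfolding whiskered_cycle_def by auto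
  qed (simp add: whiskered_cycle_def)
qed

lemma whiskered_cycle_matched:
  assumes "3 \<le> m" "T \<subseteq> block 1 (Suc m)"
  shows "T \<in> matched (edges (whiskered_cycle m)) k \<longleftrightarrow> T \<in> matched (cycle_edges 1 (Suc m)) k"
  by (rule matched_cong) (use whiskered_cycle_edges[OF assms(1)] assms(2) in blast)

context whiskered
begin

lemma whiskered_cycle_reg_le:
  assumes m: "3 \<le> m" and V: "V = block 1 (Suc m)"
  shows "reg_le V (matched (edges (whiskered_cycle m)) k) (reg_bound m k)"
proof (rule reg_le_transfer)
  show "reg_le V (matched (cycle_edges 1 (Suc m)) k) (reg_bound m k)"
    using reg_le_cycle[of 1 m k] V by simp
qed (simp_all add: whiskered_cycle_matched[OF m] V)

text \<open>For k < m the witness stays below index m, where the cycle has only path edges. For k =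
  m the block of the first k whiskers is the full vertex set, closing edge included; it supports a
  minimal generator.\<close>

lemma whiskered_cycle_not_acyclic:
  assumes m: "3 \<le> m" and V: "V = block 1 (Suc m)" and k: "1 \<le> k" "k \<le> m"
  obtains S i where "S \<subseteq> V" "\<not> acyclic_at (matched (edges (whiskered_cycle m)) k) S i"
    "2 * int k + (int m - int k - 1) div 2 \<le> int (card S) - int i"
proof (cases "k = m")
  case True
  have "\<not> acyclic_at (matched (cycle_edges 1 (Suc m)) k) V 0"
    using not_acyclic_block[OF path_edges_subset_cycle card_cycle_edge] True V by simp
  then have "\<not> acyclic_at (matched (edges (whiskered_cycle m)) k) V 0"
    using acyclic_cong[of V, OF whiskered_cycle_matched[OF m]] V by blast
  moreover have "2 * int k + (int m - int k - 1) div 2 \<le> int (card V) - int 0"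
    using True by (simp add: V card_block)
  ultimately show ?thesis using that[of V 0] by blast
next
  case False
  \<comment> \<open>The largest q with k + 2q at most m - 1; it equals the floor in the lower
    bound.\<close>
  define q where "q = (m - 1 - k) div 2"
  have q: "k + 2 * q \<le> m - 1" using False k by (simp add: q_def)
  have B: "block 1 (Suc (k + 2 * q)) \<subseteq> block 1 m" by (rule block_mono) (use q m in auto)
  also have "\<dots> \<subseteq> V" unfolding V by (rule block_mono) auto
  finally have BV: "block 1 (Suc (k + 2 * q)) \<subseteq> V" .
  have S: "witness k q \<subseteq> block 1 m" using witness_block B by blast
  have iff: "T \<in> matched path_edges k \<longleftrightarrow> T \<in> matched (edges (whiskered_cycle m)) k"
    if "T \<subseteq> witness k q" for T
  proof -
    have T: "T \<subseteq> block 1 m" using that S by blast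
    then have "X m \<notin> T" by auto
    then have "T \<in> matched path_edges k \<longleftrightarrow> T \<in> matched (cycle_edges 1 (Suc m)) k"
      using matched_cycle_path[of 1 T "Suc m" k] by simp
    moreover have "T \<subseteq> block 1 (Suc m)" using T block_mono[of 1 1 m "Suc m"] by auto
    ultimately show ?thesis using whiskered_cycle_matched[OF m] by blast
  qed
  have "\<not> acyclic_at (matched (edges (whiskered_cycle m)) k) (witness k q) q"
    using not_acyclic_witness[OF k(1) BV] acyclic_cong[OF iff] by blast
  moreover have "2 * int k + (int m - int k - 1) div 2 \<le> int (card (witness k q)) - int q"
  proof -
    have "int q = (int m - int k - 1) div 2"
      using False k by (simp add: q_def zdiv_int of_nat_diff algebra_simps)
    then show ?thesis by (simp add: card_witness)
  qed
  ultimately show ?thesis using that[of "witness k q" q] witness_block BV by blast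
qed

end

section \<open>Graded modules over the polynomial ring\<close>

abbreviation lookup where "lookup \<equiv> Poly_Mapping.lookup"
abbreviation keys where "keys \<equiv> Poly_Mapping.keys"
abbreviation single where "single \<equiv> Poly_Mapping.single"

lemma mdeg_superset: "finite A \<Longrightarrow> keys e \<subseteq> A \<Longrightarrow> mdeg e = (\<Sum>x\<in>A. lookup e x)"
  unfolding mdeg_def by (rule sum.mono_neutral_left) (auto simp: in_keys_iff)

lemma mdeg_add: "mdeg (e + f) = mdeg e + mdeg f"
proof -
  have "keys (e + f) \<subseteq> keys e \<union> keys f" by (rule keys_add)
  then show ?thesis
    by (simp add: mdeg_superset[of "keys e \<union> keys f"] lookup_add sum.distrib)
qed

lemma mdeg_zero [simp]: "mdeg 0 = 0"
  by (simp add: mdeg_def)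

lemma mdeg_single [simp]: "mdeg (single x n) = n"
  by (cases "n = 0") (simp_all add: mdeg_def)

lemma mdeg_eq_0_iff: "mdeg e = 0 \<longleftrightarrow> e = 0"
  by (auto simp: mdeg_def in_keys_iff intro!: poly_mapping_eqI)

lemma keys_add_monomial: "keys (e + f) = keys e \<union> keys (f :: 'v monomial)"
  by (auto simp: in_keys_iff lookup_add)

lemma monomial_diff_add:
  fixes e f :: "'v monomial"
  assumes "\<And>x. lookup f x \<le> lookup e x"
  shows "f + (e - f) = e"
  using assms by (intro poly_mapping_eqI) (simp add: lookup_add lookup_minus)

lemma finite_monomials: "finite V \<Longrightarrow> finite {e. keys e \<subseteq> V \<and> mdeg e = d}"
proof -
  assume V: "finite V"
  have "lookup e ` V \<subseteq> {..d}" if "keys e \<subseteq> V" "mdeg e = d" for e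
    using that V by (auto simp: mdeg_superset[of V] intro!: member_le_sum)
  then have "lookup ` {e. keys e \<subseteq> V \<and> mdeg e = d} \<subseteq> {f. \<forall>x. (x \<in> V \<longrightarrow> f x \<in> {..d}) \<and> (x \<notin> V \<longrightarrow> f x = 0)}"
    by (auto simp: in_keys_iff subset_iff)
  moreover have "finite {f. \<forall>x. (x \<in> V \<longrightarrow> f x \<in> {..d}) \<and> (x \<notin> V \<longrightarrow> f x = 0)}"
    using V by (rule finite_set_of_finite_funs) simp
  ultimately have "finite (lookup ` {e. keys e \<subseteq> V \<and> mdeg e = d})"
    by (rule finite_subset)
  then show ?thesis
    by (rule finite_imageD) (simp add: inj_on_def Poly_Mapping.lookup_inject)
qed

lemma lookup_single_times:
  fixes p :: "('v, 'k::field) mpoly"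
  shows "lookup (single t c * p) e =
    (if \<exists>q. e = t + q then c * lookup p (e - t) else 0)"
proof -
  have "lookup (single t c * p) e =
      (\<Sum>l. ((c * (\<Sum>q. lookup p q when e = l + q)) when l = t))"
    unfolding lookup_mult by (intro Sum_any.cong) (auto simp: lookup_single when_def)
  also have "\<dots> = c * (\<Sum>q. lookup p q when e = t + q)"
    by simp
  also have "(\<Sum>q. lookup p q when e = t + q) = (if \<exists>q. e = t + q then lookup p (e - t) else 0)"
  proof (cases "\<exists>q. e = t + q")
    case True
    then obtain q where q: "e = t + q" by blast
    have "(\<lambda>q'. lookup p q' when e = t + q') = (\<lambda>q'. lookup p q' when q' = q)"
      by (auto simp: q when_def)
    then show ?thesis using True by (simp add: q)
  next
    case False
    then have "(\<lambda>q'. lookup p q' when e = t + q') = (\<lambda>q'. 0)" by (auto simp: when_def)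
    then show ?thesis using False by simp
  qed
  finally show ?thesis by auto
qed

lemma lookup_indet_times:
  fixes p :: "('v, 'k::field) mpoly"
  shows "lookup (indet x * p) e = (if x \<in> keys e then lookup p (e - single x 1) else 0)"
proof -
  have "(\<exists>q. e = single x 1 + q) \<longleftrightarrow> x \<in> keys e"
  proof
    assume "x \<in> keys e"
    then have "e = single x 1 + (e - single x 1)"
      by (intro monomial_diff_add[symmetric]) (auto simp: lookup_single when_def in_keys_iff)
    then show "\<exists>q. e = single x 1 + q" by blast
  qed (auto simp: in_keys_iff lookup_add)
  then show ?thesis by (simp add: indet_def lookup_single_times)
qed

text \<open>Degrees are integers because shifts lead below 0, where only the zero polynomial is
  homogeneous.\<close>

definition homogeneous :: "'v set \<Rightarrow> int \<Rightarrow> ('v, 'k::field) mpoly set" where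
  "homogeneous V t = {p. \<forall>e\<in>keys p. keys e \<subseteq> V \<and> int (mdeg e) = t}"

lemma homogeneous_0 [simp]: "0 \<in> homogeneous V t"
  by (simp add: homogeneous_def)

lemma homogeneous_add: "p \<in> homogeneous V t \<Longrightarrow> q \<in> homogeneous V t \<Longrightarrow> p + q \<in> homogeneous V t"
  using keys_add[of p q] by (fastforce simp: homogeneous_def)

lemma homogeneous_minus: "p \<in> homogeneous V t \<Longrightarrow> - p \<in> homogeneous V t"
  by (simp add: homogeneous_def)

lemma homogeneous_diff: "p \<in> homogeneous V t \<Longrightarrow> q \<in> homogeneous V t \<Longrightarrow> p - q \<in> homogeneous V t"
  using homogeneous_add[OF _ homogeneous_minus, of p V t q] by simp

lemma homogeneous_sum: "(\<And>a. a \<in> A \<Longrightarrow> f a \<in> homogeneous V t) \<Longrightarrow> sum f A \<in> homogeneous V t"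
  by (induction A rule: infinite_finite_induct) (simp_all add: homogeneous_add)

lemma homogeneous_mult:
  "p \<in> homogeneous V t \<Longrightarrow> q \<in> homogeneous V u \<Longrightarrow> p * q \<in> homogeneous V (t + u)"
  using keys_mult[of p q] by (fastforce simp: homogeneous_def mdeg_add keys_add_monomial)

lemma homogeneous_indet: "x \<in> V \<Longrightarrow> indet x \<in> homogeneous V 1"
  by (simp add: homogeneous_def indet_def)

text \<open>Elements of free modules are functions that vanish beyond the rank. Unlike vectors that
  carry a length, these form an abelian group type, as \<open>koszul\<close> requires.\<close>

definition vmul :: "'v \<Rightarrow> (nat \<Rightarrow> ('v, 'k::field) mpoly) \<Rightarrow> nat \<Rightarrow> ('v, 'k) mpoly" where
  "vmul x f = (\<lambda>a. indet x * f a)"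

text \<open>The degree \<open>j\<close> part of the sum of the \<open>J(- s ! a)\<close>, where \<open>J\<close> is the ideal spanned by the monomials with support in \<open>U\<close>;
  the free module is the case \<open>U = UNIV\<close>.\<close>

definition gpart :: "'v set \<Rightarrow> 'v set set \<Rightarrow> nat list \<Rightarrow> int \<Rightarrow> (nat \<Rightarrow> ('v, 'k::field) mpoly) set" where
  "gpart V U s j = {f. (\<forall>a<length s. f a \<in> homogeneous V (j - int (s ! a)) \<and> (\<forall>e\<in>keys (f a). keys e \<in> U)) \<and>
     (\<forall>a\<ge>length s. f a = 0)}"

definition sqf :: "'v set \<Rightarrow> 'v monomial" where
  "sqf F = (\<Sum>x\<in>F. single x 1)"

lemma lookup_sqf: "finite F \<Longrightarrow> lookup (sqf F) x = (if x \<in> F then 1 else 0)"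
  by (simp add: sqf_def lookup_sum lookup_single when_def)

lemma keys_sqf: "finite F \<Longrightarrow> keys (sqf F) = F"
  by (auto simp: in_keys_iff lookup_sqf split: if_splits)

lemma mdeg_sqf: "finite F \<Longrightarrow> mdeg (sqf F) = card F"
  by (simp add: mdeg_def keys_sqf lookup_sqf)

lemma sqf_diff_add:
  assumes "F \<subseteq> keys e" shows "e - sqf F + sqf F = e"
proof -
  have "finite F" by (rule finite_subset[OF assms finite_keys])
  then have "lookup (sqf F) x \<le> lookup e x" for x
    using assms by (auto simp: lookup_sqf in_keys_iff subset_iff)
  then show ?thesis using monomial_diff_add[of "sqf F" e] by (simp add: add.commute)
qed

lemma lookup_signed: "lookup (signed s p) e = signed s (lookup p e)"
  by (simp add: signed_def)

lemma signed_fun_apply: "signed s f a = signed s (f a :: 'm::ab_group_add)"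
  by (simp add: signed_def)

lemma sum_fun_at: "(sum f A) a = (\<Sum>x\<in>A. f x (a :: 'a) :: 'm::comm_monoid_add)"
  by (induction A rule: infinite_finite_induct) simp_all

context squarefree_koszul
begin

sublocale md: koszul V "vmul :: 'v \<Rightarrow> (nat \<Rightarrow> ('v, 'k) mpoly) \<Rightarrow> _"
  by unfold_locales (auto simp: fin vmul_def plus_fun_def distrib_left mult.left_commute)

text \<open>The strand of the Koszul complex of \<open>M\<close> in internal degree
  \<open>j\<close>: the exterior basis element of \<open>F\<close> itself has degree
  \<open>card F\<close>.\<close>

definition graded :: "(int \<Rightarrow> (nat \<Rightarrow> ('v, 'k) mpoly) set) \<Rightarrow> int \<Rightarrow> 'v set \<Rightarrow> (nat \<Rightarrow> ('v, 'k) mpoly) set" where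
  "graded M j F = M (j - int (card F))"

definition graded_module :: "(int \<Rightarrow> (nat \<Rightarrow> ('v, 'k) mpoly) set) \<Rightarrow> bool" where
  "graded_module M \<longleftrightarrow> (\<forall>j. 0 \<in> M j \<and> (\<forall>f\<in>M j. - f \<in> M j \<and> (\<forall>g\<in>M j. f + g \<in> M j) \<and>
     (\<forall>x\<in>V. vmul x f \<in> M (j + 1))))"

lemma coeffs_graded:
  assumes "graded_module M"
  shows "md.coeffs (graded M j)"
  unfolding md.coeffs_def graded_def
proof (intro conjI allI impI ballI)
  fix F x m assume F: "F \<subseteq> V" "x \<in> V - F" and m: "m \<in> M (j - int (card (insert x F)))"
  have "finite F" using F(1) sq.finite_subset_V by simp
  then have e: "j - int (card (insert x F)) + 1 = j - int (card F)" using F by simp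
  have "vmul x m \<in> M (j - int (card (insert x F)) + 1)"
    using assms m F by (simp add: graded_module_def)
  then show "vmul x m \<in> M (j - int (card F))" by (simp only: e)
qed (use assms in \<open>simp_all add: graded_module_def\<close>)

lemma gpart_module:
  assumes U: "upset U" shows "graded_module (gpart V U s)"
proof -
  have "vmul x f \<in> gpart V U s (j + 1)" if f: "f \<in> gpart V U s j" and x: "x \<in> V" for x f j
  proof -
    have "keys e \<in> U" if e: "e \<in> keys (indet x * f a)" and a: "a < length s" for a e
    proof -
      obtain e' where e': "e' \<in> keys (f a)" "e = single x 1 + e'"
        using e keys_mult[of "indet x" "f a"] by (auto simp: indet_def)
      then have "keys e' \<in> U" using f a by (simp add: gpart_def)
      then show ?thesis by (rule upsetD[OF U]) (auto simp: e'(2) keys_add_monomial)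
    qed
    moreover have "indet x * f a \<in> homogeneous V (j + 1 - int (s ! a))" if "a < length s" for a
      using homogeneous_mult[OF homogeneous_indet[OF x], of "f a" "j - int (s ! a)"] f that
      by (simp add: gpart_def algebra_simps)
    ultimately show ?thesis using f by (simp add: gpart_def vmul_def)
  qed
  moreover have "0 \<in> gpart V U s j" "f \<in> gpart V U s j \<Longrightarrow> - f \<in> gpart V U s j" for f j
    by (simp_all add: gpart_def homogeneous_minus)
  moreover have "f + g \<in> gpart V U s j" if f: "f \<in> gpart V U s j" and g: "g \<in> gpart V U s j" for f g j
  proof -
    have "keys e \<in> U" if "a < length s" "e \<in> keys (f a + g a)" for a e
      using f g that keys_add[of "f a" "g a"] unfolding gpart_def by blast
    then show ?thesis using f g by (simp add: gpart_def homogeneous_add)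
  qed
  ultimately show ?thesis
    unfolding graded_module_def by blast
qed

section \<open>Decomposition of Koszul strands into multidegrees\<close>

definition component :: "nat \<Rightarrow> 'v monomial \<Rightarrow> ('v set \<Rightarrow> nat \<Rightarrow> ('v, 'k) mpoly) \<Rightarrow> 'v set \<Rightarrow> 'k" where
  "component a \<alpha> c F = (if F \<subseteq> keys \<alpha> then lookup (c F a) (\<alpha> - sqf F) else 0)"

text \<open>The upper Koszul complex in an arbitrary multidegree, square-free or not.\<close>

definition mfaces :: "'v set set \<Rightarrow> 'v monomial \<Rightarrow> 'v set \<Rightarrow> 'k set" where
  "mfaces U \<alpha> F = (if F \<subseteq> keys \<alpha> \<and> keys (\<alpha> - sqf F) \<in> U then UNIV else {0})"

lemma mem_mfaces: "m \<in> mfaces U \<alpha> F \<longleftrightarrow> m = 0 \<or> F \<subseteq> keys \<alpha> \<and> keys (\<alpha> - sqf F) \<in> U"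
  by (auto simp: mfaces_def)

lemma diff_sqf_insert:
  assumes "finite F" "x \<notin> F"
  shows "\<alpha> - sqf (insert x F) = \<alpha> - sqf F - single x 1"
  using assms by (auto simp: lookup_minus lookup_sqf lookup_single when_def intro!: poly_mapping_eqI)

lemma coeffs_mfaces:
  assumes "upset U" shows "sq.coeffs (mfaces U \<alpha>)"
proof -
  have "m \<in> mfaces U \<alpha> F" if "m \<in> mfaces U \<alpha> (insert x F)" "F \<subseteq> V" "x \<in> V - F" for m x F
  proof -
    have "finite F" using that(2) sq.finite_subset_V by simp
    then have "keys (\<alpha> - sqf (insert x F)) \<subseteq> keys (\<alpha> - sqf F)"
      using that(3) by (auto simp: in_keys_iff lookup_minus lookup_sqf)
    then have "keys (\<alpha> - sqf (insert x F)) \<in> U \<Longrightarrow> keys (\<alpha> - sqf F) \<in> U"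
      using upsetD[OF assms] by blast
    then show ?thesis using that unfolding mem_mfaces by blast
  qed
  moreover have "0 \<in> mfaces U \<alpha> F" "m \<in> mfaces U \<alpha> F \<Longrightarrow> - m \<in> mfaces U \<alpha> F"
    "m \<in> mfaces U \<alpha> F \<Longrightarrow> n \<in> mfaces U \<alpha> F \<Longrightarrow> m + n \<in> mfaces U \<alpha> F" for m n F
    by (auto simp: mem_mfaces)
  ultimately show ?thesis unfolding sq.coeffs_def by blast
qed

lemma kd_component: "sq.kd (component a \<alpha> c) F = component a \<alpha> (md.kd c) F"
proof (cases "F \<subseteq> V \<and> F \<subseteq> keys \<alpha>")
  case True
  then have F: "finite F" "F \<subseteq> V" "F \<subseteq> keys \<alpha>" using finite_subset[OF _ fin] by auto
  have "component a \<alpha> (md.kd c) F =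
      (\<Sum>x\<in>V - F. signed (kpar x F) (lookup (indet x * c (insert x F) a) (\<alpha> - sqf F)))"
    using F by (simp add: component_def md.kd_def sum_fun_at lookup_sum signed_fun_apply lookup_signed vmul_def)
  also have "\<dots> = (\<Sum>x\<in>V - F. signed (kpar x F) (component a \<alpha> c (insert x F)))"
  proof (intro sum.cong refl)
    fix x assume x: "x \<in> V - F"
    then have "x \<in> keys (\<alpha> - sqf F) \<longleftrightarrow> insert x F \<subseteq> keys \<alpha>"
      using F by (auto simp: in_keys_iff lookup_minus lookup_sqf)
    then show "signed (kpar x F) (lookup (indet x * c (insert x F) a) (\<alpha> - sqf F)) =
        signed (kpar x F) (component a \<alpha> c (insert x F))"
      using x F by (simp add: component_def lookup_indet_times diff_sqf_insert)
  qed
  finally show ?thesis using F by (simp add: sq.kd_def)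
next
  case False
  then show ?thesis by (auto simp: component_def sq.kd_def md.kd_def intro!: sum.neutral)
qed

lemma poly_component:
  assumes "finite F"
  shows "lookup (c F a) \<beta> = component a (\<beta> + sqf F) c F"
proof -
  have "\<beta> + sqf F - sqf F = \<beta>" by simp
  moreover have "F \<subseteq> keys (\<beta> + sqf F)" using assms by (auto simp: keys_add_monomial keys_sqf)
  ultimately show ?thesis by (simp add: component_def)
qed

text \<open>The strand is the direct sum of the complexes \<open>mfaces U \<alpha>\<close>, one for
  each summand \<open>a\<close> and each multidegree \<alpha> of the complementary total degree;
  \<open>component\<close> is the projection.\<close>

lemma vanishes_gpart:
  assumes U: "upset U"
  shows "md.vanishes (graded (gpart V U s) j) i \<longleftrightarrow>
    (\<forall>a<length s. \<forall>\<alpha>. keys \<alpha> \<subseteq> V \<longrightarrow> int (mdeg \<alpha>) + int (s ! a) = j \<longrightarrow> sq.vanishes (mfaces U \<alpha>) i)"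
    (is "?L \<longleftrightarrow> (\<forall>a<length s. \<forall>\<alpha>. ?P a \<alpha> \<longrightarrow> _ a \<alpha> \<longrightarrow> _)")
proof
  let ?N = "graded (gpart V U s) j"
  note cN = coeffs_graded[OF gpart_module[OF U]]
  have mdeg_diff: "mdeg (\<alpha> - sqf F) + card F = mdeg \<alpha>" if "F \<subseteq> keys \<alpha>" for \<alpha> :: "'v monomial" and F
    using mdeg_add[of "\<alpha> - sqf F" "sqf F"] sqf_diff_add[OF that] mdeg_sqf[OF finite_subset[OF that]]
    by simp
  have comp_chain: "sq.chain (mfaces U \<alpha>) n (component a \<alpha> c)"
    if c: "md.chain ?N n c" and a: "a < length s" for c a \<alpha> n
  proof (rule sq.chainI)
    fix F
    have nz: "F \<subseteq> keys \<alpha>" "\<alpha> - sqf F \<in> keys (c F a)" "c F \<noteq> 0" if "component a \<alpha> c F \<noteq> 0"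
      using that by (auto simp: component_def in_keys_iff split: if_splits)
    show "component a \<alpha> c F \<in> mfaces U \<alpha> F"
      unfolding mem_mfaces using nz md.chainD(1)[OF c, of F] a
      by (auto simp: graded_def gpart_def)
    show "F \<subseteq> V \<and> card F = n" if "component a \<alpha> c F \<noteq> 0"
      using nz(3)[OF that] md.chainD(2,3)[OF c] by blast
  qed
  {
    assume L: ?L
    show "\<forall>a<length s. \<forall>\<alpha>. keys \<alpha> \<subseteq> V \<longrightarrow> int (mdeg \<alpha>) + int (s ! a) = j \<longrightarrow> sq.vanishes (mfaces U \<alpha>) i"
    proof (intro allI impI)
      fix a \<alpha> assume a: "a < length s" and \<alpha>: "keys \<alpha> \<subseteq> V" "int (mdeg \<alpha>) + int (s ! a) = j"
      show "sq.vanishes (mfaces U \<alpha>) i"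
        unfolding sq.vanishes_def
      proof (intro allI impI)
        fix c0 assume c0: "sq.chain (mfaces U \<alpha>) i c0" "\<forall>F. sq.kd c0 F = 0"
        \<comment> \<open>The chain of the strand whose only nonzero component is
          \<open>c0\<close>.\<close>
        define c where "c F a' = (if a' = a \<and> F \<subseteq> keys \<alpha> then single (\<alpha> - sqf F) (c0 F) else 0)"
          for F a'
        have comp: "component a' \<alpha>' c = (if a' = a \<and> \<alpha>' = \<alpha> then c0 else (\<lambda>F. 0))" for a' \<alpha>'
        proof
          fix F
          have out: "c0 F = 0" if "\<not> F \<subseteq> keys \<alpha>"
            using sq.chainD(1)[OF c0(1), of F] that by (simp add: mem_mfaces)
          have inj: "\<alpha>' = \<alpha>" if "F \<subseteq> keys \<alpha>" "F \<subseteq> keys \<alpha>'" "\<alpha> - sqf F = \<alpha>' - sqf F"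
            using sqf_diff_add[OF that(1)] sqf_diff_add[OF that(2)] that(3) by metis
          show "component a' \<alpha>' c F = (if a' = a \<and> \<alpha>' = \<alpha> then c0 else (\<lambda>F. 0)) F"
          proof (cases "a' = a \<and> F \<subseteq> keys \<alpha> \<and> F \<subseteq> keys \<alpha>'")
            case True
            then have "component a' \<alpha>' c F = (if \<alpha> - sqf F = \<alpha>' - sqf F then c0 F else 0)"
              by (simp add: component_def c_def lookup_single when_def)
            then show ?thesis using inj True by auto
          next
            case False
            then have "component a' \<alpha>' c F = 0" by (auto simp: component_def c_def)
            then show ?thesis using out False by auto
          qed
        qed
        have c: "md.chain ?N i c"
        proof (rule md.chainI)
          fix F
          show "c F \<in> ?N F"
          proof (cases "F \<subseteq> keys \<alpha> \<and> c0 F \<noteq> 0")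
            case True
            then have "keys (\<alpha> - sqf F) \<in> U" using sq.chainD(1)[OF c0(1), of F] by (simp add: mem_mfaces)
            moreover have "keys (\<alpha> - sqf F) \<subseteq> V"
              using \<alpha>(1) by (auto simp: in_keys_iff lookup_minus)
            moreover have "int (mdeg (\<alpha> - sqf F)) = j - int (card F) - int (s ! a)"
              using mdeg_diff[of F \<alpha>] True \<alpha>(2) by linarith
            ultimately show ?thesis
              using a True by (auto simp: graded_def gpart_def c_def homogeneous_def)
          next
            case False
            then have "c F = 0" by (auto simp: c_def fun_eq_iff)
            then show ?thesis using md.coeffsD(1)[OF cN] by simp
          qed
          assume "c F \<noteq> 0"
          then have "c0 F \<noteq> 0" by (auto simp: c_def fun_eq_iff split: if_splits)
          then show "F \<subseteq> V \<and> card F = i" using sq.chainD(2,3)[OF c0(1)] by blast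
        qed
        moreover have "md.kd c F = 0" for F
        proof (cases "F \<subseteq> V")
          case True
          then have "finite F" by (rule sq.finite_subset_V)
          then have "lookup (md.kd c F a') \<beta> = 0" for a' \<beta>
            using c0(2) by (simp add: poly_component kd_component[symmetric] comp)
          then show ?thesis by (auto intro!: poly_mapping_eqI simp: fun_eq_iff)
        qed (simp add: md.kd_def)
        ultimately obtain b where b: "md.chain ?N (Suc i) b" "md.kd b = c"
          using md.vanishesD[OF L] by blast
        have "sq.kd (component a \<alpha> b) = c0"
          using kd_component[of a \<alpha> b] b(2) comp[of a \<alpha>] by auto
        then show "\<exists>b. sq.chain (mfaces U \<alpha>) (Suc i) b \<and> sq.kd b = c0"
          using comp_chain[OF b(1) a] by blast
      qed
    qed
  next
    assume R: "\<forall>a<length s. \<forall>\<alpha>. keys \<alpha> \<subseteq> V \<longrightarrow> int (mdeg \<alpha>) + int (s ! a) = j \<longrightarrow> sq.vanishes (mfaces U \<alpha>) i"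
    define valid where "valid a \<alpha> \<longleftrightarrow> a < length s \<and> keys \<alpha> \<subseteq> V \<and> int (mdeg \<alpha>) + int (s ! a) = j" for a \<alpha>
    show ?L
      unfolding md.vanishes_def
    proof (intro allI impI)
      fix c assume c: "md.chain ?N i c" "\<forall>F. md.kd c F = 0"
      have "\<exists>b. sq.chain (mfaces U \<alpha>) (Suc i) b \<and> sq.kd b = component a \<alpha> c" if "valid a \<alpha>" for a \<alpha>
      proof -
        have "sq.kd (component a \<alpha> c) F = 0" for F
          using c(2) by (simp add: kd_component component_def)
        moreover have "sq.chain (mfaces U \<alpha>) i (component a \<alpha> c)"
          using comp_chain[OF c(1)] that by (simp add: valid_def)
        ultimately show ?thesis using R that unfolding valid_def sq.vanishes_def by blast
      qed
      then obtain B where B: "\<And>a \<alpha>. valid a \<alpha> \<Longrightarrow> sq.chain (mfaces U \<alpha>) (Suc i) (B a \<alpha>)"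
        "\<And>a \<alpha>. valid a \<alpha> \<Longrightarrow> sq.kd (B a \<alpha>) = component a \<alpha> c"
        by metis
      \<comment> \<open>The bounding chains of the components assemble to polynomials because only
        finitely many monomials in \<open>V\<close> have a given degree.\<close>
      define b where "b F a = (if F \<subseteq> V \<and> card F = Suc i then
          Abs_poly_mapping (\<lambda>\<beta>. if valid a (\<beta> + sqf F) then B a (\<beta> + sqf F) F else 0) else 0)" for F a
      have lookup_b: "lookup (b F a) \<beta> = (if F \<subseteq> V \<and> card F = Suc i \<and> valid a (\<beta> + sqf F) then B a (\<beta> + sqf F) F else 0)"
        for F a \<beta>
      proof (cases "F \<subseteq> V \<and> card F = Suc i")
        case True
        then have F: "finite F" using sq.finite_subset_V by simp
        have "{\<beta>. (if valid a (\<beta> + sqf F) then B a (\<beta> + sqf F) F else 0) \<noteq> 0} \<subseteq>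
            {\<beta>. keys \<beta> \<subseteq> V \<and> mdeg \<beta> = nat (j - int (s ! a) - int (card F))}"
          using F by (auto simp: valid_def mdeg_add mdeg_sqf keys_add_monomial split: if_splits)
        then have "finite {\<beta>. (if valid a (\<beta> + sqf F) then B a (\<beta> + sqf F) F else 0) \<noteq> 0}"
          using finite_monomials[OF fin] finite_subset by blast
        then show ?thesis using True by (simp add: b_def)
      qed (auto simp: b_def)
      have b: "md.chain ?N (Suc i) b"
      proof (rule md.chainI)
        fix F
        show "b F \<in> ?N F"
        proof -
          have "keys e \<subseteq> V \<and> keys e \<in> U \<and> int (mdeg e) = j - int (card F) - int (s ! a) \<and> a < length s"
            if e: "e \<in> keys (b F a)" for e a
          proof -
            have F: "F \<subseteq> V" "card F = Suc i" and v: "valid a (e + sqf F)" and nz: "B a (e + sqf F) F \<noteq> 0"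
              using e by (auto simp: in_keys_iff lookup_b split: if_splits)
            have fF: "finite F" using F(1) sq.finite_subset_V by simp
            have "keys e \<in> U"
              using sq.chainD(1)[OF B(1)[OF v], of F] nz by (simp add: mem_mfaces)
            then show ?thesis using v fF by (auto simp: valid_def mdeg_add mdeg_sqf keys_add_monomial)
          qed
          moreover from this have "b F a = 0" if "a \<ge> length s" for a
            using that by (metis keys_eq_empty ex_in_conv not_le)
          ultimately show ?thesis by (simp add: graded_def gpart_def homogeneous_def)
        qed
        assume "b F \<noteq> 0"
        then show "F \<subseteq> V \<and> card F = Suc i" by (auto simp: b_def fun_eq_iff split: if_splits)
      qed
      have compb: "component a \<alpha> b = B a \<alpha>" if v: "valid a \<alpha>" for a \<alpha>
      proof
        fix F
        note ch = sq.chainD[OF B(1)[OF v], of F]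
        show "component a \<alpha> b F = B a \<alpha> F"
        proof (cases "F \<subseteq> keys \<alpha>")
          case True
          have e: "\<alpha> - sqf F + sqf F = \<alpha>" by (rule sqf_diff_add[OF True])
          show ?thesis using True v ch by (auto simp: component_def lookup_b e)
        next
          case False
          then show ?thesis using ch(1) by (auto simp: component_def mem_mfaces)
        qed
      qed
      have "md.kd b = c"
      proof
        fix F
        show "md.kd b F = c F"
        proof (cases "F \<subseteq> V")
          case True
          then have F: "finite F" using sq.finite_subset_V by simp
          have gp: "md.kd b F \<in> ?N F" "c F \<in> ?N F"
            using md.chainD(1)[OF md.chain_kd[OF cN b]] md.chainD(1)[OF c(1)] by auto
          have "lookup (md.kd b F a) \<beta> = lookup (c F a) \<beta>" for a \<beta>
          proof (cases "valid a (\<beta> + sqf F)")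
            case True
            then show ?thesis
              using F by (simp add: poly_component kd_component[symmetric] compb B(2))
          next
            case False
            have "lookup (f a) \<beta> = 0" if "f \<in> ?N F" for f
            proof (rule ccontr)
              assume nz: "lookup (f a) \<beta> \<noteq> 0"
              then have "a < length s" using that by (auto simp: graded_def gpart_def not_le[symmetric])
              then have "valid a (\<beta> + sqf F)"
                using nz that F True by (auto simp: valid_def graded_def gpart_def homogeneous_def in_keys_iff
                  mdeg_add mdeg_sqf keys_add_monomial keys_sqf)
              then show False using False by simp
            qed
            then show ?thesis using gp by simp
          qed
          then show ?thesis by (auto intro!: poly_mapping_eqI simp: fun_eq_iff)
        next
          case False
          then show ?thesis using md.chain_outside[OF c(1)] by (simp add: md.kd_def)
        qed
      qed
      then show "\<exists>b. md.chain ?N (Suc i) b \<and> md.kd b = c" using b by blast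
    qed
  }
qed

lemma vanishes_mfaces_cone:
  assumes U: "upset U" and x: "x \<in> V" and eq: "\<And>F. F \<subseteq> V \<Longrightarrow> x \<notin> F \<Longrightarrow> mfaces U \<alpha> (insert x F) = mfaces U \<alpha> F"
  shows "sq.vanishes (mfaces U \<alpha>) i"
  by (rule sq.vanishes_cone[OF coeffs_mfaces[OF U] x]) (simp add: eq bij_betw_def)

text \<open>Any variable dividing \<alpha> is the apex of a cone; for \<alpha> = 0 the empty set is
  the only face.\<close>

lemma vanishes_mfaces_free:
  assumes "keys \<alpha> \<subseteq> V" "\<alpha> \<noteq> 0 \<or> i \<noteq> 0"
  shows "sq.vanishes (mfaces UNIV \<alpha>) i"
proof (cases "\<alpha> = 0")
  case False
  then obtain x where "x \<in> keys \<alpha>" by (metis keys_eq_empty ex_in_conv)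
  then show ?thesis
    using assms(1) by (intro vanishes_mfaces_cone[of _ x]) (auto simp: upset_def mfaces_def)
next
  case True
  have "i \<noteq> 0" using assms(2) True by simp
  then show ?thesis
    by (intro sq.vanishes_trivial[OF coeffs_mfaces]) (auto simp: upset_def mfaces_def True)
qed

lemma vanishes_free:
  assumes "i \<noteq> 0 \<or> j \<notin> int ` set s"
  shows "md.vanishes (graded (gpart V UNIV s) j) i"
proof -
  have up: "upset (UNIV :: 'v set set)" by (simp add: upset_def)
  have "sq.vanishes (mfaces UNIV \<alpha>) i"
    if "a < length s" "keys \<alpha> \<subseteq> V" "int (mdeg \<alpha>) + int (s ! a) = j" for a \<alpha>
  proof (rule vanishes_mfaces_free[OF that(2)])
    have "\<alpha> = 0 \<Longrightarrow> j \<in> int ` set s" using that by auto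
    then show "\<alpha> \<noteq> 0 \<or> i \<noteq> 0" using assms by blast
  qed
  then show ?thesis unfolding vanishes_gpart[OF up] by blast
qed

text \<open>Only square-free multidegrees contribute to the Koszul homology of a square-free monomial ideal.\<close>

lemma vanishes_ideal:
  assumes U: "upset U"
  shows "md.vanishes (graded (gpart V U [0]) j) i \<longleftrightarrow> (\<forall>S\<subseteq>V. int (card S) = j \<longrightarrow> acyclic_at U S i)"
proof -
  have sf: "mfaces U (sqf S) = faces U S" if "S \<subseteq> V" for S
  proof
    fix F
    have S: "finite S" using that sq.finite_subset_V by simp
    have "keys (sqf S - sqf F) = S - F" if "F \<subseteq> S"
      using S finite_subset[OF that S] by (auto simp: in_keys_iff lookup_minus lookup_sqf split: if_splits)
    then show "mfaces U (sqf S) F = faces U S F"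
      using S by (auto simp: mfaces_def faces_def keys_sqf)
  qed
  have "sq.vanishes (mfaces U \<alpha>) i" if \<alpha>: "keys \<alpha> \<subseteq> V" "\<alpha> \<noteq> sqf (keys \<alpha>)" for \<alpha>
  proof -
    obtain x where x: "lookup \<alpha> x \<noteq> lookup (sqf (keys \<alpha>)) x"
      using \<alpha>(2) by (meson poly_mapping_eqI)
    \<comment> \<open>A variable of exponent at least 2 is an apex, since lowering the exponent by
      one keeps the support.\<close>
    then have x2: "1 < lookup \<alpha> x" by (auto simp: lookup_sqf in_keys_iff split: if_splits)
    then have xk: "x \<in> keys \<alpha>" by (simp add: in_keys_iff)
    show ?thesis
    proof (rule vanishes_mfaces_cone[OF U])
      show "x \<in> V" using xk \<alpha>(1) by blast
      fix F assume F: "F \<subseteq> V" "x \<notin> F"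
      have "finite F" using F(1) sq.finite_subset_V by simp
      then have "keys (\<alpha> - sqf (insert x F)) = keys (\<alpha> - sqf F)"
        using x2 F(2) by (auto simp: in_keys_iff lookup_minus lookup_sqf)
      then show "mfaces U \<alpha> (insert x F) = mfaces U \<alpha> F" using xk by (simp add: mfaces_def)
    qed
  qed
  note nsf = this
  show ?thesis
    unfolding vanishes_gpart[OF U]
  proof (intro iffI allI impI)
    fix S assume *: "\<forall>a<length [0::nat]. \<forall>\<alpha>. keys \<alpha> \<subseteq> V \<longrightarrow> int (mdeg \<alpha>) + int ([0] ! a) = j \<longrightarrow> sq.vanishes (mfaces U \<alpha>) i"
      and S: "S \<subseteq> V" "int (card S) = j"
    have "finite S" using S sq.finite_subset_V by simp
    then show "acyclic_at U S i"
      using *[rule_format, of 0 "sqf S"] S sf[OF S(1)] by (simp add: acyclic_at_def keys_sqf mdeg_sqf)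
  next
    fix a \<alpha> assume *: "\<forall>S\<subseteq>V. int (card S) = j \<longrightarrow> acyclic_at U S i" and a: "a < length [0::nat]"
      and \<alpha>: "keys \<alpha> \<subseteq> V" "int (mdeg \<alpha>) + int ([0] ! a) = j"
    show "sq.vanishes (mfaces U \<alpha>) i"
    proof (cases "\<alpha> = sqf (keys \<alpha>)")
      case True
      then have "card (keys \<alpha>) = mdeg \<alpha>" using mdeg_sqf[of "keys \<alpha>"] by simp
      then have "acyclic_at U (keys \<alpha>) i" using *[rule_format, of "keys \<alpha>"] \<alpha> a by simp
      then show ?thesis using sf[OF \<alpha>(1)] True by (simp add: acyclic_at_def)
    qed (rule nsf[OF \<alpha>(1)])
  qed
qed

end

section \<open>Graded matrices as maps\<close>

definition mat_map :: "('v, 'k::field) mpoly mat \<Rightarrow> (nat \<Rightarrow> ('v, 'k) mpoly) \<Rightarrow> nat \<Rightarrow> ('v, 'k) mpoly" where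
  "mat_map A f a = (if a < dim_row A then \<Sum>b<dim_col A. A $$ (a, b) * f b else 0)"

lemma mat_map_add: "mat_map A (f + g) = mat_map A f + mat_map A g"
  by (rule ext) (simp add: mat_map_def distrib_left sum.distrib)

lemma mat_map_vmul: "mat_map A (vmul x f) = vmul x (mat_map A f)"
  by (rule ext) (simp add: mat_map_def vmul_def sum_distrib_left mult.left_commute)

lemma mat_map_0 [simp]: "mat_map A 0 = 0"
  by (rule ext) (simp add: mat_map_def)

lemma mat_map_diff: "mat_map A (f - g) = mat_map A f - mat_map A g"
  by (rule ext) (simp add: mat_map_def right_diff_distrib sum_subtractf)

lemma mat_map_sum: "mat_map A (sum f I) = (\<Sum>i\<in>I. mat_map A (f i))"
  by (induction I rule: infinite_finite_induct)
    (simp_all only: sum.infinite sum.empty sum.insert mat_map_0 mat_map_add not_False_eq_True)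

definition scale :: "'k::field \<Rightarrow> (nat \<Rightarrow> ('v, 'k) mpoly) \<Rightarrow> nat \<Rightarrow> ('v, 'k) mpoly" where
  "scale c f = (\<lambda>a. single 0 c * f a)"

lemma mat_map_scale: "mat_map A (scale c f) = scale c (mat_map A f)"
  by (rule ext) (simp add: mat_map_def scale_def sum_distrib_left mult.left_commute)

definition poly_vecs :: "'v set \<Rightarrow> nat \<Rightarrow> (nat \<Rightarrow> ('v, 'k::field) mpoly) set" where
  "poly_vecs V n = {f. (\<forall>a<n. f a \<in> carrier (poly_ring V)) \<and> (\<forall>a\<ge>n. f a = 0)}"

lemma mem_carrier_poly_ring: "p \<in> carrier (poly_ring V) \<longleftrightarrow> (\<forall>e\<in>keys p. keys e \<subseteq> V)"
  by (simp add: poly_ring_def)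

definition vec_fun :: "('v, 'k::field) mpoly vec \<Rightarrow> nat \<Rightarrow> ('v, 'k) mpoly" where
  "vec_fun v a = (if a < dim_vec v then v $ a else 0)"

lemma vec_fun_free_module: "vec_fun ` free_module V n = poly_vecs V n"
proof
  show "vec_fun ` free_module V n \<subseteq> poly_vecs V n"
    by (auto simp: free_module_def poly_vecs_def vec_fun_def)
  show "poly_vecs V n \<subseteq> vec_fun ` free_module V n"
  proof
    fix f assume f: "f \<in> poly_vecs V n"
    then have "f = vec_fun (vec n f)" by (auto simp: vec_fun_def poly_vecs_def fun_eq_iff)
    moreover have "vec n f \<in> free_module V n" using f by (simp add: free_module_def poly_vecs_def)
    ultimately show "f \<in> vec_fun ` free_module V n" by blast
  qed
qed

lemma vec_fun_inject:
  assumes "v \<in> carrier_vec n" "w \<in> carrier_vec n" "vec_fun v = vec_fun w"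
  shows "v = w"
proof (rule eq_vecI)
  show "v $ a = w $ a" if "a < dim_vec w" for a
    using fun_cong[OF assms(3), of a] that assms(1,2) by (simp add: vec_fun_def)
qed (use assms(1,2) in simp)

lemma vec_fun_mult:
  assumes "A \<in> carrier_mat m n" "v \<in> carrier_vec n"
  shows "vec_fun (A *\<^sub>v v) = mat_map A (vec_fun v)"
proof
  fix a show "vec_fun (A *\<^sub>v v) a = mat_map A (vec_fun v) a"
    using assms by (auto simp: vec_fun_def mat_map_def scalar_prod_def atLeast0LessThan intro!: sum.cong)
qed

lemma vec_fun_zero: "vec_fun (0\<^sub>v n) = 0"
  by (auto simp: vec_fun_def fun_eq_iff)

lemma kernel_vec_fun:
  assumes A: "A \<in> carrier_mat m n" and A': "A' \<in> carrier_mat n k"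
  shows "mat_kernel A \<inter> free_module V n = {A' *\<^sub>v v | v. v \<in> free_module V k} \<longleftrightarrow>
    {f \<in> poly_vecs V n. mat_map A f = 0} = mat_map A' ` poly_vecs V k" (is "?K = ?I \<longleftrightarrow> ?K' = ?I'")
proof -
  have fm: "v \<in> carrier_vec l" if "v \<in> free_module V l" for v :: "('a, 'b) mpoly vec" and l
    using that by (simp add: free_module_def)
  have K: "vec_fun ` ?K = ?K'"
  proof -
    have "v \<in> mat_kernel A \<longleftrightarrow> mat_map A (vec_fun v) = 0" if "v \<in> free_module V n" for v
    proof -
      have "A *\<^sub>v v = 0\<^sub>v m \<longleftrightarrow> vec_fun (A *\<^sub>v v) = vec_fun (0\<^sub>v m)"
        using vec_fun_inject[OF mult_mat_vec_carrier[OF A fm[OF that]] zero_carrier_vec] by metis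
      then show ?thesis
        using fm[OF that] A by (simp add: mat_kernel[OF A] vec_fun_mult[OF A fm[OF that]] vec_fun_zero)
    qed
    then have "?K = {v \<in> free_module V n. mat_map A (vec_fun v) = 0}" by blast
    then show ?thesis by (auto simp: vec_fun_free_module[symmetric])
  qed
  have I: "vec_fun ` ?I = ?I'"
  proof -
    have "vec_fun ` ?I = (\<lambda>v. vec_fun (A' *\<^sub>v v)) ` free_module V k" by auto
    also have "\<dots> = (\<lambda>v. mat_map A' (vec_fun v)) ` free_module V k"
      by (rule image_cong[OF refl]) (rule vec_fun_mult[OF A' fm])
    also have "\<dots> = ?I'" by (simp only: image_image[symmetric] vec_fun_free_module)
    finally show ?thesis .
  qed
  have "?K \<subseteq> carrier_vec n" by (auto simp: free_module_def)
  moreover have "?I \<subseteq> carrier_vec n" using A' by (auto intro: mult_mat_vec_carrier[OF A'] fm)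
  moreover have "inj_on vec_fun (carrier_vec n :: ('a, 'b) mpoly vec set)"
    by (rule inj_onI) (rule vec_fun_inject)
  ultimately have "vec_fun ` ?K = vec_fun ` ?I \<longleftrightarrow> ?K = ?I" by (intro inj_on_image_eq_iff)
  then show ?thesis unfolding K I by (rule sym)
qed

lemma augmentation_vec_fun:
  assumes A: "A \<in> carrier_mat 1 n" and J: "J \<subseteq> carrier (poly_ring V)"
  shows "{(A *\<^sub>v v) $ 0 | v. v \<in> free_module V n} = J \<longleftrightarrow>
    {f \<in> poly_vecs V 1. f 0 \<in> J} = mat_map A ` poly_vecs V n"
proof -
  have fm: "v \<in> carrier_vec n" if "v \<in> free_module V n" for v :: "('a, 'b) mpoly vec"
    using that by (simp add: free_module_def)
  have "{(A *\<^sub>v v) $ 0 | v. v \<in> free_module V n} = (\<lambda>v. mat_map A (vec_fun v) 0) ` free_module V n"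
  proof -
    have "(A *\<^sub>v v) $ 0 = mat_map A (vec_fun v) 0" if "v \<in> free_module V n" for v
      using fun_cong[OF vec_fun_mult[OF A fm[OF that]], of 0] A by (simp add: vec_fun_def)
    then show ?thesis by (auto simp: image_iff) metis
  qed
  also have "\<dots> = (\<lambda>f. f 0) ` mat_map A ` poly_vecs V n"
    by (simp only: image_image vec_fun_free_module[symmetric])
  finally have e1: "{(A *\<^sub>v v) $ 0 | v. v \<in> free_module V n} = (\<lambda>f. f 0) ` mat_map A ` poly_vecs V n" .
  have e2: "(\<lambda>f. f 0) ` {f \<in> poly_vecs V 1. f 0 \<in> J} = J"
  proof
    show "J \<subseteq> (\<lambda>f. f 0) ` {f \<in> poly_vecs V 1. f 0 \<in> J}"
    proof
      fix p assume "p \<in> J"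
      then show "p \<in> (\<lambda>f. f 0) ` {f \<in> poly_vecs V 1. f 0 \<in> J}"
        using J by (intro image_eqI[of _ _ "\<lambda>a. if a = 0 then p else 0"]) (auto simp: poly_vecs_def)
    qed
  qed auto
  have inj: "inj_on (\<lambda>f. f 0) {f :: nat \<Rightarrow> ('a, 'b) mpoly. \<forall>a\<ge>1. f a = 0}"
  proof (rule inj_onI, rule ext)
    fix f g :: "nat \<Rightarrow> ('a, 'b) mpoly" and a
    assume "f \<in> {f. \<forall>a\<ge>1. f a = 0}" "g \<in> {f. \<forall>a\<ge>1. f a = 0}" "f 0 = g 0"
    then show "f a = g a" by (cases a) auto
  qed
  have s1: "{f \<in> poly_vecs V 1. f 0 \<in> J} \<subseteq> {f. \<forall>a\<ge>1. f a = 0}"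
    by (auto simp: poly_vecs_def)
  have s2: "mat_map A ` poly_vecs V n \<subseteq> {f. \<forall>a\<ge>1. f a = 0}"
    using A by (auto simp: mat_map_def)
  show ?thesis
    unfolding e1 using inj_on_image_eq_iff[OF inj s1 s2] unfolding e2 by (simp only: eq_commute)
qed

section \<open>Homogeneous components\<close>

definition hpart :: "int \<Rightarrow> ('v, 'k::field) mpoly \<Rightarrow> ('v, 'k) mpoly" where
  "hpart t p = Abs_poly_mapping (\<lambda>e. if int (mdeg e) = t then lookup p e else 0)"

lemma lookup_hpart: "lookup (hpart t p) e = (if int (mdeg e) = t then lookup p e else 0)"
proof -
  have "{e. (if int (mdeg e) = t then lookup p e else 0) \<noteq> 0} \<subseteq> keys p"
    by (auto simp: in_keys_iff)
  then show ?thesis by (simp add: hpart_def finite_subset)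
qed

lemma hpart_add: "hpart t (p + q) = hpart t p + hpart t q"
  by (rule poly_mapping_eqI) (simp add: lookup_hpart lookup_add)

lemma hpart_0 [simp]: "hpart t 0 = 0"
  by (rule poly_mapping_eqI) (simp add: lookup_hpart)

lemma hpart_sum: "hpart t (sum f A) = (\<Sum>a\<in>A. hpart t (f a))"
  by (induction A rule: infinite_finite_induct) (simp_all add: hpart_add)

lemma hpart_homogeneous: "p \<in> carrier (poly_ring V) \<Longrightarrow> hpart t p \<in> homogeneous V t"
  by (auto simp: homogeneous_def mem_carrier_poly_ring in_keys_iff lookup_hpart split: if_splits)

lemma hpart_id: "p \<in> homogeneous V t \<Longrightarrow> hpart t p = p"
  by (rule poly_mapping_eqI) (auto simp: lookup_hpart homogeneous_def in_keys_iff)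

lemma homogeneous_carrier: "p \<in> homogeneous V t \<Longrightarrow> p \<in> carrier (poly_ring V)"
  by (simp add: homogeneous_def mem_carrier_poly_ring)

lemma hpart_mult:
  assumes p: "p \<in> homogeneous V u"
  shows "hpart (u + t) (p * q) = p * hpart t q"
proof -
  \<comment> \<open>The components of \<open>q\<close> in degrees other than \<open>t\<close>;
    multiplied by \<open>p\<close>, they miss the degree u + t.\<close>
  define r where "r = q - hpart t q"
  have r: "lookup r e = 0" if "int (mdeg e) = t" for e
    using that by (simp add: r_def lookup_minus lookup_hpart)
  have "hpart (u + t) (p * r) = 0"
  proof (rule poly_mapping_eqI)
    fix e
    have "e \<notin> keys (p * r)" if "int (mdeg e) = u + t"
    proof
      assume "e \<in> keys (p * r)"
      then obtain a b where ab: "a \<in> keys p" "b \<in> keys r" "e = a + b" using keys_mult[of p r] by blast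
      then have "int (mdeg a) = u" using p by (simp add: homogeneous_def)
      then have "int (mdeg b) = t" using ab(3) that by (simp add: mdeg_add)
      then show False using r[of b] ab(2) by (simp add: in_keys_iff)
    qed
    then show "lookup (hpart (u + t) (p * r)) e = lookup 0 e"
      by (auto simp: lookup_hpart in_keys_iff)
  qed
  moreover have "hpart (u + t) (p * hpart t q) = p * hpart t q"
  proof (rule poly_mapping_eqI)
    fix e
    have "int (mdeg e) = u + t" if "e \<in> keys (p * hpart t q)"
    proof -
      obtain a b where ab: "a \<in> keys p" "b \<in> keys (hpart t q)" "e = a + b"
        using \<open>e \<in> keys (p * hpart t q)\<close> keys_mult[of p "hpart t q"] by blast
      then have "int (mdeg a) = u" "int (mdeg b) = t"
        using p by (auto simp: homogeneous_def in_keys_iff lookup_hpart split: if_splits)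
      then show ?thesis by (simp add: ab(3) mdeg_add)
    qed
    then show "lookup (hpart (u + t) (p * hpart t q)) e = lookup (p * hpart t q) e"
      by (auto simp: lookup_hpart in_keys_iff)
  qed
  moreover have "p * q = p * hpart t q + p * r"
    by (simp add: r_def distrib_left[symmetric])
  ultimately show ?thesis by (simp add: hpart_add)
qed

definition hcomp :: "nat list \<Rightarrow> int \<Rightarrow> (nat \<Rightarrow> ('v, 'k::field) mpoly) \<Rightarrow> nat \<Rightarrow> ('v, 'k) mpoly" where
  "hcomp s j f a = (if a < length s then hpart (j - int (s ! a)) (f a) else 0)"

lemma graded_matrix_entry:
  assumes "graded_matrix V s t A" "a < length s" "b < length t"
  shows "A $$ (a, b) \<in> homogeneous V (int (t ! b) - int (s ! a))"
  using assms unfolding graded_matrix_def homogeneous_def mem_carrier_poly_ring by fastforce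

lemma graded_matrix_dims:
  assumes "graded_matrix V s t A"
  shows "dim_row A = length s" "dim_col A = length t" "A \<in> carrier_mat (length s) (length t)"
  using assms by (auto simp: graded_matrix_def)

lemma mat_map_gpart:
  assumes A: "graded_matrix V s t A" and f: "f \<in> gpart V UNIV t j"
  shows "mat_map A f \<in> gpart V UNIV s j"
proof -
  have "A $$ (a, b) * f b \<in> homogeneous V (j - int (s ! a))" if "a < length s" "b < length t" for a b
    using homogeneous_mult[OF graded_matrix_entry[OF A that], of "f b" "j - int (t ! b)"] f that
    by (simp add: gpart_def)
  then show ?thesis
    by (auto simp: gpart_def mat_map_def graded_matrix_dims[OF A] intro!: homogeneous_sum)
qed

lemma hcomp_mat_map:
  assumes A: "graded_matrix V s t A"
  shows "hcomp s j (mat_map A f) = mat_map A (hcomp t j f)"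
proof
  fix a
  have "hpart (j - int (s ! a)) (A $$ (a, b) * f b) = A $$ (a, b) * hpart (j - int (t ! b)) (f b)"
    if "a < length s" "b < length t" for b
    using hpart_mult[OF graded_matrix_entry[OF A that], of "j - int (t ! b)" "f b"] by simp
  then show "hcomp s j (mat_map A f) a = mat_map A (hcomp t j f) a"
    by (simp add: hcomp_def mat_map_def graded_matrix_dims[OF A] hpart_sum)
qed

lemma hcomp_gpart: "f \<in> poly_vecs V (length s) \<Longrightarrow> hcomp s j f \<in> gpart V UNIV s j"
  by (simp add: gpart_def poly_vecs_def hcomp_def hpart_homogeneous)

lemma hcomp_id: "f \<in> gpart V UNIV s j \<Longrightarrow> hcomp s j f = f"
  by (auto simp: gpart_def hcomp_def fun_eq_iff not_less intro: hpart_id)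

lemma gpart_poly_vecs: "gpart V U s j \<subseteq> poly_vecs V (length s)"
  by (auto simp: gpart_def poly_vecs_def intro: homogeneous_carrier)

lemma poly_vecs_add: "f \<in> poly_vecs V n \<Longrightarrow> g \<in> poly_vecs V n \<Longrightarrow> f + g \<in> poly_vecs V n"
proof -
  assume fg: "f \<in> poly_vecs V n" "g \<in> poly_vecs V n"
  have "f a + g a \<in> carrier (poly_ring V)" if "a < n" for a
    using fg that keys_add[of "f a" "g a"] unfolding poly_vecs_def mem_carrier_poly_ring by blast
  then show ?thesis using fg by (simp add: poly_vecs_def)
qed

lemma poly_vecs_sum: "(\<And>i. i \<in> I \<Longrightarrow> f i \<in> poly_vecs V n) \<Longrightarrow> sum f I \<in> poly_vecs V n"
proof (induction I rule: infinite_finite_induct)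
  case (insert x F)
  then show ?case unfolding sum.insert[OF insert.hyps] by (intro poly_vecs_add) auto
qed (simp_all add: poly_vecs_def mem_carrier_poly_ring)

lemma sum_hcomp:
  fixes f :: "nat \<Rightarrow> ('v, 'k::field) mpoly"
  assumes f: "f \<in> poly_vecs V (length s)"
  obtains N where "f = (\<Sum>j<N. hcomp s (int j) f)"
proof -
  define S where "S = (\<Union>a<length s. (\<lambda>e. mdeg e + s ! a) ` keys (f a))"
  have "finite S" by (simp add: S_def)
  then obtain N where N: "S \<subseteq> {..<N}" using finite_nat_iff_bounded by blast
  have "f = (\<Sum>j<N. hcomp s (int j) f)"
  proof
    fix a show "f a = (\<Sum>j<N. hcomp s (int j) f) a"
    proof (cases "a < length s")
      case True
      show ?thesis
      proof (rule poly_mapping_eqI)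
        fix e :: "'v monomial"
        have eq: "(int (mdeg e) = int j - int (s ! a)) \<longleftrightarrow> j = mdeg e + s ! a" for j by auto
        have "lookup ((\<Sum>j<N. hcomp s (int j) f) a) e =
            (\<Sum>j<N. if j = mdeg e + s ! a then lookup (f a) e else 0)"
          using True by (simp add: sum_fun_at lookup_sum hcomp_def lookup_hpart eq)
        also have "\<dots> = (if mdeg e + s ! a < N then lookup (f a) e else 0)"
          by simp
        also have "\<dots> = lookup (f a) e"
        proof (cases "e \<in> keys (f a)")
          case e: True
          then have "mdeg e + s ! a \<in> S" using True by (auto simp: S_def)
          then show ?thesis using N by auto
        qed (simp add: in_keys_iff)
        finally show "lookup (f a) e = lookup ((\<Sum>j<N. hcomp s (int j) f) a) e" ..
      qed
    next
      case False
      then show ?thesis using f by (simp add: sum_fun_at hcomp_def poly_vecs_def)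
    qed
  qed
  then show ?thesis by (rule that)
qed

text \<open>Exactness of a resolution concerns whole modules, Koszul homology their graded pieces.
  Since graded matrices commute with \<open>hcomp\<close>, an image can be compared degree by degree
  with a submodule closed under components.\<close>

lemma image_graded_iff:
  assumes A: "graded_matrix V s t A" and M: "M \<subseteq> poly_vecs V (length s)"
    and M0: "0 \<in> M" and Madd: "\<And>f g. f \<in> M \<Longrightarrow> g \<in> M \<Longrightarrow> f + g \<in> M"
    and Mh: "\<And>f j. f \<in> M \<Longrightarrow> hcomp s j f \<in> M"
  shows "M = mat_map A ` poly_vecs V (length t) \<longleftrightarrow>
    (\<forall>j. mat_map A ` gpart V UNIV t j = M \<inter> gpart V UNIV s j)"
proof
  assume L: "M = mat_map A ` poly_vecs V (length t)"
  show "\<forall>j. mat_map A ` gpart V UNIV t j = M \<inter> gpart V UNIV s j"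
  proof (intro allI equalityI subsetI)
    fix j f assume "f \<in> mat_map A ` gpart V UNIV t j"
    then show "f \<in> M \<inter> gpart V UNIV s j"
      unfolding L using mat_map_gpart[OF A] gpart_poly_vecs[of V UNIV t j] by blast
  next
    fix j f assume f: "f \<in> M \<inter> gpart V UNIV s j"
    then obtain v where v: "v \<in> poly_vecs V (length t)" "f = mat_map A v" unfolding L by blast
    have "f = mat_map A (hcomp t j v)"
      using f hcomp_id[of f V s j] hcomp_mat_map[OF A, of j v] v(2) by simp
    then show "f \<in> mat_map A ` gpart V UNIV t j" using hcomp_gpart[OF v(1)] by blast
  qed
next
  assume R: "\<forall>j. mat_map A ` gpart V UNIV t j = M \<inter> gpart V UNIV s j"
  have Msum: "sum f I \<in> M" if "\<And>i. i \<in> I \<Longrightarrow> f i \<in> M" for f and I :: "nat set"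
    using that by (induction I rule: infinite_finite_induct) (simp_all add: M0 Madd)
  show "M = mat_map A ` poly_vecs V (length t)"
  proof (intro equalityI subsetI)
    fix f assume f: "f \<in> M"
    then have fv: "f \<in> poly_vecs V (length s)" using M by blast
    obtain N where N: "f = (\<Sum>j<N. hcomp s (int j) f)" using sum_hcomp[OF fv] .
    have "\<exists>v\<in>gpart V UNIV t (int j). mat_map A v = hcomp s (int j) f" for j
    proof -
      have "hcomp s (int j) f \<in> mat_map A ` gpart V UNIV t (int j)"
        unfolding R[rule_format] using Mh[OF f] hcomp_gpart[OF fv] by (rule IntI)
      then show ?thesis by (rule imageE) (rule bexI, auto)
    qed
    then obtain v where v: "\<And>j. v j \<in> gpart V UNIV t (int j)" "\<And>j. mat_map A (v j) = hcomp s (int j) f"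
      by metis
    have "f = mat_map A (\<Sum>j<N. v j)" using N by (simp add: mat_map_sum v(2))
    moreover have "(\<Sum>j<N. v j) \<in> poly_vecs V (length t)"
      by (rule poly_vecs_sum) (use v(1) gpart_poly_vecs in blast)
    ultimately show "f \<in> mat_map A ` poly_vecs V (length t)" by blast
  next
    fix f assume "f \<in> mat_map A ` poly_vecs V (length t)"
    then obtain v where v: "v \<in> poly_vecs V (length t)" "f = mat_map A v" by blast
    obtain N where N: "v = (\<Sum>j<N. hcomp t (int j) v)" using sum_hcomp[OF v(1)] .
    have "f = (\<Sum>j<N. mat_map A (hcomp t (int j) v))"
      unfolding v(2) mat_map_sum[symmetric] N[symmetric] ..
    moreover have "mat_map A (hcomp t (int j) v) \<in> M" for j
      using R hcomp_gpart[OF v(1), of "int j"] by blast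
    ultimately show "f \<in> M" using Msum by simp
  qed
qed

section \<open>Monomial ideals\<close>

lemma poly_sum_monomials: "p = (\<Sum>e\<in>keys p. single e (lookup p e))"
  by (rule poly_mapping_eqI) (simp add: lookup_sum lookup_single when_def in_keys_iff sum.delta' cong: if_cong)

lemma poly_ring_simps:
  "mult (poly_ring V) = (*)" "one (poly_ring V) = 1" "zero (poly_ring V) = 0" "add (poly_ring V) = (+)"
  by (simp_all add: poly_ring_def)

definition monomial_span :: "'v set \<Rightarrow> 'v monomial set \<Rightarrow> ('v, 'k::field) mpoly set" where
  "monomial_span V B = {p \<in> carrier (poly_ring V). keys p \<subseteq> B}"

lemma ideal_monomial_span:
  assumes "\<And>e f. e \<in> B \<Longrightarrow> e + f \<in> B"
  shows "ideal (monomial_span V B :: ('v, 'k::field) mpoly set) (poly_ring V)"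
proof -
  interpret R: cring "poly_ring V :: ('v, 'k) mpoly ring" by (rule cring_poly_ring)
  have mult: "p * q \<in> monomial_span V B" if "p \<in> monomial_span V B" "q \<in> carrier (poly_ring V)"
    for p q :: "('v, 'k) mpoly"
  proof -
    have "p * q \<in> carrier (poly_ring V)"
      using R.m_closed[of p q] that by (simp add: monomial_span_def poly_ring_simps)
    moreover have "keys (p * q) \<subseteq> B"
      using keys_mult[of p q] that(1) assms by (fastforce simp: monomial_span_def)
    ultimately show ?thesis by (simp add: monomial_span_def)
  qed
  show ?thesis
  proof (rule idealI[OF R.ring_axioms])
    show "subgroup (monomial_span V B :: ('v, 'k) mpoly set) (add_monoid (poly_ring V))"
    proof (rule R.add.subgroupI)
      show "(monomial_span V B :: ('v, 'k) mpoly set) \<subseteq> carrier (poly_ring V)"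
        by (auto simp: monomial_span_def)
      have "(0 :: ('v, 'k) mpoly) \<in> monomial_span V B" by (simp add: monomial_span_def mem_carrier_poly_ring)
      then show "(monomial_span V B :: ('v, 'k) mpoly set) \<noteq> {}" by blast
      fix p q :: "('v, 'k) mpoly" assume p: "p \<in> monomial_span V B"
      have "p \<in> carrier (poly_ring V)" "- p \<in> carrier (poly_ring V)"
        using p by (auto simp: monomial_span_def mem_carrier_poly_ring)
      then have "\<ominus>\<^bsub>poly_ring V\<^esub> p = - p"
        by (intro R.minus_equality) (simp_all add: poly_ring_simps)
      then show "\<ominus>\<^bsub>poly_ring V\<^esub> p \<in> monomial_span V B"
        using p by (simp add: monomial_span_def mem_carrier_poly_ring)
      assume q: "q \<in> monomial_span V B"
      show "p \<oplus>\<^bsub>poly_ring V\<^esub> q \<in> monomial_span V B"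
        using p q keys_add[of p q] R.a_closed[of p q] by (auto simp: monomial_span_def poly_ring_simps)
    qed
    fix p q :: "('v, 'k) mpoly" assume "p \<in> monomial_span V B" "q \<in> carrier (poly_ring V)"
    then show "q \<otimes>\<^bsub>poly_ring V\<^esub> p \<in> monomial_span V B" "p \<otimes>\<^bsub>poly_ring V\<^esub> q \<in> monomial_span V B"
      using mult[of p q] by (simp_all add: poly_ring_simps mult.commute)
  qed
qed

lemma monomial_span_subset:
  fixes I :: "('v, 'k::field) mpoly set"
  assumes I: "ideal I (poly_ring V)" and B: "\<And>e. e \<in> B \<Longrightarrow> keys e \<subseteq> V \<Longrightarrow> single e 1 \<in> I"
  shows "monomial_span V B \<subseteq> I"
proof
  fix p :: "('v, 'k) mpoly" assume p: "p \<in> monomial_span V B"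
  interpret I: ideal I "poly_ring V" by (rule I)
  have mono: "single e (lookup p e) \<in> I" if "e \<in> keys p" for e
  proof -
    have "single e 1 \<in> I"
      using p that by (intro B) (auto simp: monomial_span_def mem_carrier_poly_ring)
    moreover have "single 0 (lookup p e) \<in> carrier (poly_ring V)"
      by (auto simp: mem_carrier_poly_ring split: if_splits)
    ultimately have "single 0 (lookup p e) * single e 1 \<in> I"
      using I.I_l_closed by (simp add: poly_ring_simps)
    then show ?thesis by (simp add: mult_single)
  qed
  have zero: "0 \<in> I" using additive_subgroup.zero_closed[OF ideal.axioms(1)[OF I]] by (simp add: poly_ring_simps)
  have add: "a + b \<in> I" if "a \<in> I" "b \<in> I" for a b
    using additive_subgroup.a_closed[OF ideal.axioms(1)[OF I] that] by (simp add: poly_ring_simps)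
  have "(\<Sum>e\<in>S. single e (lookup p e)) \<in> I" if "S \<subseteq> keys p" for S
    using finite_subset[OF that finite_keys] that
    by (induction S) (simp_all add: zero add mono)
  from this[OF order_refl] show "p \<in> I" using poly_sum_monomials[of p] by simp
qed

lemma irrelevant_ideal_eq: "(irrelevant_ideal V :: ('v, 'k::field) mpoly set) = monomial_span V (- {0})"
proof
  interpret R: cring "poly_ring V :: ('v, 'k) mpoly ring" by (rule cring_poly_ring)
  have sub: "(indet ` V :: ('v, 'k) mpoly set) \<subseteq> carrier (poly_ring V)"
    by (auto simp: mem_carrier_poly_ring indet_def)
  show "irrelevant_ideal V \<subseteq> (monomial_span V (- {0}) :: ('v, 'k) mpoly set)"
    unfolding irrelevant_ideal_def
  proof (rule R.genideal_minimal[OF ideal_monomial_span])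
    fix e f :: "'v monomial" assume "e \<in> - {0}"
    then show "e + f \<in> - {0}" by (metis Compl_iff add_eq_0_iff_both_eq_0 mdeg_add mdeg_eq_0_iff singletonD singletonI)
  next
    show "indet ` V \<subseteq> (monomial_span V (- {0}) :: ('v, 'k) mpoly set)"
    proof
      fix p :: "('v, 'k) mpoly" assume "p \<in> indet ` V"
      then obtain x where x: "x \<in> V" "p = indet x" by blast
      have "(single x 1 :: 'v monomial) \<noteq> 0"
        using mdeg_single[of x 1] by (metis mdeg_zero one_neq_zero)
      then show "p \<in> monomial_span V (- {0})"
        using x by (auto simp: monomial_span_def mem_carrier_poly_ring indet_def)
    qed
  qed
  show "monomial_span V (- {0}) \<subseteq> (irrelevant_ideal V :: ('v, 'k) mpoly set)"
  proof (rule monomial_span_subset)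
    have id: "ideal (irrelevant_ideal V :: ('v, 'k) mpoly set) (poly_ring V)"
      unfolding irrelevant_ideal_def by (rule R.genideal_ideal[OF sub])
    then show "ideal (irrelevant_ideal V :: ('v, 'k) mpoly set) (poly_ring V)" .
    fix e :: "'v monomial" assume e: "e \<in> - {0}" "keys e \<subseteq> V"
    then obtain x where x: "x \<in> keys e" by (metis Compl_iff keys_eq_empty ex_in_conv singletonI)
    then have "indet x \<in> (irrelevant_ideal V :: ('v, 'k) mpoly set)"
      unfolding irrelevant_ideal_def using R.genideal_self[OF sub] e(2) by blast
    moreover have "single (e - single x 1) 1 \<in> carrier (poly_ring V :: ('v, 'k) mpoly ring)"
      using e(2) by (auto simp: mem_carrier_poly_ring in_keys_iff lookup_minus)
    ultimately have "single (e - single x 1) 1 * indet x \<in> (irrelevant_ideal V :: ('v, 'k) mpoly set)"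
      using ideal.I_l_closed[OF id] by (simp add: poly_ring_simps)
    moreover have "e - single x 1 + single x 1 = e"
    proof -
      have "lookup (single x 1) y \<le> lookup e y" for y
        using x by (auto simp: lookup_single when_def in_keys_iff)
      then show ?thesis using monomial_diff_add[of "single x 1" e] by (simp add: add.commute)
    qed
    ultimately show "single e 1 \<in> (irrelevant_ideal V :: ('v, 'k) mpoly set)"
      by (simp add: indet_def mult_single)
  qed
qed

section \<open>Minimal resolutions and Koszul homology\<close>

lemma homogeneous_neg: "t < 0 \<Longrightarrow> p \<in> homogeneous V t \<Longrightarrow> p = 0"
  by (auto simp: homogeneous_def keys_eq_empty[symmetric] simp del: keys_eq_empty)

lemma homogeneous_const:
  assumes "p \<in> homogeneous V 0" shows "p = single 0 (lookup p 0)"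
proof (rule poly_mapping_eqI)
  fix e
  have "lookup p e = 0" if "e \<noteq> 0"
    using assms that by (auto simp: homogeneous_def mdeg_eq_0_iff in_keys_iff)
  then show "lookup p e = lookup (single 0 (lookup p 0)) e"
    by (auto simp: lookup_single when_def)
qed

context squarefree_koszul
begin

abbreviation free :: "nat list \<Rightarrow> int \<Rightarrow> (nat \<Rightarrow> ('v, 'k) mpoly) set" where
  "free \<equiv> gpart V UNIV"

lemma upset_UNIV: "upset UNIV"
  by (simp add: upset_def)

lemmas free_module_graded = gpart_module[OF upset_UNIV]

definition kern :: "nat list \<Rightarrow> ('v, 'k) mpoly mat \<Rightarrow> int \<Rightarrow> (nat \<Rightarrow> ('v, 'k) mpoly) set" where
  "kern t A j = {f \<in> free t j. mat_map A f = 0}"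

definition presents :: "(int \<Rightarrow> (nat \<Rightarrow> ('v, 'k) mpoly) set) \<Rightarrow> nat list \<Rightarrow> ('v, 'k) mpoly mat \<Rightarrow> bool" where
  "presents M t A \<longleftrightarrow> (\<forall>j. mat_map A ` free t j = M j)"

text \<open>A homogeneous relation has coefficients in the irrelevant ideal as soon as it involves no generator of its own degree.\<close>

definition minimal_kern :: "nat list \<Rightarrow> ('v, 'k) mpoly mat \<Rightarrow> bool" where
  "minimal_kern t A \<longleftrightarrow> (\<forall>j. \<forall>f\<in>kern t A j. \<forall>b<length t. int (t ! b) = j \<longrightarrow> f b = 0)"

lemma graded_moduleD:
  assumes "graded_module M"
  shows "0 \<in> M j" "f \<in> M j \<Longrightarrow> - f \<in> M j" "f \<in> M j \<Longrightarrow> g \<in> M j \<Longrightarrow> f + g \<in> M j"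
    "x \<in> V \<Longrightarrow> f \<in> M j \<Longrightarrow> vmul x f \<in> M (j + 1)"
  using assms unfolding graded_module_def by blast+

lemma graded_module_sum: "graded_module M \<Longrightarrow> (\<And>i. i \<in> I \<Longrightarrow> f i \<in> M j) \<Longrightarrow> sum f I \<in> M j"
proof (induction I rule: infinite_finite_induct)
  case (insert x F)
  then show ?case unfolding sum.insert[OF insert.hyps] by (intro graded_moduleD(3)) auto
qed (simp_all only: sum.infinite sum.empty graded_moduleD(1) not_False_eq_True)

lemma kern_module: "graded_module (kern t A)"
proof -
  have "- f \<in> kern t A j" if "f \<in> kern t A j" for f j
    using that graded_moduleD(2)[OF free_module_graded] mat_map_diff[of A 0 f] by (simp add: kern_def)
  moreover have "f + g \<in> kern t A j" if "f \<in> kern t A j" "g \<in> kern t A j" for f g j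
    using that graded_moduleD(3)[OF free_module_graded] mat_map_add[of A f g] unfolding kern_def by auto
  moreover have "vmul x f \<in> kern t A (j + 1)" if "f \<in> kern t A j" "x \<in> V" for f j x
  proof -
    have "vmul x (0 :: nat \<Rightarrow> ('v, 'k) mpoly) = 0" by (rule ext) (simp add: vmul_def)
    then show ?thesis
      using that graded_moduleD(4)[OF free_module_graded] mat_map_vmul[of A x f] unfolding kern_def by auto
  qed
  moreover have "0 \<in> kern t A j" for j
    using graded_moduleD(1)[OF free_module_graded] mat_map_0[of A] unfolding kern_def by blast
  ultimately show ?thesis unfolding graded_module_def by blast
qed

text \<open>Dimension shifting along 0 -> kernel -> free -> M -> 0, as free modules have Koszul
  homology in degree 0 only. For p = 0 the free module may have homology, and minimality has to show
  that kernel elements bound in it.\<close>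

lemma vanishes_kern:
  assumes M: "graded_module M" and pr: "presents M t A" and min: "minimal_kern t A"
  shows "md.vanishes (graded (kern t A) j) p \<longleftrightarrow> md.vanishes (graded M j) (Suc p)"
proof
  note cs = coeffs_graded[OF free_module_graded] coeffs_graded[OF kern_module] coeffs_graded[OF M]
  have surj: "mat_map A ` graded (free t) j F = graded M j F" for F
    using pr by (simp add: graded_def presents_def)
  have ker: "graded (kern t A) j F = {m \<in> graded (free t) j F. mat_map A m = 0}" for F
    by (simp add: graded_def kern_def)
  {
    assume "md.vanishes (graded (kern t A) j) p"
    then show "md.vanishes (graded M j) (Suc p)"
      by (rule md.vanishes_quotient[OF cs(1) mat_map_add mat_map_vmul surj ker cs(2,3), rotated])
        (rule vanishes_free, simp)
  next
    assume van: "md.vanishes (graded M j) (Suc p)"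
    show "md.vanishes (graded (kern t A) j) p"
    proof (rule md.vanishes_kernel[OF cs(1) mat_map_add mat_map_vmul surj ker cs(2,3) van])
      fix c assume c: "md.chain (graded (kern t A) j) p c" "\<forall>F. md.kd c F = 0"
      show "\<exists>b. md.chain (graded (free t) j) (Suc p) b \<and> md.kd b = c"
      proof (cases "p = 0")
        case False
        have "md.chain (graded (free t) j) p c"
          using c(1) unfolding md.chain_def ker by blast
        then show ?thesis
          using vanishes_free[of p j t] False c(2) unfolding md.vanishes_def by blast
      next
        case True
        \<comment> \<open>Generators of degree j are moved to degree j + 1. By minimality the cycle
          has zero entries there, so it lives in the modified free module, which has no generator
          and hence no homology in degree j.\<close>
        define t' where "t' = map (\<lambda>d. if int d = j then d + 1 else d) t"
        have len: "length t' = length t" by (simp add: t'_def)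
        have t'_nth: "t' ! b = (if int (t ! b) = j then t ! b + 1 else t ! b)" if "b < length t" for b
          using that by (simp add: t'_def)
        have "md.chain (graded (free t') j) 0 c"
        proof (rule md.chainI)
          fix F
          show "c F \<in> graded (free t') j F"
          proof (cases "c F = 0")
            case True
            then show ?thesis using md.coeffsD(1)[OF coeffs_graded[OF free_module_graded]] by simp
          next
            case cF: False
            then have "card F = 0" using md.chainD(3)[OF c(1)] True by simp
            then have k: "c F \<in> kern t A j" using md.chainD(1)[OF c(1), of F] by (simp add: graded_def)
            then have z: "c F b = 0" if "b < length t" "int (t ! b) = j" for b
              using min that unfolding minimal_kern_def by blast
            have "c F b \<in> homogeneous V (j - int (t' ! b))" if b: "b < length t" for b
            proof (cases "int (t ! b) = j")
              case True then show ?thesis using z[OF b] by simp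
            next
              case False
              then show ?thesis using k b by (simp add: kern_def gpart_def t'_nth)
            qed
            then show ?thesis
              using k \<open>card F = 0\<close> by (simp add: graded_def gpart_def kern_def len)
          qed
          show "F \<subseteq> V \<and> card F = 0" if "c F \<noteq> 0" using that md.chainD(2,3)[OF c(1)] True by blast
        qed
        moreover have "md.vanishes (graded (free t') j) 0"
        proof (rule vanishes_free, rule disjI2, rule notI)
          assume "j \<in> int ` set t'"
          then obtain d' where d': "j = int d'" "d' \<in> set t'" by (rule imageE)
          then obtain b where b: "b < length t" "t' ! b = d'" by (metis in_set_conv_nth len)
          have "int (t' ! b) \<noteq> j" by (cases "int (t ! b) = j") (simp_all add: t'_nth[OF b(1)])
          then show False using b(2) d'(1) by simp
        qed
        ultimately obtain b where b: "md.chain (graded (free t') j) (Suc 0) b" "md.kd b = c"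
          using c(2) md.vanishesD by blast
        have "md.chain (graded (free t) j) (Suc 0) b"
        proof (rule md.chainI)
          fix F
          show "b F \<in> graded (free t) j F"
          proof (cases "b F = 0")
            case True
            then show ?thesis using md.coeffsD(1)[OF coeffs_graded[OF free_module_graded]] by simp
          next
            case bF: False
            then have F: "card F = 1" using md.chainD(3)[OF b(1)] by simp
            have bt: "b F \<in> free t' (j - 1)" using md.chainD(1)[OF b(1), of F] F by (simp add: graded_def)
            have "b F a \<in> homogeneous V (j - 1 - int (t ! a))" if a: "a < length t" for a
            proof -
              have bta: "b F a \<in> homogeneous V (j - 1 - int (t' ! a))"
                using bt a by (simp add: gpart_def len)
              show ?thesis
              proof (cases "int (t ! a) = j")
                case True
                \<comment> \<open>At a moved generator the bounding chain would have degree (j - 1)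
                  - (j + 1). It is therefore 0 there and belongs to the original free
                  module.\<close>
                then have "b F a \<in> homogeneous V (- 2)" using bta by (simp add: t'_nth[OF a])
                then show ?thesis using homogeneous_neg[of "- 2" "b F a" V] by simp
              next
                case False
                then show ?thesis using bta by (simp add: t'_nth[OF a])
              qed
            qed
            then show ?thesis using bt F by (simp add: graded_def gpart_def len)
          qed
          show "F \<subseteq> V \<and> card F = Suc 0" if "b F \<noteq> 0" using that md.chainD(2,3)[OF b(1)] by blast
        qed
        then show ?thesis using b(2) True by blast
      qed
    qed
  }
qed

lemma lookup_kd_zero: "lookup (md.kd b F a) 0 = 0"
  by (simp add: md.kd_def sum_fun_at lookup_sum signed_fun_apply lookup_signed vmul_def lookup_indet_times)

text \<open>Graded Nakayama: homology in degree 0 is \<open>M\<close> modulo the irrelevant ideal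
  times \<open>M\<close>, and it lives in the degrees of the minimal generators.\<close>

lemma vanishes_0_iff:
  assumes M: "graded_module M" and pr: "presents M t A" and min: "minimal_kern t A"
  shows "md.vanishes (graded M j) 0 \<longleftrightarrow> j \<notin> int ` set t"
proof
  note cF = coeffs_graded[OF free_module_graded]
  have surj: "mat_map A ` graded (free t) j F = graded M j F" for F
    using pr by (simp add: graded_def presents_def)
  {
    assume van: "md.vanishes (graded M j) 0"
    show "j \<notin> int ` set t"
    proof
      assume "j \<in> int ` set t"
      then obtain b where b: "b < length t" "int (t ! b) = j" by (auto simp: in_set_conv_nth)
      define u :: "nat \<Rightarrow> ('v, 'k) mpoly" where "u a = (if a = b then 1 else 0)" for a
      have u: "u \<in> free t j" using b by (auto simp: u_def gpart_def homogeneous_def)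
      define c where "c F = (if F = {} then mat_map A u else 0)" for F :: "'v set"
      have "mat_map A u \<in> M j" using pr u unfolding presents_def by blast
      then have "md.chain (graded M j) 0 c"
        using graded_moduleD(1)[OF M] by (intro md.chainI) (auto simp: c_def graded_def split: if_splits)
      moreover have "md.kd c F = 0" for F
        using md.mul_0 by (simp add: md.kd_def c_def)
      ultimately obtain b' where b': "md.chain (graded M j) (Suc 0) b'" "md.kd b' = c"
        using md.vanishesD[OF van] by blast
      obtain b'' where b'': "md.chain (graded (free t) j) (Suc 0) b''" "\<forall>F. mat_map A (b'' F) = b' F"
        using md.lift_chain[OF surj cF mat_map_0 b'(1)] by blast
      \<comment> \<open>A relation of degree j with constant coefficient 1 at a generator of degree
        j, because boundaries have no constant terms; this contradicts minimality.\<close>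
      define z where "z = u - md.kd b'' {}"
      have kd: "md.kd b'' {} \<in> free t j"
        using md.chainD(1)[OF md.chain_kd[OF cF b''(1)], of "{}"] by (simp add: graded_def)
      have "mat_map A (md.kd b'' {}) = md.kd (\<lambda>F. mat_map A (b'' F)) {}"
        by (rule md.kd_hom[OF mat_map_add mat_map_vmul, symmetric])
      also have "\<dots> = mat_map A u" using b''(2) b'(2) by (simp add: c_def)
      finally have "mat_map A z = 0" unfolding z_def mat_map_diff by simp
      moreover have "z \<in> free t j"
        unfolding z_def diff_conv_add_uminus
        by (intro graded_moduleD(2,3)[OF free_module_graded] u kd)
      ultimately have "z b = 0" using min b unfolding minimal_kern_def kern_def by blast
      moreover have "lookup (z b) 0 = 1"
        by (simp add: z_def u_def lookup_minus lookup_kd_zero)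
      ultimately show False by simp
    qed
  next
    assume j: "j \<notin> int ` set t"
    show "md.vanishes (graded M j) 0"
      unfolding md.vanishes_def
    proof (intro allI impI)
      fix c assume c: "md.chain (graded M j) 0 c" "\<forall>F. md.kd c F = 0"
      obtain c' where c': "md.chain (graded (free t) j) 0 c'" "\<forall>F. mat_map A (c' F) = c F"
        using md.lift_chain[OF surj cF mat_map_0 c(1)] by blast
      have "md.kd c' F = 0" for F
        using md.kd_nonzero(2)[of c' F 0] md.chainD(2,3)[OF c'(1)] by auto
      then obtain b where b: "md.chain (graded (free t) j) (Suc 0) b" "md.kd b = c'"
        using md.vanishesD[OF vanishes_free c'(1)] j by blast
      have "md.chain (graded M j) (Suc 0) (\<lambda>F. mat_map A (b F))"
      proof (rule md.chainI)
        show "mat_map A (b F) \<in> graded M j F" for F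
          using md.chainD(1)[OF b(1), of F] surj by blast
        show "F \<subseteq> V \<and> card F = Suc 0" if "mat_map A (b F) \<noteq> 0" for F
        proof -
          have "b F \<noteq> 0" using that mat_map_0 by metis
          then show ?thesis using md.chainD(2,3)[OF b(1)] by blast
        qed
      qed
      moreover have "md.kd (\<lambda>F. mat_map A (b F)) = c"
      proof
        fix F
        have "md.kd (\<lambda>F. mat_map A (b F)) F = mat_map A (md.kd b F)"
          by (rule md.kd_hom[OF mat_map_add mat_map_vmul])
        then show "md.kd (\<lambda>F. mat_map A (b F)) F = c F"
          unfolding b(2) using c'(2) by simp
      qed
      ultimately show "\<exists>b. md.chain (graded M j) (Suc 0) b \<and> md.kd b = c" by blast
    qed
  }
qed

lemma vanishes_0_decomp:
  assumes M: "graded_module M" and van: "md.vanishes (graded M j) 0" and f: "f \<in> M j"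
  obtains g where "\<forall>x\<in>V. g x \<in> M (j - 1)" "f = (\<Sum>x\<in>V. vmul x (g x))"
proof -
  define c where "c F = (if F = {} then f else 0)" for F :: "'v set"
  have "md.chain (graded M j) 0 c"
    using f graded_moduleD(1)[OF M] by (intro md.chainI) (auto simp: c_def graded_def split: if_splits)
  moreover have "md.kd c F = 0" for F
    using md.mul_0 by (simp add: md.kd_def c_def)
  ultimately obtain b where b: "md.chain (graded M j) (Suc 0) b" "md.kd b = c"
    using md.vanishesD[OF van] by blast
  have "f = md.kd b {}" by (simp add: b(2) c_def)
  also have "\<dots> = (\<Sum>x\<in>V. vmul x (b {x}))"
    by (simp add: md.kd_def kpar_def signed_def)
  finally have "f = (\<Sum>x\<in>V. vmul x (b {x}))" .
  moreover have "b {x} \<in> M (j - 1)" for x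
    using md.chainD(1)[OF b(1), of "{x}"] by (simp add: graded_def)
  ultimately show ?thesis using that[of "\<lambda>x. b {x}"] by blast
qed

subsection \<open>Existence of minimal presentations\<close>

definition scale_closed :: "(int \<Rightarrow> (nat \<Rightarrow> ('v, 'k) mpoly) set) \<Rightarrow> bool" where
  "scale_closed M \<longleftrightarrow> (\<forall>j c. \<forall>f\<in>M j. scale c f \<in> M j)"

lemma module_mult:
  assumes M: "graded_module M" "scale_closed M" and p: "p \<in> homogeneous V u" and f: "f \<in> M j"
  shows "(\<lambda>a. p * f a) \<in> M (j + u)"
proof -
  have mono: "(\<lambda>a. single e 1 * f a) \<in> M (j + int (mdeg e))" if "keys e \<subseteq> V" for e
    using that
  proof (induction "mdeg e" arbitrary: e)
    case 0
    then have e: "e = 0" using mdeg_eq_0_iff by metis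
    show ?case using f by (simp add: e)
  next
    case (Suc n)
    then obtain x where x: "x \<in> keys e"
      by (metis keys_eq_empty ex_in_conv mdeg_zero nat.distinct(1))
    define e' where "e' = e - single x 1"
    have "lookup (single x 1) y \<le> lookup e y" for y
      using x by (auto simp: lookup_single when_def in_keys_iff)
    then have e: "e = single x 1 + e'"
      unfolding e'_def by (rule monomial_diff_add[symmetric])
    then have d: "mdeg e = Suc (mdeg e')" by (simp add: mdeg_add)
    have "keys e' \<subseteq> V" using Suc.prems e by (auto simp: keys_add_monomial)
    then have "(\<lambda>a. single e' 1 * f a) \<in> M (j + int (mdeg e'))"
      using Suc.hyps d by simp
    then have "vmul x (\<lambda>a. single e' 1 * f a) \<in> M (j + int (mdeg e') + 1)"
      using x Suc.prems by (intro graded_moduleD(4)[OF M(1)]) auto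
    moreover have "vmul x (\<lambda>a. single e' 1 * f a) = (\<lambda>a. single e 1 * f a)"
      by (rule ext) (simp add: vmul_def indet_def e mult.assoc[symmetric] mult_single)
    ultimately show ?case by (simp add: d ac_simps)
  qed
  have eq: "(\<lambda>a. p * f a) = (\<Sum>e\<in>keys p. scale (lookup p e) (\<lambda>a. single e 1 * f a))"
  proof
    fix a
    have "p * f a = (\<Sum>e\<in>keys p. single e (lookup p e)) * f a"
      using poly_sum_monomials[of p] by simp
    then show "p * f a = (\<Sum>e\<in>keys p. scale (lookup p e) (\<lambda>a. single e 1 * f a)) a"
      by (simp add: sum_fun_at scale_def sum_distrib_right mult.assoc[symmetric] mult_single)
  qed
  have "scale (lookup p e) (\<lambda>a. single e 1 * f a) \<in> M (j + u)" if "e \<in> keys p" for e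
  proof -
    have "keys e \<subseteq> V" "int (mdeg e) = u" using p that by (auto simp: homogeneous_def)
    then show ?thesis using mono[of e] M(2) unfolding scale_closed_def by auto
  qed
  then show ?thesis unfolding eq by (rule graded_module_sum[OF M(1)])
qed

lemma vector_space_scale: "Vector_Spaces.vector_space (scale :: 'k \<Rightarrow> (nat \<Rightarrow> ('v, 'k) mpoly) \<Rightarrow> _)"
proof (rule Vector_Spaces.vector_space.intro)
  fix a b :: 'k and f g :: "nat \<Rightarrow> ('v, 'k) mpoly"
  show "scale a (f + g) = scale a f + scale a g"
    by (rule ext) (simp add: scale_def distrib_left)
  show "scale (a + b) f = scale a f + scale b f"
    by (rule ext) (simp add: scale_def single_add distrib_right)
  show "scale a (scale b f) = scale (a * b) f"
    by (rule ext) (simp add: scale_def mult.assoc[symmetric] mult_single)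
  show "scale 1 f = f" by (rule ext) (simp add: scale_def)
qed

lemma finite_basis_gpart:
  assumes "N \<subseteq> free s j"
  obtains B where "B \<subseteq> N" "finite B" "N \<subseteq> Modules.module.span scale B"
proof -
  interpret vs: Vector_Spaces.vector_space "scale :: 'k \<Rightarrow> (nat \<Rightarrow> ('v, 'k) mpoly) \<Rightarrow> _"
    by (rule vector_space_scale)
  define u :: "nat \<Rightarrow> 'v monomial \<Rightarrow> nat \<Rightarrow> ('v, 'k) mpoly" where
    "u a e = (\<lambda>a'. if a' = a then single e 1 else 0)" for a e
  define T where "T = (\<lambda>(a, e). u a e) ` (SIGMA a:{..<length s}. {e. keys e \<subseteq> V \<and> mdeg e = nat (j - int (s ! a))})"
  have "finite T" unfolding T_def using finite_monomials[OF fin] by (intro finite_imageI finite_SigmaI) auto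
  have "f \<in> vs.span T" if f: "f \<in> free s j" for f
  proof -
    have "f = (\<Sum>a<length s. \<Sum>e\<in>keys (f a). scale (lookup (f a) e) (u a e))"
    proof
      fix a'
      have "(\<Sum>a<length s. \<Sum>e\<in>keys (f a). scale (lookup (f a) e) (u a e)) a' =
          (\<Sum>a<length s. if a = a' then f a else 0)"
        unfolding sum_fun_at
      proof (intro sum.cong refl)
        fix a
        show "(\<Sum>e\<in>keys (f a). scale (lookup (f a) e) (u a e) a') = (if a = a' then f a else 0)"
          using poly_sum_monomials[of "f a'", symmetric] by (auto simp: scale_def u_def mult_single)
      qed
      also have "\<dots> = f a'" using f by (simp add: gpart_def)
      finally show "f a' = (\<Sum>a<length s. \<Sum>e\<in>keys (f a). scale (lookup (f a) e) (u a e)) a'" ..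
    qed
    also have "\<dots> \<in> vs.span T"
    proof (intro vs.span_sum vs.span_scale vs.span_base)
      fix a e assume ae: "a \<in> {..<length s}" "e \<in> keys (f a)"
      then have "keys e \<subseteq> V" "int (mdeg e) = j - int (s ! a)"
        using f by (auto simp: gpart_def homogeneous_def)
      moreover from this(2) have "mdeg e = nat (j - int (s ! a))" by linarith
      ultimately show "u a e \<in> T"
        using ae unfolding T_def by (intro image_eqI[of _ _ "(a, e)"]) auto
    qed
    finally show ?thesis .
  qed
  then have span: "N \<subseteq> vs.span T" using assms by blast
  obtain B where B: "B \<subseteq> N" "vs.independent B" "N \<subseteq> vs.span B"
    using vs.maximal_independent_subset[of N] by blast
  have "finite B" using vs.independent_span_bound[OF \<open>finite T\<close> B(2)] B(1) span by blast
  then show ?thesis using B that by blast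
qed

text \<open>The degree \<open>j\<close> part of the submodule generated by \<Gamma>. Generators
  carry their degree along, since the zero vector does not determine one.\<close>

definition hspan :: "(nat \<times> (nat \<Rightarrow> ('v, 'k) mpoly)) set \<Rightarrow> int \<Rightarrow> (nat \<Rightarrow> ('v, 'k) mpoly) set" where
  "hspan \<Gamma> j = {(\<lambda>a. \<Sum>\<gamma>\<in>\<Gamma>. h \<gamma> * snd \<gamma> a) | h. \<forall>\<gamma>\<in>\<Gamma>. h \<gamma> \<in> homogeneous V (j - int (fst \<gamma>))}"

lemma hspanI:
  assumes "\<And>\<gamma>. \<gamma> \<in> \<Gamma> \<Longrightarrow> h \<gamma> \<in> homogeneous V (j - int (fst \<gamma>))" "\<And>a. f a = (\<Sum>\<gamma>\<in>\<Gamma>. h \<gamma> * snd \<gamma> a)"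
  shows "f \<in> hspan \<Gamma> j"
  using assms unfolding hspan_def by blast

lemma hspanE:
  assumes "f \<in> hspan \<Gamma> j"
  obtains h where "\<forall>\<gamma>\<in>\<Gamma>. h \<gamma> \<in> homogeneous V (j - int (fst \<gamma>))" "\<forall>a. f a = (\<Sum>\<gamma>\<in>\<Gamma>. h \<gamma> * snd \<gamma> a)"
  using assms unfolding hspan_def by auto

lemma hspan_zero: "0 \<in> hspan \<Gamma> j"
  by (rule hspanI[where h = "\<lambda>_. 0"]) simp_all

lemma hspan_add:
  assumes "f \<in> hspan \<Gamma> j" "g \<in> hspan \<Gamma> j" shows "f + g \<in> hspan \<Gamma> j"
proof -
  obtain h where "\<forall>\<gamma>\<in>\<Gamma>. h \<gamma> \<in> homogeneous V (j - int (fst \<gamma>))" "\<forall>a. f a = (\<Sum>\<gamma>\<in>\<Gamma>. h \<gamma> * snd \<gamma> a)"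
    by (rule hspanE[OF assms(1)])
  moreover obtain k where "\<forall>\<gamma>\<in>\<Gamma>. k \<gamma> \<in> homogeneous V (j - int (fst \<gamma>))" "\<forall>a. g a = (\<Sum>\<gamma>\<in>\<Gamma>. k \<gamma> * snd \<gamma> a)"
    by (rule hspanE[OF assms(2)])
  ultimately show ?thesis
    by (intro hspanI[where h = "\<lambda>\<gamma>. h \<gamma> + k \<gamma>"]) (simp_all add: homogeneous_add distrib_right sum.distrib)
qed

lemma hspan_sum: "(\<And>i. i \<in> I \<Longrightarrow> f i \<in> hspan \<Gamma> j) \<Longrightarrow> sum f I \<in> hspan \<Gamma> j"
proof (induction I rule: infinite_finite_induct)
  case (insert x F)
  then show ?case unfolding sum.insert[OF insert.hyps] by (intro hspan_add) auto
qed (simp_all only: sum.infinite sum.empty hspan_zero not_False_eq_True)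

lemma hspan_mult:
  assumes "f \<in> hspan \<Gamma> j" "p \<in> homogeneous V u" shows "(\<lambda>a. p * f a) \<in> hspan \<Gamma> (j + u)"
proof -
  obtain h where h': "\<forall>\<gamma>\<in>\<Gamma>. h \<gamma> \<in> homogeneous V (j - int (fst \<gamma>))" "\<forall>a. f a = (\<Sum>\<gamma>\<in>\<Gamma>. h \<gamma> * snd \<gamma> a)"
    by (rule hspanE[OF assms(1)])
  note h = bspec[OF h'(1)] spec[OF h'(2)]
  show ?thesis
  proof (rule hspanI[where h = "\<lambda>\<gamma>. p * h \<gamma>"])
    show "p * h \<gamma> \<in> homogeneous V (j + u - int (fst \<gamma>))" if "\<gamma> \<in> \<Gamma>" for \<gamma>
      using homogeneous_mult[OF assms(2) h(1)[OF that]] by (simp add: algebra_simps)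
  qed (simp add: h(2) sum_distrib_left mult.assoc)
qed

lemma hspan_scale: "f \<in> hspan \<Gamma> j \<Longrightarrow> scale c f \<in> hspan \<Gamma> j"
  using hspan_mult[of f \<Gamma> j "single 0 c" 0]
  by (auto simp: scale_def homogeneous_def split: if_splits)

lemma hspan_vmul: "f \<in> hspan \<Gamma> j \<Longrightarrow> x \<in> V \<Longrightarrow> vmul x f \<in> hspan \<Gamma> (j + 1)"
  unfolding vmul_def by (rule hspan_mult[OF _ homogeneous_indet])

lemma hspan_self:
  assumes "finite \<Gamma>" "\<gamma> \<in> \<Gamma>" shows "snd \<gamma> \<in> hspan \<Gamma> (int (fst \<gamma>))"
proof (rule hspanI[where h = "\<lambda>\<delta>. if \<delta> = \<gamma> then 1 else 0"])
  fix a
  have "(\<Sum>\<delta>\<in>\<Gamma>. (if \<delta> = \<gamma> then 1 else 0) * snd \<delta> a) = (\<Sum>\<delta>\<in>\<Gamma>. if \<delta> = \<gamma> then snd \<delta> a else 0)"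
    by (intro sum.cong refl) simp
  then show "snd \<gamma> a = (\<Sum>\<delta>\<in>\<Gamma>. (if \<delta> = \<gamma> then 1 else 0) * snd \<delta> a)"
    using assms by simp
qed (auto simp: homogeneous_def)

definition generates :: "(nat \<times> (nat \<Rightarrow> ('v, 'k) mpoly)) set \<Rightarrow> (int \<Rightarrow> (nat \<Rightarrow> ('v, 'k) mpoly) set) \<Rightarrow> bool" where
  "generates \<Gamma> M \<longleftrightarrow> finite \<Gamma> \<and> (\<forall>\<gamma>\<in>\<Gamma>. snd \<gamma> \<in> M (int (fst \<gamma>))) \<and> (\<forall>j. M j \<subseteq> hspan \<Gamma> j)"

text \<open>Above degree \<open>r\<close> every element is a combination of variables times elements
  of lower degree by \<open>vanishes_0_decomp\<close>. Hence bases of the finitely many parts up to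
  \<open>r\<close> generate, without a Noetherian argument.\<close>

lemma ex_generates:
  assumes M: "graded_module M" and sub: "\<And>j. M j \<subseteq> free s j"
    and van: "\<And>j. r < j \<Longrightarrow> md.vanishes (graded M j) 0"
  obtains \<Gamma> where "generates \<Gamma> M"
proof -
  interpret vs: Vector_Spaces.vector_space "scale :: 'k \<Rightarrow> (nat \<Rightarrow> ('v, 'k) mpoly) \<Rightarrow> _"
    by (rule vector_space_scale)
  have "\<forall>n. \<exists>B. B \<subseteq> M (int n) \<and> finite B \<and> M (int n) \<subseteq> vs.span B"
    using finite_basis_gpart[OF sub] by metis
  then obtain B where B: "\<And>n. B n \<subseteq> M (int n)" "\<And>n. finite (B n)" "\<And>n. M (int n) \<subseteq> vs.span (B n)"
    by metis
  define \<Gamma> where "\<Gamma> = (SIGMA n:{..nat r}. B n)"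
  have fG: "finite \<Gamma>" unfolding \<Gamma>_def using B(2) by (intro finite_SigmaI) auto
  have nat: "M (int n) \<subseteq> hspan \<Gamma> (int n)" for n
  proof (induction n rule: less_induct)
    case (less n)
    show ?case
    proof (cases "n \<le> nat r")
      case True
      have "vs.subspace (hspan \<Gamma> (int n))"
        by (rule vs.subspaceI) (rule hspan_zero, erule (1) hspan_add, erule hspan_scale)
      moreover have "B n \<subseteq> hspan \<Gamma> (int n)"
      proof
        fix g assume "g \<in> B n"
        then have "(n, g) \<in> \<Gamma>" using True by (simp add: \<Gamma>_def)
        then show "g \<in> hspan \<Gamma> (int n)" using hspan_self[OF fG, of "(n, g)"] by simp
      qed
      ultimately show ?thesis using B(3)[of n] vs.span_minimal by blast
    next
      case False
      then obtain n' where n': "n = Suc n'" by (cases n) auto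
      show ?thesis
      proof
        fix f assume f: "f \<in> M (int n)"
        have "r < int n" using False by linarith
        then obtain g where g: "\<forall>x\<in>V. g x \<in> M (int n - 1)" "f = (\<Sum>x\<in>V. vmul x (g x))"
          using vanishes_0_decomp[OF M van f] by blast
        have "vmul x (g x) \<in> hspan \<Gamma> (int n)" if "x \<in> V" for x
        proof -
          have "g x \<in> hspan \<Gamma> (int n')" using g(1) that less[of n'] n' by auto
          then show ?thesis using hspan_vmul[of "g x" \<Gamma> "int n'" x] that n' by (simp add: add.commute)
        qed
        then show "f \<in> hspan \<Gamma> (int n)" unfolding g(2) by (rule hspan_sum)
      qed
    qed
  qed
  have "M j \<subseteq> hspan \<Gamma> j" for j
  proof (cases "0 \<le> j")
    case True
    then show ?thesis using nat[of "nat j"] by simp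
  next
    case False
    have "f = 0" if "f \<in> M j" for f
    proof
      fix a
      have f: "f \<in> free s j" using sub that by blast
      show "f a = 0 a"
        using f homogeneous_neg[of "j - int (s ! a)" "f a" V] False
        by (cases "a < length s") (simp_all add: gpart_def)
    qed
    then show ?thesis using hspan_zero by blast
  qed
  moreover have "\<forall>\<gamma>\<in>\<Gamma>. snd \<gamma> \<in> M (int (fst \<gamma>))" using B(1) by (auto simp: \<Gamma>_def)
  ultimately show ?thesis using that fG unfolding generates_def by blast
qed

text \<open>A relation with an invertible coefficient allows to drop a generator.\<close>

lemma generates_minimal_relation:
  assumes gen: "generates \<Gamma> M" and min: "\<And>\<Gamma>'. generates \<Gamma>' M \<Longrightarrow> card \<Gamma> \<le> card \<Gamma>'"
    and k: "\<And>\<gamma>. \<gamma> \<in> \<Gamma> \<Longrightarrow> k \<gamma> \<in> homogeneous V (j - int (fst \<gamma>))"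
    and rel: "\<And>a. (\<Sum>\<gamma>\<in>\<Gamma>. k \<gamma> * snd \<gamma> a) = 0"
    and g0: "\<gamma>0 \<in> \<Gamma>" "int (fst \<gamma>0) = j"
  shows "k \<gamma>0 = 0"
proof (rule ccontr)
  assume nz: "k \<gamma>0 \<noteq> 0"
  define c where "c = lookup (k \<gamma>0) 0"
  have kc: "k \<gamma>0 = single 0 c"
    unfolding c_def by (rule homogeneous_const[where V = V]) (use k[OF g0(1)] g0(2) in simp)
  then have c0: "c \<noteq> 0" using nz by auto
  have fG: "finite \<Gamma>" using gen by (simp add: generates_def)
  let ?\<Gamma>' = "\<Gamma> - {\<gamma>0}"
  have "generates ?\<Gamma>' M"
    unfolding generates_def
  proof (intro conjI allI subsetI)
    fix i f assume "f \<in> M i"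
    then have fG': "f \<in> hspan \<Gamma> i" using gen unfolding generates_def by blast
    obtain h where h': "\<forall>\<gamma>\<in>\<Gamma>. h \<gamma> \<in> homogeneous V (i - int (fst \<gamma>))" "\<forall>a. f a = (\<Sum>\<gamma>\<in>\<Gamma>. h \<gamma> * snd \<gamma> a)"
      by (rule hspanE[OF fG'])
    note h = bspec[OF h'(1)] spec[OF h'(2)]
    \<comment> \<open>Subtracting \<open>q\<close> times the relation cancels the coefficient of
      \<open>\<gamma>0\<close>.\<close>
    define q where "q = h \<gamma>0 * single 0 (inverse c)"
    have q: "q \<in> homogeneous V (i - j)"
      using homogeneous_mult[OF h(1)[OF g0(1)], of "single 0 (inverse c)" 0] g0(2)
      by (auto simp: q_def homogeneous_def)
    have qk: "q * k \<gamma>0 = h \<gamma>0"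
      using c0 by (simp add: q_def kc mult.assoc mult_single)
    show "f \<in> hspan ?\<Gamma>' i"
    proof (rule hspanI[where h = "\<lambda>\<gamma>. h \<gamma> - q * k \<gamma>"])
      fix \<gamma> assume "\<gamma> \<in> ?\<Gamma>'"
      then have "\<gamma> \<in> \<Gamma>" by simp
      then show "h \<gamma> - q * k \<gamma> \<in> homogeneous V (i - int (fst \<gamma>))"
        using h(1) homogeneous_mult[OF q k[of \<gamma>]] by (intro homogeneous_diff) simp_all
    next
      fix a
      have "f a = (\<Sum>\<gamma>\<in>\<Gamma>. h \<gamma> * snd \<gamma> a) - q * (\<Sum>\<gamma>\<in>\<Gamma>. k \<gamma> * snd \<gamma> a)"
        by (simp add: rel h(2))
      also have "\<dots> = (\<Sum>\<gamma>\<in>\<Gamma>. (h \<gamma> - q * k \<gamma>) * snd \<gamma> a)"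
        by (simp add: left_diff_distrib sum_subtractf sum_distrib_left mult.assoc)
      also have "\<dots> = (\<Sum>\<gamma>\<in>?\<Gamma>'. (h \<gamma> - q * k \<gamma>) * snd \<gamma> a)"
        unfolding sum.remove[OF fG g0(1)] by (simp add: qk)
      finally show "f a = (\<Sum>\<gamma>\<in>?\<Gamma>'. (h \<gamma> - q * k \<gamma>) * snd \<gamma> a)" .
    qed
  qed (use gen in \<open>auto simp: generates_def\<close>)
  moreover have "card ?\<Gamma>' < card \<Gamma>" by (rule card_Diff1_less[OF fG g0(1)])
  ultimately show False using min by force
qed

text \<open>The generators are taken in least possible number, so that
  \<open>generates_minimal_relation\<close> excludes invertible coefficients in relations.\<close>

lemma ex_minimal_presentation:
  assumes M: "graded_module M" "scale_closed M" and sub: "\<And>j. M j \<subseteq> free s j"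
    and van: "\<And>j. r < j \<Longrightarrow> md.vanishes (graded M j) 0"
  obtains t A where "graded_matrix V s t A" "presents M t A" "minimal_kern t A"
proof -
  obtain \<Gamma>0 where "generates \<Gamma>0 M" using ex_generates[OF M(1) sub van] by blast
  then obtain \<Gamma> where gen: "generates \<Gamma> M" and min: "\<And>\<Gamma>'. generates \<Gamma>' M \<Longrightarrow> card \<Gamma> \<le> card \<Gamma>'"
    using ex_has_least_nat[of "\<lambda>\<Gamma>. generates \<Gamma> M" \<Gamma>0 card] by blast
  have fG: "finite \<Gamma>" using gen by (simp add: generates_def)
  obtain xs where xs: "set xs = \<Gamma>" "distinct xs" using finite_distinct_list[OF fG] by blast
  define n where "n = length xs"
  have bij: "bij_betw ((!) xs) {..<n} \<Gamma>" using bij_betw_nth[OF xs(2)] xs(1) n_def by blast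
  define t where "t = map fst xs"
  define A where "A = mat (length s) n (\<lambda>(a, b). snd (xs ! b) a)"
  have len: "length t = n" by (simp add: t_def n_def)
  have xsM: "snd (xs ! b) \<in> M (int (fst (xs ! b)))" if "b < n" for b
    using gen that xs(1) nth_mem[of b xs] by (auto simp: generates_def n_def)
  have t_nth: "t ! b = fst (xs ! b)" if "b < n" for b using that by (simp add: t_def n_def)
  have xsF: "snd (xs ! b) \<in> free s (int (t ! b))" if "b < n" for b
    using xsM[OF that] sub t_nth[OF that] by auto
  have map_A: "mat_map A f a = (\<Sum>b<n. f b * snd (xs ! b) a)" for f a
  proof (cases "a < length s")
    case True
    then show ?thesis by (simp add: mat_map_def A_def mult.commute)
  next
    case False
    have "snd (xs ! b) a = 0" if "b < n" for b
      using xsF[OF that] False by (simp add: gpart_def)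
    then show ?thesis using False by (simp add: mat_map_def A_def)
  qed
  have "graded_matrix V s t A"
    unfolding graded_matrix_def
  proof (intro conjI allI impI)
    show "A \<in> carrier_mat (length s) (length t)" by (simp add: A_def len)
    fix a b assume ab: "a < length s" "b < length t"
    have h: "A $$ (a, b) \<in> homogeneous V (int (t ! b) - int (s ! a))"
      using xsF[of b] ab len by (simp add: A_def gpart_def)
    then show "A $$ (a, b) \<in> carrier (poly_ring V)" by (rule homogeneous_carrier)
    show "\<forall>e\<in>keys (A $$ (a, b)). mdeg e + s ! a = t ! b"
      using h by (fastforce simp: homogeneous_def)
  qed
  moreover have "presents M t A"
    unfolding presents_def
  proof (intro allI equalityI subsetI)
    fix j f assume "f \<in> mat_map A ` free t j"
    then obtain v where v: "v \<in> free t j" "f = mat_map A v" by blast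
    have eq: "f = (\<Sum>b<n. (\<lambda>a. v b * snd (xs ! b) a))"
      by (rule ext) (simp add: v(2) map_A sum_fun_at)
    have "(\<lambda>a. v b * snd (xs ! b) a) \<in> M j" if "b < n" for b
      using module_mult[OF M, of "v b" "j - int (t ! b)" "snd (xs ! b)" "int (t ! b)"] xsM[OF that] v(1) that
      by (simp add: t_nth gpart_def len)
    then show "f \<in> M j" unfolding eq by (intro graded_module_sum[OF M(1)]) simp
  next
    fix j f assume "f \<in> M j"
    then have fG': "f \<in> hspan \<Gamma> j" using gen unfolding generates_def by blast
    obtain h where h': "\<forall>\<gamma>\<in>\<Gamma>. h \<gamma> \<in> homogeneous V (j - int (fst \<gamma>))" "\<forall>a. f a = (\<Sum>\<gamma>\<in>\<Gamma>. h \<gamma> * snd \<gamma> a)"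
      by (rule hspanE[OF fG'])
    note h = bspec[OF h'(1)] spec[OF h'(2)]
    define v where "v b = (if b < n then h (xs ! b) else 0)" for b
    have "mat_map A v = f"
    proof
      fix a
      have "mat_map A v a = (\<Sum>b<n. h (xs ! b) * snd (xs ! b) a)"
        unfolding map_A by (intro sum.cong refl) (simp add: v_def)
      also have "\<dots> = f a"
        unfolding h(2) by (rule sum.reindex_bij_betw[OF bij])
      finally show "mat_map A v a = f a" .
    qed
    moreover have "v \<in> free t j"
      using h(1) xs(1) nth_mem[of _ xs] by (simp add: gpart_def v_def len t_nth n_def)
    ultimately show "f \<in> mat_map A ` free t j" by blast
  qed
  moreover have "minimal_kern t A"
    unfolding minimal_kern_def
  proof (intro allI ballI impI)
    fix j f b assume f: "f \<in> kern t A j" and b: "b < length t" "int (t ! b) = j"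
    define k where "k \<gamma> = f (the_inv_into {..<n} ((!) xs) \<gamma>)" for \<gamma>
    have k_nth: "k (xs ! i) = f i" if "i < n" for i
      using bij that unfolding k_def bij_betw_def by (simp add: the_inv_into_f_f)
    have "k (xs ! b) = 0"
    proof (rule generates_minimal_relation[OF gen min])
      fix \<gamma> assume "\<gamma> \<in> \<Gamma>"
      then obtain i where i: "i < n" "\<gamma> = xs ! i" using xs(1) by (auto simp: in_set_conv_nth n_def)
      then show "k \<gamma> \<in> homogeneous V (j - int (fst \<gamma>))"
        using f by (simp add: k_nth kern_def gpart_def len t_nth[symmetric])
    next
      fix a
      have "(\<Sum>\<gamma>\<in>\<Gamma>. k \<gamma> * snd \<gamma> a) = (\<Sum>i<n. k (xs ! i) * snd (xs ! i) a)"
        by (rule sum.reindex_bij_betw[OF bij, symmetric])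
      also have "\<dots> = mat_map A f a"
        unfolding map_A by (intro sum.cong refl) (simp add: k_nth)
      also have "\<dots> = 0" using f by (simp add: kern_def)
      finally show "(\<Sum>\<gamma>\<in>\<Gamma>. k \<gamma> * snd \<gamma> a) = 0" .
    next
      show "xs ! b \<in> \<Gamma>" using b(1) xs(1) by (auto simp: len n_def)
      show "int (fst (xs ! b)) = j" using b by (simp add: len t_nth)
    qed
    then show "f b = 0" using k_nth b(1) by (simp add: len)
  qed
  ultimately show ?thesis by (rule that)
qed

end

section \<open>Resolutions as sequences of minimal presentations\<close>

context squarefree_koszul
begin

lemma scale_closed_gpart: "scale_closed (gpart V U s)"
  unfolding scale_closed_def
proof (intro allI ballI)
  fix j c and f :: "nat \<Rightarrow> ('v, 'k) mpoly" assume f: "f \<in> gpart V U s j"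
  have k: "keys (single 0 c * p) \<subseteq> keys p" for p :: "('v, 'k) mpoly"
    by (auto simp: in_keys_iff lookup_single_times split: if_splits)
  have "single 0 c * f a \<in> homogeneous V (j - int (s ! a))" if "a < length s" for a
    using f that k[of "f a"] unfolding gpart_def homogeneous_def by blast
  moreover have "keys e \<in> U" if "a < length s" "e \<in> keys (single 0 c * f a)" for a e
    using f that k[of "f a"] unfolding gpart_def by blast
  ultimately show "scale c f \<in> gpart V U s j"
    using f by (simp add: gpart_def scale_def)
qed

lemma scale_closed_kern: "scale_closed (kern t A)"
proof -
  have "scale c (0 :: nat \<Rightarrow> ('v, 'k) mpoly) = 0" for c by (rule ext) (simp add: scale_def)
  then show ?thesis
    using scale_closed_gpart[of UNIV t] unfolding scale_closed_def kern_def by (auto simp: mat_map_scale)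
qed

lemma augmentation_presents:
  assumes U: "upset U" and A: "graded_matrix V [0] t A"
  shows "{(A *\<^sub>v v) $ 0 | v. v \<in> free_module V (length t)} = monomial_span V {e. keys e \<in> U} \<longleftrightarrow>
    presents (gpart V U [0]) t A"
proof -
  let ?J = "monomial_span V {e. keys e \<in> U} :: ('v, 'k) mpoly set"
  let ?M = "{f \<in> poly_vecs V 1. f 0 \<in> ?J}"
  have dims: "A \<in> carrier_mat 1 (length t)" using graded_matrix_dims(3)[OF A] by simp
  have "?J \<subseteq> carrier (poly_ring V)" by (auto simp: monomial_span_def)
  from augmentation_vec_fun[OF dims this]
  have "{(A *\<^sub>v v) $ 0 | v. v \<in> free_module V (length t)} = ?J \<longleftrightarrow>
      ?M = mat_map A ` poly_vecs V (length t)" .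
  also have "\<dots> \<longleftrightarrow> (\<forall>j. mat_map A ` gpart V UNIV t j = ?M \<inter> gpart V UNIV [0] j)"
  proof (rule image_graded_iff[OF A])
    show "?M \<subseteq> poly_vecs V (length [0::nat])" by auto
    show "0 \<in> ?M" by (simp add: poly_vecs_def monomial_span_def mem_carrier_poly_ring)
    fix f g :: "nat \<Rightarrow> ('v, 'k) mpoly" assume fg: "f \<in> ?M" "g \<in> ?M"
    have "f 0 + g 0 \<in> ?J"
      using fg keys_add[of "f 0" "g 0"] unfolding monomial_span_def mem_carrier_poly_ring by blast
    then show "f + g \<in> ?M" using fg poly_vecs_add[of f V 1 g] by simp
  next
    fix f :: "nat \<Rightarrow> ('v, 'k) mpoly" and j assume f: "f \<in> ?M"
    have "hcomp [0] j f \<in> poly_vecs V 1"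
      using f hcomp_gpart[of f V "[0]" j] gpart_poly_vecs[of V UNIV "[0]" j] by auto
    moreover have "keys (hpart j (f 0)) \<subseteq> keys (f 0)"
      by (auto simp: in_keys_iff lookup_hpart split: if_splits)
    then have "hpart j (f 0) \<in> ?J"
      using f unfolding monomial_span_def mem_carrier_poly_ring by blast
    ultimately show "hcomp [0] j f \<in> ?M" by (simp add: hcomp_def)
  qed
  also have "\<dots> \<longleftrightarrow> presents (gpart V U [0]) t A"
  proof -
    have "?M \<inter> gpart V UNIV [0] j = gpart V U [0] j" for j
    proof (intro equalityI subsetI)
      fix f :: "nat \<Rightarrow> ('v, 'k) mpoly" assume "f \<in> ?M \<inter> gpart V UNIV [0] j"
      then show "f \<in> gpart V U [0] j" by (auto simp: gpart_def monomial_span_def)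
    next
      fix f :: "nat \<Rightarrow> ('v, 'k) mpoly" assume f: "f \<in> gpart V U [0] j"
      then have "f 0 \<in> carrier (poly_ring V)" by (auto simp: gpart_def intro: homogeneous_carrier)
      then show "f \<in> ?M \<inter> gpart V UNIV [0] j"
        using f gpart_poly_vecs[of V U "[0]" j] by (auto simp: gpart_def monomial_span_def)
    qed
    then show ?thesis by (simp add: presents_def)
  qed
  finally show ?thesis .
qed

lemma exact_presents:
  assumes A: "graded_matrix V s t A" and A': "graded_matrix V t u A'"
  shows "mat_kernel A \<inter> free_module V (length t) = {A' *\<^sub>v v | v. v \<in> free_module V (length u)} \<longleftrightarrow>
    presents (kern t A) u A'"
proof -
  let ?M = "{f \<in> poly_vecs V (length t). mat_map A f = 0}"
  have "mat_kernel A \<inter> free_module V (length t) = {A' *\<^sub>v v | v. v \<in> free_module V (length u)} \<longleftrightarrow>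
      ?M = mat_map A' ` poly_vecs V (length u)"
    by (rule kernel_vec_fun[OF graded_matrix_dims(3)[OF A] graded_matrix_dims(3)[OF A']])
  also have "\<dots> \<longleftrightarrow> (\<forall>j. mat_map A' ` gpart V UNIV u j = ?M \<inter> gpart V UNIV t j)"
  proof (rule image_graded_iff[OF A'])
    show "?M \<subseteq> poly_vecs V (length t)" by blast
    show "0 \<in> ?M" using mat_map_0[of A] by (simp add: poly_vecs_def mem_carrier_poly_ring)
    show "f + g \<in> ?M" if "f \<in> ?M" "g \<in> ?M" for f g
      using that mat_map_add[of A f g] poly_vecs_add[of f V "length t" g] by simp
    show "hcomp t j f \<in> ?M" if "f \<in> ?M" for f j
    proof -
      have "hcomp t j f \<in> poly_vecs V (length t)"
        using that hcomp_gpart[of f V t j] gpart_poly_vecs[of V UNIV t j] by auto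
      moreover have "hcomp s j (0 :: nat \<Rightarrow> ('v, 'k) mpoly) = 0" by (rule ext) (simp add: hcomp_def)
      then have "mat_map A (hcomp t j f) = 0" using hcomp_mat_map[OF A, of j f] that by simp
      ultimately show ?thesis by blast
    qed
  qed
  also have "\<dots> \<longleftrightarrow> presents (kern t A) u A'"
  proof -
    have "?M \<inter> gpart V UNIV t j = kern t A j" for j
      using gpart_poly_vecs[of V UNIV t j] unfolding kern_def by blast
    then show ?thesis by (simp add: presents_def)
  qed
  finally show ?thesis .
qed

text \<open>The columns of \<open>A'\<close> generate the relations, so they have no constant terms
  iff no relation has one; a homogeneous entry can have a constant term only at a generator of the
  degree of the relation.\<close>

lemma irrelevant_iff_minimal:
  assumes A': "graded_matrix V t u A'" and pr: "presents (kern t A) u A'"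
  shows "(\<forall>a<length t. \<forall>b<length u. A' $$ (a, b) \<in> irrelevant_ideal V) \<longleftrightarrow> minimal_kern t A"
proof
  assume L: "\<forall>a<length t. \<forall>b<length u. A' $$ (a, b) \<in> irrelevant_ideal V"
  show "minimal_kern t A"
    unfolding minimal_kern_def
  proof (intro allI ballI impI)
    fix j f a assume f: "f \<in> kern t A j" and a: "a < length t" "int (t ! a) = j"
    then obtain v where v: "f = mat_map A' v" using pr unfolding presents_def by blast
    have "lookup (A' $$ (a, b) * v b) 0 = 0" if b: "b < length u" for b
    proof (rule ccontr)
      assume "lookup (A' $$ (a, b) * v b) 0 \<noteq> 0"
      then have "0 \<in> keys (A' $$ (a, b) * v b)" by (simp add: in_keys_iff)
      then obtain e e' where e: "e \<in> keys (A' $$ (a, b))" "0 = e + e'"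
        using keys_mult[of "A' $$ (a, b)" "v b"] by blast
      have "mdeg e = 0" using mdeg_add[of e e'] e(2) by simp
      then have "e = 0" by (simp add: mdeg_eq_0_iff)
      then show False using L a(1) b e(1) by (auto simp: irrelevant_ideal_eq monomial_span_def)
    qed
    then have "lookup (f a) 0 = 0"
      using a(1) by (simp add: v mat_map_def graded_matrix_dims[OF A'] lookup_sum)
    moreover have "f a \<in> homogeneous V 0" using f a by (auto simp: kern_def gpart_def)
    ultimately show "f a = 0" using homogeneous_const[of "f a" V] by simp
  qed
next
  assume R: "minimal_kern t A"
  show "\<forall>a<length t. \<forall>b<length u. A' $$ (a, b) \<in> irrelevant_ideal V"
  proof (intro allI impI)
    fix a b assume ab: "a < length t" "b < length u"
    define v :: "nat \<Rightarrow> ('v, 'k) mpoly" where "v i = (if i = b then 1 else 0)" for i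
    have v: "v \<in> free u (int (u ! b))" using ab by (auto simp: v_def gpart_def homogeneous_def)
    then have K: "mat_map A' v \<in> kern t A (int (u ! b))" using pr unfolding presents_def by blast
    have e: "mat_map A' v a = A' $$ (a, b)"
      using ab by (simp add: mat_map_def graded_matrix_dims[OF A'] v_def if_distrib cong: if_cong)
    have h: "A' $$ (a, b) \<in> homogeneous V (int (u ! b) - int (t ! a))"
      by (rule graded_matrix_entry[OF A' ab])
    have "0 \<notin> keys (A' $$ (a, b))"
    proof
      assume 0: "0 \<in> keys (A' $$ (a, b))"
      then have "int (u ! b) - int (t ! a) = 0" using h by (auto simp: homogeneous_def)
      then have "int (t ! a) = int (u ! b)" by simp
      then have "mat_map A' v a = 0"
        using R[unfolded minimal_kern_def, rule_format, OF K ab(1)] by blast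
      then have "A' $$ (a, b) = 0" by (simp only: e)
      then show False using 0 by simp
    qed
    then show "A' $$ (a, b) \<in> irrelevant_ideal V"
      using homogeneous_carrier[OF h] by (auto simp: irrelevant_ideal_eq monomial_span_def)
  qed
qed

text \<open>Counting the ideal itself as module 0, with \<open>target\<close> for the degrees of the
  codomain, treats the augmentation and the differentials alike.\<close>

fun syzygies :: "'v set set \<Rightarrow> (nat \<Rightarrow> nat list) \<Rightarrow> (nat \<Rightarrow> ('v, 'k) mpoly mat) \<Rightarrow> nat \<Rightarrow> int \<Rightarrow> (nat \<Rightarrow> ('v, 'k) mpoly) set" where
  "syzygies U d A 0 = gpart V U [0]"
| "syzygies U d A (Suc i) = kern (d i) (A i)"

definition target :: "(nat \<Rightarrow> nat list) \<Rightarrow> nat \<Rightarrow> nat list" where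
  "target d i = (case i of 0 \<Rightarrow> [0] | Suc i \<Rightarrow> d i)"

lemma resolution_iff:
  assumes U: "upset U"
  shows "minimal_graded_free_resolution V (monomial_span V {e. keys e \<in> U}) d A \<longleftrightarrow>
    (\<forall>i. graded_matrix V (target d i) (d i) (A i) \<and> presents (syzygies U d A i) (d i) (A i) \<and>
      minimal_kern (d i) (A i))"
    (is "?L \<longleftrightarrow> ?R")
proof
  assume L: ?L
  have g: "graded_matrix V (target d i) (d i) (A i)" for i
    using L by (cases i) (simp_all add: minimal_graded_free_resolution_def target_def)
  have p: "presents (syzygies U d A i) (d i) (A i)" for i
  proof (cases i)
    case 0
    then show ?thesis
      using L augmentation_presents[OF U, of "d 0" "A 0"] by (simp add: minimal_graded_free_resolution_def)
  next
    case (Suc n)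
    then show ?thesis
      using L exact_presents[OF g[of n], of "d (Suc n)" "A (Suc n)"]
      by (simp add: minimal_graded_free_resolution_def)
  qed
  have "minimal_kern (d i) (A i)" for i
  proof -
    have "graded_matrix V (d i) (d (Suc i)) (A (Suc i))" using g[of "Suc i"] by (simp add: target_def)
    moreover have "presents (kern (d i) (A i)) (d (Suc i)) (A (Suc i))" using p[of "Suc i"] by simp
    moreover have "\<forall>a<length (d i). \<forall>b<length (d (Suc i)). A (Suc i) $$ (a, b) \<in> irrelevant_ideal V"
      using L unfolding minimal_graded_free_resolution_def by blast
    ultimately show ?thesis using irrelevant_iff_minimal by blast
  qed
  then show ?R using g p by blast
next
  assume R: ?R
  then have g: "graded_matrix V (target d i) (d i) (A i)" and p: "presents (syzygies U d A i) (d i) (A i)"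
    and m: "minimal_kern (d i) (A i)" for i by auto
  have g0: "graded_matrix V [0] (d 0) (A 0)" using g[of 0] by (simp add: target_def)
  have gS: "graded_matrix V (d i) (d (Suc i)) (A (Suc i))" for i using g[of "Suc i"] by (simp add: target_def)
  have pS: "presents (kern (d i) (A i)) (d (Suc i)) (A (Suc i))" for i using p[of "Suc i"] by simp
  have "{(A 0 *\<^sub>v v) $ 0 | v. v \<in> free_module V (length (d 0))} = monomial_span V {e. keys e \<in> U}"
    using augmentation_presents[OF U g0] p[of 0] by simp
  moreover have "mat_kernel (A i) \<inter> free_module V (length (d i)) =
      {A (Suc i) *\<^sub>v v | v. v \<in> free_module V (length (d (Suc i)))}" for i
    using exact_presents[OF g[of i] gS[of i]] pS[of i] by blast
  moreover have "\<forall>a<length (d i). \<forall>b<length (d (Suc i)). A (Suc i) $$ (a, b) \<in> irrelevant_ideal V" for i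
    using irrelevant_iff_minimal[OF gS pS] m by blast
  ultimately show ?L unfolding minimal_graded_free_resolution_def using g0 gS by blast
qed

text \<open>Basis degrees at step i are the degrees where the i-th syzygy module has homology in
  degree 0; shifting i times makes this homology of the ideal in degree i. This holds for every
  minimal resolution, so the choice by \<open>SOME\<close> is harmless.\<close>

lemma resolution_degrees:
  assumes U: "upset U" and res: "minimal_graded_free_resolution V (monomial_span V {e. keys e \<in> U} :: ('v, 'k) mpoly set) d A"
  shows "j \<in> set (d i) \<longleftrightarrow> (\<exists>S\<subseteq>V. card S = j \<and> \<not> acyclic_at U S i)"
proof -
  have p: "presents (syzygies U d A i) (d i) (A i)" and m: "minimal_kern (d i) (A i)" for i
    using res unfolding resolution_iff[OF U] by auto
  have mod: "graded_module (syzygies U d A i)" for i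
    by (cases i) (simp_all add: gpart_module[OF U] kern_module)
  have "md.vanishes (graded (syzygies U d A i) j) p \<longleftrightarrow> md.vanishes (graded (gpart V U [0]) j) (p + i)" for i p j
  proof (induction i arbitrary: p)
    case (Suc i)
    then show ?case using vanishes_kern[OF mod p m, of i j p] by simp
  qed simp
  then have "md.vanishes (graded (gpart V U [0]) (int j)) i \<longleftrightarrow> int j \<notin> int ` set (d i)"
    using vanishes_0_iff[OF mod p m, of i "int j"] by (metis add_0)
  then show ?thesis unfolding vanishes_ideal[OF U] by (auto simp: image_iff)
qed

text \<open>Dependent choice of presentations. The invariant \<open>P\<close> includes a bound
  beyond which the homology of the kernel vanishes; it keeps finite generation available for the
  next step.\<close>

lemma ex_resolution:
  assumes U: "upset U" and reg: "reg_le V U r"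
  shows "\<exists>d A. minimal_graded_free_resolution V (monomial_span V {e. keys e \<in> U} :: ('v, 'k) mpoly set) d A"
proof -
  define P where "P n = (\<lambda>(s, t, A :: ('v, 'k) mpoly mat). graded_matrix V s t A \<and> minimal_kern t A \<and>
    (\<exists>r. \<forall>p j. r + int p < j \<longrightarrow> md.vanishes (graded (kern t A) j) p) \<and>
    (n = 0 \<longrightarrow> s = [0] \<and> presents (gpart V U [0]) t A))" for n :: nat
  define Q where "Q (n :: nat) = (\<lambda>(s :: nat list, t, A :: ('v, 'k) mpoly mat) (s', t', A'). s' = t \<and> presents (kern t A) t' A')" for n
  have "\<exists>x. P 0 x"
  proof -
    have van: "md.vanishes (graded (gpart V U [0]) j) p" if "r + int p < j" for j p
      unfolding vanishes_ideal[OF U] using reg_leD[OF reg] that by blast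
    have sub: "gpart V U [0] j \<subseteq> free [0] j" for j by (auto simp: gpart_def)
    have van0: "md.vanishes (graded (gpart V U [0]) j) 0" if "r < j" for j using van[of 0 j] that by simp
    obtain t A where tA: "graded_matrix V [0] t A" "presents (gpart V U [0]) t A" "minimal_kern t A"
      by (rule ex_minimal_presentation[OF gpart_module[OF U] scale_closed_gpart sub van0])
    \<comment> \<open>Degree p of the kernel corresponds to degree p + 1 of the ideal, which raises
      the bound by one.\<close>
    have "md.vanishes (graded (kern t A) j) p" if "(r + 1) + int p < j" for p j
      using vanishes_kern[OF gpart_module[OF U] tA(2,3)] van[of "Suc p" j] that by simp
    then have "P 0 ([0], t, A)" using tA unfolding P_def by auto
    then show ?thesis ..
  qed
  moreover have "\<exists>y. P (Suc n) y \<and> Q n x y" if Px: "P n x" for x n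
  proof -
    obtain s t A where x: "x = (s, t, A)" by (cases x) auto
    obtain r' where van: "md.vanishes (graded (kern t A) j) p" if "r' + int p < j" for j p
      using Px unfolding P_def x by auto
    have sub: "kern t A j \<subseteq> free t j" for j by (auto simp: kern_def)
    have van0: "md.vanishes (graded (kern t A) j) 0" if "r' < j" for j using van[of 0 j] that by simp
    obtain t' A' where tA: "graded_matrix V t t' A'" "presents (kern t A) t' A'" "minimal_kern t' A'"
      by (rule ex_minimal_presentation[OF kern_module scale_closed_kern sub van0])
    have "md.vanishes (graded (kern t' A') j) p" if "(r' + 1) + int p < j" for p j
      using vanishes_kern[OF kern_module tA(2,3)] van[of "Suc p" j] that by simp
    then have "P (Suc n) (t, t', A')" using tA unfolding P_def by auto
    then show ?thesis using tA(2) unfolding Q_def x by auto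
  qed
  ultimately obtain f where f: "\<And>n. P n (f n)" "\<And>n. Q n (f n) (f (Suc n))"
    using dependent_nat_choice[of P Q] by blast
  define d where "d n = fst (snd (f n))" for n
  define A where "A n = snd (snd (f n))" for n
  have fn: "f n = (fst (f n), d n, A n)" for n by (simp add: d_def A_def)
  have "fst (f n) = target d n" for n
  proof (cases n)
    case 0 then show ?thesis using f(1)[of 0] fn[of 0] unfolding P_def target_def by (auto split: prod.splits)
  next
    case (Suc i)
    then show ?thesis using f(2)[of i] fn[of i] unfolding Q_def target_def by (auto split: prod.splits)
  qed
  then have fn: "f n = (target d n, d n, A n)" for n using fn by metis
  have "presents (syzygies U d A n) (d n) (A n)" for n
  proof (cases n)
    case 0 then show ?thesis using f(1)[of 0] unfolding fn P_def by simp
  next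
    case (Suc i) then show ?thesis using f(2)[of i] unfolding fn Q_def by simp
  qed
  moreover have "graded_matrix V (target d n) (d n) (A n)" "minimal_kern (d n) (A n)" for n
    using f(1)[of n] unfolding fn P_def by auto
  ultimately show ?thesis unfolding resolution_iff[OF U] by blast
qed

section \<open>Betti numbers and regularity\<close>

lemma graded_betti_nonzero_iff:
  assumes U: "upset U" and reg: "reg_le V U r"
  shows "graded_betti V (monomial_span V {e. keys e \<in> U} :: ('v, 'k) mpoly set) i j \<noteq> 0 \<longleftrightarrow>
    (\<exists>S\<subseteq>V. card S = j \<and> \<not> acyclic_at U S i)"
proof -
  let ?J = "monomial_span V {e. keys e \<in> U} :: ('v, 'k) mpoly set"
  define x where "x = (SOME (d, A). minimal_graded_free_resolution V ?J d A)"
  have "\<exists>x. case x of (d, A) \<Rightarrow> minimal_graded_free_resolution V ?J d A"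
    using ex_resolution[OF U reg] by auto
  then have "case x of (d, A) \<Rightarrow> minimal_graded_free_resolution V ?J d A"
    unfolding x_def by (rule someI_ex)
  then have "minimal_graded_free_resolution V ?J (fst x) (snd x)" by (simp add: case_prod_beta)
  note deg = resolution_degrees[OF U this, of j i]
  have "graded_betti V ?J i j \<noteq> 0 \<longleftrightarrow> j \<in> set (fst x i)"
    by (simp add: graded_betti_def x_def count_list_0_iff)
  then show ?thesis unfolding deg .
qed

text \<open>Together with the upper bound, this confines the differences j - i to a finite range, so
  that the maximum in \<open>regularity\<close> is attained.\<close>

lemma acyclic_above_card: "upset U \<Longrightarrow> S \<subseteq> V \<Longrightarrow> card S < i \<Longrightarrow> acyclic_at U S i"
  unfolding acyclic_at_def
proof (rule sq.vanishes_trivial[OF coeffs_faces])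
  fix F :: "'v set" assume "S \<subseteq> V" "card S < i" "card F = i"
  then have "\<not> F \<subseteq> S" using card_mono[of S F] sq.finite_subset_V by auto
  then show "faces U S F \<subseteq> {0}" by (simp add: faces_def)
qed

lemma regularity_bounds:
  assumes U: "upset U" and reg: "reg_le V U r"
    and S: "S \<subseteq> V" "\<not> acyclic_at U S i"
  shows "int (card S) - int i \<le> regularity V (monomial_span V {e. keys e \<in> U} :: ('v, 'k) mpoly set)"
    "regularity V (monomial_span V {e. keys e \<in> U} :: ('v, 'k) mpoly set) \<le> r"
proof -
  let ?D = "{int j - int i | i j. graded_betti V (monomial_span V {e. keys e \<in> U} :: ('v, 'k) mpoly set) i j \<noteq> 0}"
  have D: "?D = {int (card S) - int i | S i. S \<subseteq> V \<and> \<not> acyclic_at U S i}"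
    unfolding graded_betti_nonzero_iff[OF U reg] by blast
  have bd: "0 \<le> int (card T) - int l \<and> int (card T) - int l \<le> r" if "T \<subseteq> V" "\<not> acyclic_at U T l" for T l
    using acyclic_above_card[OF U that(1), of l] reg_leD[OF reg that(1), of l] that(2) by fastforce
  then have "?D \<subseteq> {0..r}" unfolding D by auto
  then have fin: "finite ?D" using finite_subset by blast
  have mem: "int (card S) - int i \<in> ?D" unfolding D using S by blast
  show "int (card S) - int i \<le> regularity V (monomial_span V {e. keys e \<in> U} :: ('v, 'k) mpoly set)"
    unfolding regularity_def by (rule Max_ge[OF fin mem])
  have "Max ?D \<in> ?D" using Max_in[OF fin] mem by blast
  then show "regularity V (monomial_span V {e. keys e \<in> U} :: ('v, 'k) mpoly set) \<le> r"
    unfolding regularity_def using subsetD[OF \<open>?D \<subseteq> {0..r}\<close>] by (simp only: atLeastAtMost_iff)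
qed

end

section \<open>Square-free powers of edge ideals\<close>

text \<open>Exponents of the monomials divisible by a product of k edges, repetitions
  allowed.\<close>

fun edge_products :: "'v set set \<Rightarrow> nat \<Rightarrow> 'v monomial set" where
  "edge_products E 0 = UNIV"
| "edge_products E (Suc k) = {f + (single x 1 + single y 1) | f x y. {x, y} \<in> E \<and> f \<in> edge_products E k}"

lemma edge_products_add: "e \<in> edge_products E k \<Longrightarrow> e + f \<in> edge_products E k"
proof (induction k arbitrary: e f)
  case (Suc k)
  then obtain g x y where g: "e = g + (single x 1 + single y 1)" "{x, y} \<in> E" "g \<in> edge_products E k"
    by auto
  have "e + f = (g + f) + (single x 1 + single y 1)"
    unfolding g(1) by (simp only: ac_simps)
  then show ?case using Suc.IH[OF g(3), of f] g(2) by auto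
qed simp

text \<open>No variable occurs twice in a square-free monomial, so the edge split off shares no
  vertex with the remaining factor.\<close>

lemma squarefree_edge_products:
  assumes "squarefree_monomial e" "e \<in> edge_products E k"
  shows "keys e \<in> matched E k"
  using assms
proof (induction k arbitrary: e)
  case (Suc k)
  then obtain g x y where g: "e = g + (single x 1 + single y 1)" "{x, y} \<in> E" "g \<in> edge_products E k"
    by auto
  have le: "lookup g z + ((if x = z then 1 else 0) + (if y = z then 1 else 0)) \<le> 1" for z
  proof -
    have "lookup e z \<le> 1" using Suc.prems(1) by (simp add: squarefree_monomial_def)
    then show ?thesis by (simp only: g(1) lookup_add lookup_single when_def)
  qed
  have "lookup g z \<le> 1" for z using le[of z] by linarith
  then have "squarefree_monomial g" by (simp add: squarefree_monomial_def)
  then obtain M where M: "M \<subseteq> E" "finite M" "card M = k" "pairwise disjnt M" "\<Union>M \<subseteq> keys g"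
    using Suc.IH[OF _ g(3)] by (auto simp: matched_def)
  have xy: "x \<notin> keys g" "y \<notin> keys g" using le[of x] le[of y] by (auto simp: in_keys_iff split: if_splits)
  have "{x, y} \<notin> M" using M(5) xy by blast
  then have "card (insert {x, y} M) = Suc k" using M by simp
  moreover have "pairwise disjnt (insert {x, y} M)"
    using M(4,5) xy by (auto simp: pairwise_insert disjnt_def)
  moreover have "\<Union>(insert {x, y} M) \<subseteq> keys e"
    using M(5) by (auto simp: g(1) keys_add_monomial)
  ultimately show ?case using M g(2) unfolding matched_def by (auto intro!: exI[of _ "insert {x, y} M"])
qed (simp add: matched_0)

lemma ideals_set_pow:
  "I [^]\<^bsub>ideals_set R\<^esub> (0::nat) = carrier R"
  "I [^]\<^bsub>ideals_set R\<^esub> Suc k = ideal_prod R (I [^]\<^bsub>ideals_set R\<^esub> k) I"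
  by (simp_all add: nat_pow_def ideals_set_def)

context
  fixes G :: "'v graph"
  assumes G: "finite_simple_graph G"
begin

abbreviation (input) edge_pow :: "nat \<Rightarrow> ('v, 'k::field) mpoly set" where
  "edge_pow k \<equiv> edge_ideal G [^]\<^bsub>ideals_set (poly_ring (vertices G))\<^esub> k"

lemma edge_generators_carrier:
  "{indet x * indet y | x y. {x, y} \<in> edges G} \<subseteq> carrier (poly_ring (vertices G) :: ('v, 'k::field) mpoly ring)"
proof
  fix p :: "('v, 'k) mpoly" assume "p \<in> {indet x * indet y | x y. {x, y} \<in> edges G}"
  then obtain x y where p: "p = indet x * indet y" "{x, y} \<in> edges G" by blast
  then have "x \<in> vertices G" "y \<in> vertices G" using G by (auto simp: finite_simple_graph_def)
  then show "p \<in> carrier (poly_ring (vertices G))"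
    by (auto simp: p(1) indet_def mult_single mem_carrier_poly_ring keys_add_monomial)
qed

lemma ideal_edge_ideal: "ideal (edge_ideal G :: ('v, 'k::field) mpoly set) (poly_ring (vertices G))"
  unfolding edge_ideal_def
  by (rule ring.genideal_ideal[OF cring.axioms(1)[OF cring_poly_ring] edge_generators_carrier])

lemma ideal_edge_pow: "ideal (edge_pow k :: ('v, 'k::field) mpoly set) (poly_ring (vertices G))"
proof (induction k)
  case 0
  show ?case unfolding ideals_set_pow by (rule ring.oneideal[OF cring.axioms(1)[OF cring_poly_ring]])
next
  case (Suc k)
  show ?case unfolding ideals_set_pow
    by (rule ring.ideal_prod_is_ideal[OF cring.axioms(1)[OF cring_poly_ring] Suc ideal_edge_ideal])
qed

lemma edge_pow_subset:
  "(edge_pow k :: ('v, 'k::field) mpoly set) \<subseteq> monomial_span (vertices G) (edge_products (edges G) k)"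
proof (induction k)
  case 0
  show ?case unfolding ideals_set_pow by (auto simp: monomial_span_def)
next
  case (Suc k)
  let ?S = "\<lambda>k. monomial_span (vertices G) (edge_products (edges G) k) :: ('v, 'k) mpoly set"
  have id: "ideal (?S k) (poly_ring (vertices G))" for k
    by (rule ideal_monomial_span[OF edge_products_add])
  have one: "edge_ideal G \<subseteq> ?S 1"
    unfolding edge_ideal_def
  proof (rule ring.genideal_minimal[OF cring.axioms(1)[OF cring_poly_ring] id])
    show "{indet x * indet y | x y. {x, y} \<in> edges G} \<subseteq> ?S 1"
    proof
      fix p :: "('v, 'k) mpoly" assume p: "p \<in> {indet x * indet y | x y. {x, y} \<in> edges G}"
      then obtain x y where xy: "p = indet x * indet y" "{x, y} \<in> edges G" by blast
      have "single x 1 + single y 1 \<in> edge_products (edges G) 1"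
        unfolding One_nat_def edge_products.simps
        by (rule CollectI, rule exI[of _ 0], rule exI[of _ x], rule exI[of _ y]) (use xy(2) in simp)
      then show "p \<in> ?S 1"
        using p edge_generators_carrier xy(1)
        by (auto simp: monomial_span_def indet_def mult_single simp del: edge_products.simps)
    qed
  qed
  show ?case
  proof
    fix p :: "('v, 'k) mpoly" assume "p \<in> edge_pow (Suc k)"
    then show "p \<in> ?S (Suc k)"
      unfolding ideals_set_pow
    proof (induction rule: ideal_prod.induct)
      case (prod i j)
      have i: "i \<in> ?S k" and j: "j \<in> ?S 1" using prod Suc.IH one by auto
      have "keys (i * j) \<subseteq> edge_products (edges G) (Suc k)"
      proof
        fix e assume "e \<in> keys (i * j)"
        then obtain a b where ab: "e = a + b" "a \<in> keys i" "b \<in> keys j" using keys_mult[of i j] by blast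
        have "b \<in> edge_products (edges G) 1" using j ab(3) by (auto simp: monomial_span_def)
        then obtain f x y where b: "b = f + (single x 1 + single y 1)" "{x, y} \<in> edges G"
          by auto
        have "a + f \<in> edge_products (edges G) k"
          using i ab(2) by (intro edge_products_add) (auto simp: monomial_span_def)
        moreover have "e = (a + f) + (single x 1 + single y 1)"
          by (simp only: ab(1) b(1) ac_simps)
        ultimately show "e \<in> edge_products (edges G) (Suc k)" using b(2) by auto
      qed
      moreover have "i \<otimes>\<^bsub>poly_ring (vertices G)\<^esub> j \<in> carrier (poly_ring (vertices G))"
      proof (rule monoid.m_closed[OF ring.is_monoid[OF cring.axioms(1)[OF cring_poly_ring]]])
        show "i \<in> carrier (poly_ring (vertices G))" using i by (simp add: monomial_span_def)
        show "j \<in> carrier (poly_ring (vertices G))" using j unfolding monomial_span_def by blast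
      qed
      ultimately show ?case by (simp add: monomial_span_def poly_ring_simps)
    next
      case (sum s1 s2)
      then show ?case using additive_subgroup.a_closed[OF ideal.axioms(1)[OF id]] by blast
    qed
  qed
qed

lemma matching_edge_pow:
  assumes "finite M" "M \<subseteq> edges G" "pairwise disjnt M"
  shows "single (sqf (\<Union>M)) 1 \<in> (edge_pow (card M) :: ('v, 'k::field) mpoly set)"
  using assms
proof (induction M)
  case empty
  show ?case unfolding card.empty ideals_set_pow by (simp add: sqf_def mem_carrier_poly_ring)
next
  case (insert e M)
  have IH: "single (sqf (\<Union>M)) 1 \<in> (edge_pow (card M) :: ('v, 'k) mpoly set)"
    using insert by (auto simp: pairwise_insert)
  have e: "e \<in> edges G" "card e = 2" using insert.prems G by (auto simp: finite_simple_graph_def)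
  then obtain x y where xy: "e = {x, y}" "x \<noteq> y" by (auto simp: card_2_iff)
  have fin: "finite (\<Union>M)"
  proof -
    have "f \<subseteq> vertices G" if "f \<in> M" for f using G that insert.prems by (auto simp: finite_simple_graph_def)
    then have "\<Union>M \<subseteq> vertices G" by blast
    then show ?thesis using G finite_subset unfolding finite_simple_graph_def by blast
  qed
  have "e \<inter> \<Union>M = {}" using insert.prems(2) insert.hyps(2) by (auto simp: pairwise_insert disjnt_def)
  then have "sqf (\<Union>(insert e M)) = sqf (\<Union>M) + (single x 1 + single y 1)"
    using fin xy by (intro poly_mapping_eqI) (auto simp: lookup_sqf lookup_add lookup_single when_def)
  then have eq: "single (sqf (\<Union>(insert e M))) (1 :: 'k) = single (sqf (\<Union>M)) 1 * (indet x * indet y)"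
    by (simp add: indet_def mult_single)
  have "indet x * indet y \<in> (edge_ideal G :: ('v, 'k) mpoly set)"
    unfolding edge_ideal_def using ring.genideal_self[OF cring.axioms(1)[OF cring_poly_ring] edge_generators_carrier] e(1) xy(1)
    by blast
  from ideal_prod.prod[OF IH this, of "poly_ring (vertices G)"]
  show ?case
    unfolding eq card_insert_disjoint[OF insert.hyps] ideals_set_pow by (simp only: poly_ring_simps)
qed

lemma ideal_monomial_mult:
  fixes I :: "('v, 'k::field) mpoly set"
  assumes I: "ideal I (poly_ring V)" and F: "single (sqf F) 1 \<in> I" "F \<subseteq> keys e" "keys e \<subseteq> V"
  shows "single e 1 \<in> I"
proof -
  have "single (e - sqf F) 1 \<in> carrier (poly_ring V :: ('v, 'k) mpoly ring)"
    using F(3) by (auto simp: mem_carrier_poly_ring in_keys_iff lookup_minus)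
  from ideal.I_l_closed[OF I F(1) this]
  show ?thesis by (simp add: poly_ring_simps mult_single sqf_diff_add[OF F(2)])
qed

text \<open>A square-free monomial of the power contains a k-matching by
  \<open>squarefree_edge_products\<close>. Conversely, a monomial whose support contains one is a
  multiple of the square-free monomial on its support, which is a generator by
  \<open>matching_edge_pow\<close>.\<close>

lemma squarefree_power_eq:
  "(squarefree_power G k :: ('v, 'k::field) mpoly set) = monomial_span (vertices G) {e. keys e \<in> matched (edges G) k}"
proof
  let ?R = "poly_ring (vertices G) :: ('v, 'k) mpoly ring"
  let ?gen = "{u. \<exists>e. u = single e 1 \<and> squarefree_monomial e \<and> u \<in> edge_pow k} :: ('v, 'k) mpoly set"
  let ?S = "monomial_span (vertices G) {e. keys e \<in> matched (edges G) k} :: ('v, 'k) mpoly set"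
  have ring: "ring ?R" by (rule cring.axioms(1)[OF cring_poly_ring])
  have gen: "?gen \<subseteq> carrier ?R"
    using additive_subgroup.a_subset[OF ideal.axioms(1)[OF ideal_edge_pow[of k]]] by blast
  show "squarefree_power G k \<subseteq> ?S"
    unfolding squarefree_power_def
  proof (rule ring.genideal_minimal[OF ring ideal_monomial_span])
    show "e + f \<in> {e. keys e \<in> matched (edges G) k}" if "e \<in> {e. keys e \<in> matched (edges G) k}"
      for e f :: "'v monomial"
    proof -
      have "keys e \<subseteq> keys (e + f)" by (auto simp: keys_add_monomial)
      then show ?thesis using upsetD[OF upset_matched] that by blast
    qed
    show "?gen \<subseteq> ?S"
    proof
      fix u assume "u \<in> ?gen"
      then obtain e where e: "u = single e 1" "squarefree_monomial e" "u \<in> edge_pow k" by blast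
      then have "u \<in> monomial_span (vertices G) (edge_products (edges G) k)" using edge_pow_subset by blast
      then have "u \<in> carrier ?R" "e \<in> edge_products (edges G) k" using e(1) by (auto simp: monomial_span_def)
      then show "u \<in> ?S" using squarefree_edge_products[OF e(2)] e(1) by (simp add: monomial_span_def)
    qed
  qed
  have id: "ideal (squarefree_power G k :: ('v, 'k) mpoly set) ?R"
    unfolding squarefree_power_def by (rule ring.genideal_ideal[OF ring gen])
  show "?S \<subseteq> squarefree_power G k"
  proof (rule monomial_span_subset[OF id])
    fix e :: "'v monomial" assume "e \<in> {e. keys e \<in> matched (edges G) k}" and e: "keys e \<subseteq> vertices G"
    then obtain M where M: "M \<subseteq> edges G" "finite M" "card M = k" "pairwise disjnt M" "\<Union>M \<subseteq> keys e"
      by (auto simp: matched_def)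
    have k: "keys (sqf (keys e)) = keys e" by (rule keys_sqf) simp
    have "single (sqf (keys e)) 1 \<in> (edge_pow k :: ('v, 'k) mpoly set)"
      by (rule ideal_monomial_mult[OF ideal_edge_pow matching_edge_pow[OF M(2,1,4), unfolded M(3)]])
        (use M(5) e k in auto)
    moreover have "squarefree_monomial (sqf (keys e))"
      by (simp add: squarefree_monomial_def lookup_sqf)
    ultimately have "single (sqf (keys e)) 1 \<in> (squarefree_power G k :: ('v, 'k) mpoly set)"
      unfolding squarefree_power_def using ring.genideal_self[OF ring gen] by blast
    then show "single e 1 \<in> (squarefree_power G k :: ('v, 'k) mpoly set)"
      by (rule ideal_monomial_mult[OF id _ order_refl e])
  qed
qed

end

text \<open>Disjoint edges use two vertices each, which bounds a matching by m; the whiskers attain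
  this.\<close>

lemma matching_number_whiskered_cycle:
  assumes m: "3 \<le> m" shows "matching_number (whiskered_cycle m) = m"
  unfolding matching_number_def
proof (rule Max_eqI)
  let ?G = "whiskered_cycle m"
  note G = finite_simple_graph_whiskered_cycle[OF m]
  have "edges ?G \<subseteq> Pow (vertices ?G)" using G by (auto simp: finite_simple_graph_def)
  then have finE: "finite (edges ?G)" using G finite_subset unfolding finite_simple_graph_def by blast
  have "{card M | M. is_matching ?G M} \<subseteq> card ` Pow (edges ?G)" by (auto simp: is_matching_def)
  then show "finite {card M | M. is_matching ?G M}" using finE finite_subset by blast
  show "n \<le> m" if "n \<in> {card M | M. is_matching ?G M}" for n
  proof -
    from that obtain M where "n = card M" "is_matching ?G M" by blast
    then have M: "n = card M" "M \<subseteq> edges ?G" "pairwise disjnt M" by (auto simp: is_matching_def)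
    have "\<Union>M \<subseteq> vertices ?G" using M(2) G by (auto simp: finite_simple_graph_def)
    then have "vertices ?G \<in> matched (edges ?G) n"
      using M finite_subset[OF M(2) finE] unfolding matched_def by blast
    moreover have "card e = 2" if "e \<in> edges ?G" for e using G that by (simp add: finite_simple_graph_def)
    moreover have "finite (vertices ?G)" using G by (simp add: finite_simple_graph_def)
    ultimately have "2 * n \<le> card (vertices ?G)" using matched_card by blast
    then show ?thesis by (simp add: whiskered_cycle_block card_block)
  qed
  let ?M = "(\<lambda>i. {X i, Y i}) ` {1..m}"
  have "card ?M = m" by (subst card_image) (auto simp: inj_on_def doubleton_eq_iff)
  moreover have "is_matching ?G ?M"
    by (auto simp: is_matching_def whiskered_cycle_def pairwise_def disjnt_def)
  ultimately show "m \<in> {card M | M. is_matching ?G M}" by force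
qed

theorem corollary5p3:
  fixes m :: nat and G :: "whisker_vertex graph"
  assumes "m \<ge> 3" and "G = whiskered_cycle m"
  shows "matching_number G = m \<and>
    (\<forall>k::nat. 1 \<le> k \<and> k \<le> matching_number G \<longrightarrow>
       2 * int k + \<lfloor>(real m - real k - 1) / 2\<rfloor>
         \<le> regularity (vertices G) (squarefree_power G k :: (whisker_vertex, 'k::field) mpoly set) \<and>
       regularity (vertices G) (squarefree_power G k :: (whisker_vertex, 'k::field) mpoly set)
         \<le> 2 * int k + \<lfloor>(real m - real k) / 2\<rfloor>)"
proof -
  have G: "finite_simple_graph G" and V: "vertices G = block 1 (Suc m)" and \<nu>: "matching_number G = m"
    using assms finite_simple_graph_whiskered_cycle whiskered_cycle_block matching_number_whiskered_cycle
    by auto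
  interpret whiskered "vertices G" "TYPE('k)"
    by unfold_locales (use G in \<open>simp add: finite_simple_graph_def\<close>)
  \<comment> \<open>Integer division rounds down like the floor, also at the value -1 that occurs
    for k = m.\<close>
  have fl: "\<lfloor>(real m - real k - 1) / 2\<rfloor> = (int m - int k - 1) div 2"
    "\<lfloor>(real m - real k) / 2\<rfloor> = (int m - int k) div 2" for k
    using floor_divide_of_int_eq[of "int m - int k - 1" 2, where 'a = real]
      floor_divide_of_int_eq[of "int m - int k" 2, where 'a = real] by simp_all
  have "2 * int k + (int m - int k - 1) div 2
         \<le> regularity (vertices G) (squarefree_power G k :: (whisker_vertex, 'k) mpoly set) \<and>
       regularity (vertices G) (squarefree_power G k :: (whisker_vertex, 'k) mpoly set)
         \<le> 2 * int k + (int m - int k) div 2" if k: "1 \<le> k" "k \<le> m" for k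
  proof -
    obtain S i where S: "S \<subseteq> vertices G" "\<not> acyclic_at (matched (edges G) k) S i"
      "2 * int k + (int m - int k - 1) div 2 \<le> int (card S) - int i"
      using whiskered_cycle_not_acyclic[OF assms(1) V k] unfolding assms(2) by blast
    have reg: "reg_le (vertices G) (matched (edges G) k) (reg_bound m k)"
      using whiskered_cycle_reg_le[OF assms(1) V] unfolding assms(2) .
    show ?thesis
      using regularity_bounds[OF upset_matched reg S(1,2)] S(3)
      unfolding squarefree_power_eq[OF G] reg_bound_def by linarith
  qed
  then show ?thesis unfolding fl \<nu> by blast
qed

end
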